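(* Let $(\mathsf D,(\bullet,\Phi,\phi,\iota),(\circ,\Psi,\psi,\upsilon),\xi)$ be a $\mathsf{Lax}^+_0\mathsf{Oplax}^0_+$-duoidal category. Then: (1) The comonoids in the $\mathsf{Lax}^+\mathsf{Oplax}^0$-monoidal category $(\mathsf D,\bullet,\Phi,\phi,\iota)$ constitute a $\mathsf{Lax}_0\mathsf{Oplax}_+$-monoidal category with the structure $(\circ,\Psi,\psi,\upsilon)$. (2) The monoids in the $\mathsf{Lax}_0\mathsf{Oplax}_+$-monoidal category $(\mathsf D,\circ,\Psi,\psi,\upsilon)$ constitute a $\mathsf{Lax}^+\mathsf{Oplax}^0$-monoidal category with the structure $(\bullet,\Phi,\phi,\iota)$.
   Context: Conventions: $gf$ means first $f$, then $g$ (also for vertical composition of natural transformations); $\cdot$ is composition of functors and Godement product of natural transformations; $1$ denotes any identity; $\mathsf A^n$ is the $n$-fold Cartesian power, $\mathsf A^0=\mathbb 1$ the terminal category, $G^n=G\times\cdots\times G$. For $m\in\mathbb N$: $Z(m)=1$ if $m=0$, $Z(m)=0$ if $m>0$, $\overline m=m+Z(m)$. For $k_1,\dots,k_n\in\mathbb N$: $K=\sum_ik_i$, $Z=\sum_iZ(k_i)$. A $\mathsf{Lax}^+\mathsf{Oplax}^0$-monoidal category $(\mathsf L,\bullet,\Phi,\phi,\iota)$ consists of a category $\mathsf L$; functors $\bullet_n:\mathsf L^n\to\mathsf L$ for $n\ge0$; and, with $[k]:\mathsf L^k\to\mathsf L^{\overline k}$ denoting the identity if $k>0$ and $\bullet_0:\mathbb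 1\to\mathsf L$ if $k=0$, natural transformations, for all $n,k_1,\dots,k_n\ge0$, $\Phi_{k_1,\dots,k_n}:\bullet_n\cdot(\bullet_{k_1}\times\cdots\times\bullet_{k_n})\to\bullet_{K+Z}\cdot([k_1]\times\cdots\times[k_n])$, $\phi_{k_1,\dots,k_n}:\bullet_K\to\bullet_{K+Z}\cdot([k_1]\times\cdots\times[k_n])$, and $\iota:1\to\bullet_1$, such that: (a) $\Phi_{k_1,\dots,k_n}=1$ if $K=0$; $\phi_{k_1,\dots,k_n}=1$ if $Z=0$; $\phi_0=\iota\cdot1$ (sequence of length one with $k_1=0$). (b) $\Phi_n(\iota\cdot1)=1=\Phi_{1,\dots,1}(1\cdot(\iota\times\cdots\times\iota))$ on $\bullet_n$ for $n\ge1$. (c) For all non-negative $n$, $m_i$ ($1\le i\le n$), $k_{ij}$ ($1\le j\le m_i$), put $\vec m=(m_1,\dots,m_n)$, $\vec k_i=(k_{i1},\dots,k_{im_i})$, $\vec k=(k_{11},\dots,k_{nm_n})$, $K_i=\sum_jk_{ij}$, $Z_i=\sum_jZ(k_{ij})$, $K=\sum_iK_i$, and for $1\le i\le n$, $1\le j\le\overline m_i$: $\widetilde k_{ij}=k_{ij}$ if $m_i>0$, $\widetilde k_{ij}=0$ if $m_i=0$; $\widehat k_{ij}=k_{ij}$ if $K_i>0$; $\widehat k_{ij}=1$ if $K_i=0,m_i>0,j=1$; $\widehat k_{ij}=0$ if $K_i=0,m_i>0,j>1$; $\widehat k_{ij}=1$ if $m_i=0$. Let $\widetilde k,\widehat k$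 be these sequences in lexicographic order and $\widetilde Z=\sum_{i,j}Z(\widetilde k_{ij})$. Then, with common codomain $\bullet_{K+\widetilde Z}\cdot\prod_{i,j}[\widetilde k_{ij}]=\bullet_{K+\widetilde Z}\cdot\prod_i[K_i+Z_i]\cdot\prod_{i,j}[k_{ij}]=\bullet_{K+\widetilde Z}\cdot\prod_{i,j}[\widehat k_{ij}]\cdot\prod_i[K_i]$: $\Phi_{\widetilde k}(\Phi_{\vec m}\cdot1)=(\Phi_{K_1+Z_1,\dots,K_n+Z_n}\cdot1)(1\cdot(\Phi_{\vec k_1}\times\cdots\times\Phi_{\vec k_n}))$; $\Phi_{\widetilde k}(\phi_{\vec m}\cdot1)=(\phi_{K_1+Z_1,\dots,K_n+Z_n}\cdot1)\Phi_{\vec k}$; $(\Phi_{K_1+Z_1,\dots,K_n+Z_n}\cdot1)(1\cdot(\phi_{\vec k_1}\times\cdots\times\phi_{\vec k_n}))=(\phi_{\widehat k}\cdot1)\Phi_{K_1,\dots,K_n}$; $(\phi_{K_1+Z_1,\dots,K_n+Z_n}\cdot1)\phi_{\vec k}=(\phi_{\widehat k}\cdot1)\phi_{K_1,\dots,K_n}$. Write $j$ for the object $\bullet_0$ and $a_1\bullet\cdots\bullet a_n=\bullet_n(a_1,\dots,a_n)$. A $\mathsf{Lax}_0\mathsf{Oplax}_+$-monoidal category $(\mathsf R,\circ,\Psi,\psi,\upsilon)$ is one for which $(\mathsf R^{op},\circ^{op},\Psi^{op},\psi^{op},\upsilon^{op})$ is $\mathsf{Lax}^+\mathsf{Oplax}^0$-monoidal;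 so $\Psi_{k_1,\dots,k_n}:\circ_{K+Z}\cdot([k_1]\times\cdots\times[k_n])\to\circ_n\cdot(\circ_{k_1}\times\cdots\times\circ_{k_n})$, $\psi_{k_1,\dots,k_n}:\circ_{K+Z}\cdot([k_1]\times\cdots\times[k_n])\to\circ_K$ (with $[0]=\circ_0$), $\upsilon:\circ_1\to1$. Write $i$ for the object $\circ_0$. A $\mathsf{Lax}^+\mathsf{Oplax}^0$-monoidal functor $(G,\Gamma):\mathsf L\to\mathsf L'$ is a functor $G$ with natural transformations $\Gamma_n:G\cdot\bullet_n\to\bullet'_n\cdot G^n$ ($n\ge0$) such that, with $\langle k\rangle:G^{\overline k}\cdot[k]\to[k]'\cdot G^k$ the identity if $k>0$ and $\Gamma_0$ if $k=0$: $\Gamma_1(1\cdot\iota)=\iota'\cdot1$; $(1\cdot(\langle k_1\rangle\times\cdots\times\langle k_n\rangle))(\Gamma_{K+Z}\cdot1)(1\cdot\Phi_{k_1,\dots,k_n})=(\Phi'_{k_1,\dots,k_n}\cdot1)(1\cdot(\Gamma_{k_1}\times\cdots\times\Gamma_{k_n}))(\Gamma_n\cdot1)$; $(1\cdot(\langle k_1\rangle\times\cdots\times\langle k_n\rangle))(\Gamma_{K+Z}\cdot1)(1\cdot\phi_{k_1,\dots,k_n})=(\phi'_{k_1,\dots,k_n}\cdot1)\Gamma_K$. A $\mathsf{Lax}^+\mathsf{Oplax}^0$-monoidal natural transformation is $\omega:G\to G'$ with $\Gamma'_n(\omega\cdot1)=(1\cdot(\omega\times\cdots\times\omega))\Gamma_n$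 for all $n\ge0$. The composite of $(G,\Gamma)$ followed by $(H,\Xi)$ has structure $(\Xi_n\cdot1)(1\cdot\Gamma_n)$; Cartesian products of such categories and functors have componentwise structure; identity functors have identity structure. A $\mathsf{Lax}^+_0\mathsf{Oplax}^0_+$-duoidal category is a category $\mathsf D$ with a $\mathsf{Lax}^+\mathsf{Oplax}^0$-monoidal structure $(\bullet,\Phi,\phi,\iota)$, a $\mathsf{Lax}_0\mathsf{Oplax}_+$-monoidal structure $(\circ,\Psi,\psi,\upsilon)$, and for all $n,p\ge0$ morphisms natural in the objects $a_{rs}$ ($1\le r\le n$, $1\le s\le p$), $\xi^p_n:\circ_{r=1}^n(\bullet_{s=1}^pa_{rs})\to\bullet_{s=1}^p(\circ_{r=1}^na_{rs})$, such that (a) for each $n\ge0$, $(\circ_n,\{\xi^p_n\}_{p\ge0}):\mathsf D^n\to\mathsf D$ is a $\mathsf{Lax}^+\mathsf{Oplax}^0$-monoidal functor; (b) all $\Psi_{k_1,\dots,k_p}$, $\psi_{k_1,\dots,k_p}$ and $\upsilon$ are $\mathsf{Lax}^+\mathsf{Oplax}^0$-monoidal natural transformations. A comonoid in $(\mathsf L,\bullet,\Phi,\phi,\iota)$ is an object $a$ with $\delta:a\to a\bullet a$, $\varepsilon:a\to j$ such that $\Phi_{2,1}(\delta\bullet\iota_a)\delta=\Phi_{1,2}(\iota_a\bullet\delta)\delta$, $(\varepsilon\bullet1)\delta=\phi_{0,1}\iota_a$, $(1\bullet\varepsilon)\delta=\phi_{1,0}\iota_a$; morphisms are $f:a\to a'$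 with $\delta'f=(f\bullet f)\delta$, $\varepsilon'f=\varepsilon$. A monoid in $(\mathsf R,\circ,\Psi,\psi,\upsilon)$ is an object $a$ with $\mu:a\circ a\to a$, $\eta:i\to a$ such that $\mu(\mu\circ\upsilon_a)\Psi_{2,1}=\mu(\upsilon_a\circ\mu)\Psi_{1,2}$, $\mu(\eta\circ1)=\upsilon_a\psi_{0,1}$, $\mu(1\circ\eta)=\upsilon_a\psi_{1,0}$; morphisms are $f$ with $f\mu=\mu'(f\circ f)$, $f\eta=\eta'$. Meaning of "with the structure": in (1), for $n\ge0$ and comonoids $(a_r,\delta_r,\varepsilon_r)$, $1\le r\le n$, the object $\circ_n(a_1,\dots,a_n)$ is a comonoid with comultiplication $\xi^2_n\,\circ_n(\delta_1,\dots,\delta_n)$ and counit $\xi^0_n\,\circ_n(\varepsilon_1,\dots,\varepsilon_n)$; this together with $\circ_n$ on morphisms gives the $n$-fold product functors, and the components of $\Psi,\psi,\upsilon$ at comonoids provide the coherence transformations. In (2), for monoids $(a_r,\mu_r,\eta_r)$ the object $\bullet_n(a_1,\dots,a_n)$ is a monoid with multiplication $\bullet_n(\mu_1,\dots,\mu_n)\,\xi^n_2$ and unit $\bullet_n(\eta_1,\dots,\eta_n)\,\xi^n_0$, and the components of $\Phi,\phi,\iota$ at monoids provide the coherence transformations. *)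

theory Defs
  imports Main
begin

section \<open>Categories, functors, natural transformations\<close>

record ('o, 'm) cat =
  Ob :: "'o set"
  Arr :: "'m set"
  Dom :: "'m \<Rightarrow> 'o"
  Cod :: "'m \<Rightarrow> 'o"
  Ide :: "'o \<Rightarrow> 'm"
  Cmp :: "'m \<Rightarrow> 'm \<Rightarrow> 'm" (infixr "\<cdot>\<index>" 70)

definition in_hom :: "('o, 'm) cat \<Rightarrow> 'm \<Rightarrow> 'o \<Rightarrow> 'o \<Rightarrow> bool" where
  "in_hom C f a b \<longleftrightarrow> f \<in> Arr C \<and> Dom C f = a \<and> Cod C f = b"

text \<open>\<open>g \<cdot> f\<close> means first \<open>f\<close>, then \<open>g\<close>.\<close>

locale category =
  fixes C :: "('o, 'm) cat" (structure)
  assumes dom_in: "f \<in> Arr C \<Longrightarrow> Dom C f \<in> Ob C"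
    and cod_in: "f \<in> Arr C \<Longrightarrow> Cod C f \<in> Ob C"
    and ide_in_hom: "a \<in> Ob C \<Longrightarrow> in_hom C (Ide C a) a a"
    and cmp_in_hom: "in_hom C f a b \<Longrightarrow> in_hom C g b c \<Longrightarrow> in_hom C (g \<cdot> f) a c"
    and ide_left: "in_hom C f a b \<Longrightarrow> Ide C b \<cdot> f = f"
    and ide_right: "in_hom C f a b \<Longrightarrow> f \<cdot> Ide C a = f"
    and assoc: "in_hom C f a b \<Longrightarrow> in_hom C g b c \<Longrightarrow> in_hom C h c d
      \<Longrightarrow> h \<cdot> (g \<cdot> f) = (h \<cdot> g) \<cdot> f"

definition op_cat :: "('o, 'm) cat \<Rightarrow> ('o, 'm) cat" where
  "op_cat C = \<lparr>Ob = Ob C, Arr = Arr C, Dom = Cod C, Cod = Dom C, Ide = Ide C,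
     Cmp = (\<lambda>g f. f \<cdot>\<^bsub>C\<^esub> g)\<rparr>"

definition prod_cat :: "('o, 'm) cat list \<Rightarrow> ('o list, 'm list) cat" where
  "prod_cat Cs =
    \<lparr>Ob = {as. list_all2 (\<lambda>C a. a \<in> Ob C) Cs as},
     Arr = {fs. list_all2 (\<lambda>C f. f \<in> Arr C) Cs fs},
     Dom = map2 Dom Cs,
     Cod = map2 Cod Cs,
     Ide = map2 Ide Cs,
     Cmp = (\<lambda>gs fs. map (\<lambda>(C, g, f). g \<cdot>\<^bsub>C\<^esub> f) (zip Cs (zip gs fs)))\<rparr>"

abbreviation pow_cat :: "('o, 'm) cat \<Rightarrow> nat \<Rightarrow> ('o list, 'm list) cat" where
  "pow_cat C n \<equiv> prod_cat (replicate n C)"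

record ('a, 'f, 'b, 'g) funct =
  fobj :: "'a \<Rightarrow> 'b"
  farr :: "'f \<Rightarrow> 'g"

definition is_functor :: "('a, 'f) cat \<Rightarrow> ('b, 'g) cat \<Rightarrow> ('a, 'f, 'b, 'g) funct \<Rightarrow> bool" where
  "is_functor A B F \<longleftrightarrow>
     (\<forall>a \<in> Ob A. fobj F a \<in> Ob B \<and> farr F (Ide A a) = Ide B (fobj F a)) \<and>
     (\<forall>f \<in> Arr A. in_hom B (farr F f) (fobj F (Dom A f)) (fobj F (Cod A f))) \<and>
     (\<forall>f \<in> Arr A. \<forall>g \<in> Arr A. Dom A g = Cod A f \<longrightarrow>
        farr F (g \<cdot>\<^bsub>A\<^esub> f) = farr F g \<cdot>\<^bsub>B\<^esub> farr F f)"

definition idF :: "('a, 'f, 'a, 'f) funct" where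
  "idF = \<lparr>fobj = (\<lambda>a. a), farr = (\<lambda>f. f)\<rparr>"

definition compF :: "('b, 'g, 'c, 'h) funct \<Rightarrow> ('a, 'f, 'b, 'g) funct \<Rightarrow> ('a, 'f, 'c, 'h) funct"
    (infixr "\<odot>" 70) where
  "G \<odot> F = \<lparr>fobj = fobj G \<circ> fobj F, farr = farr G \<circ> farr F\<rparr>"

definition prodF :: "('a, 'f, 'b, 'g) funct list \<Rightarrow> ('a list, 'f list, 'b list, 'g list) funct" where
  "prodF Fs = \<lparr>fobj = map2 fobj Fs, farr = map2 farr Fs\<rparr>"

text \<open>The identifications \<open>A \<rightarrow> A\<^sup>1\<close> and
  \<open>A\<^bsup>k(1)\<^esup> \<times> \<dots> \<times> A\<^bsup>k(n)\<^esup> \<rightarrow> A\<^bsup>k(1) + \<dots> + k(n)\<^esup>\<close>.\<close>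

definition singF :: "('a, 'f, 'a list, 'f list) funct" where
  "singF = \<lparr>fobj = (\<lambda>a. [a]), farr = (\<lambda>f. [f])\<rparr>"

definition concatF :: "('a list list, 'f list list, 'a list, 'f list) funct" where
  "concatF = \<lparr>fobj = concat, farr = concat\<rparr>"

definition nat_trans :: "('a, 'f) cat \<Rightarrow> ('b, 'g) cat \<Rightarrow>
    ('a, 'f, 'b, 'g) funct \<Rightarrow> ('a, 'f, 'b, 'g) funct \<Rightarrow> ('a \<Rightarrow> 'g) \<Rightarrow> bool" where
  "nat_trans A B F G \<tau> \<longleftrightarrow>
     (\<forall>a \<in> Ob A. in_hom B (\<tau> a) (fobj F a) (fobj G a)) \<and>
     (\<forall>f \<in> Arr A. \<tau> (Cod A f) \<cdot>\<^bsub>B\<^esub> farr F f = farr G f \<cdot>\<^bsub>B\<^esub> \<tau> (Dom A f))"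


section \<open>Monoidal categories of type Lax-plus Oplax-zero and Lax-zero Oplax-plus\<close>

text \<open>
  The record holds the data \<open>(\<bullet>, \<Phi>, \<phi>, \<iota>)\<close>. The fields \<open>tens\<close> and \<open>tensm\<close> are the object and
  arrow parts of all functors \<open>\<bullet>\<^sub>n\<close> at once, \<open>n\<close> being the length of the argument.
  Likewise \<open>lax\<close> (\<open>\<Phi>\<close>) and \<open>opl\<close> (\<open>\<phi>\<close>) take an object of
  \<open>L\<^bsup>k(1)\<^esup> \<times> \<dots> \<times> L\<^bsup>k(n)\<^esup>\<close>, a list of \<open>n\<close> lists whose lengths are the indices
  \<open>k(1), \<dots>, k(n)\<close>, and return the component there.
\<close>

record ('o, 'm) str =
  tens :: "'o list \<Rightarrow> 'o"
  tensm :: "'m list \<Rightarrow> 'm"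
  lax :: "'o list list \<Rightarrow> 'm"
  opl :: "'o list list \<Rightarrow> 'm"
  unt :: "'o \<Rightarrow> 'm"

definition tensF :: "('o, 'm) str \<Rightarrow> ('o list, 'm list, 'o, 'm) funct" where
  "tensF S = \<lparr>fobj = tens S, farr = tensm S\<rparr>"

definition Zn :: "nat \<Rightarrow> nat" where
  "Zn m = (if m = 0 then 1 else 0)"

text \<open>\<open>bracketF S\<close> is the functor \<open>[k]\<close> for every \<open>k\<close>, again the length of the argument.\<close>

definition bracket :: "('a list \<Rightarrow> 'a) \<Rightarrow> 'a list \<Rightarrow> 'a list" where
  "bracket t as = (if as = [] then [t []] else as)"

definition bracketF :: "('o, 'm) str \<Rightarrow> ('o list, 'm list, 'o list, 'm list) funct" where
  "bracketF S = \<lparr>fobj = bracket (tens S), farr = bracket (tensm S)\<rparr>"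

definition spread :: "('a list \<Rightarrow> 'a) \<Rightarrow> 'a list list \<Rightarrow> 'a list" where
  "spread t ass = concat (map (bracket t) ass)"

text \<open>
  For a block \<open>(a(j,1), \<dots>, a(j,k(j)))\<close>, \<open>1 \<le> j \<le> m\<close>, \<open>tilde\<close> and \<open>hat\<close> give the lists whose
  lengths are the modified indices \<open>k~(j)\<close> and \<open>k^(j)\<close>; the new entries created by
  \<open>k^(j) = 1\<close> are filled with the object \<open>\<bullet>\<^sub>0\<close>, which is what the functor \<open>[0]\<close> puts there.
\<close>

definition tilde :: "'a list list \<Rightarrow> 'a list list" where
  "tilde as = (if as = [] then [[]] else as)"

definition hat :: "('a list \<Rightarrow> 'a) \<Rightarrow> 'a list list \<Rightarrow> 'a list list" where
  "hat t as =
     (if concat as \<noteq> [] then as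
      else if as \<noteq> [] then [t []] # replicate (length as - 1) []
      else [[t []]])"

locale lax_plus_oplax_zero = category C
  for C :: "('o, 'm) cat" (structure) +
  fixes S :: "('o, 'm) str"
  assumes tens_functor: "is_functor (pow_cat C n) C (tensF S)"
    and lax_nat: "nat_trans (prod_cat (map (pow_cat C) ks)) C
      (tensF S \<odot> prodF (replicate (length ks) (tensF S)))
      (tensF S \<odot> concatF \<odot> prodF (replicate (length ks) (bracketF S)))
      (lax S)"
    and opl_nat: "nat_trans (prod_cat (map (pow_cat C) ks)) C
      (tensF S \<odot> concatF)
      (tensF S \<odot> concatF \<odot> prodF (replicate (length ks) (bracketF S)))
      (opl S)"
    and unt_nat: "nat_trans C C idF (tensF S \<odot> singF) (unt S)"
    and lax_trivial: "concat ass = [] \<Longrightarrow>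
      lax S ass = Ide C (tens S (map (tens S) ass))"
    and opl_trivial: "concat ass \<in> lists (Ob C) \<Longrightarrow> [] \<notin> set ass \<Longrightarrow>
      opl S ass = Ide C (tens S (concat ass))"
    and opl_zero: "opl S [[]] = unt S (tens S [])"
    and lax_unt_outer: "as \<in> lists (Ob C) \<Longrightarrow> as \<noteq> [] \<Longrightarrow>
      lax S [as] \<cdot> unt S (tens S as) = Ide C (tens S as)"
    and lax_unt_inner: "as \<in> lists (Ob C) \<Longrightarrow> as \<noteq> [] \<Longrightarrow>
      lax S (map (\<lambda>a. [a]) as) \<cdot> tensm S (map (unt S) as) = Ide C (tens S as)"
    and lax_lax: "concat (concat asss) \<in> lists (Ob C) \<Longrightarrow>
      lax S (concat (map tilde asss)) \<cdot> lax S (map (map (tens S)) asss) =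
      lax S (map (spread (tens S)) asss) \<cdot> tensm S (map (lax S) asss)"
    and lax_opl: "concat (concat asss) \<in> lists (Ob C) \<Longrightarrow>
      lax S (concat (map tilde asss)) \<cdot> opl S (map (map (tens S)) asss) =
      opl S (map (spread (tens S)) asss) \<cdot> lax S (concat asss)"
    and opl_lax: "concat (concat asss) \<in> lists (Ob C) \<Longrightarrow>
      lax S (map (spread (tens S)) asss) \<cdot> tensm S (map (opl S) asss) =
      opl S (concat (map (hat (tens S)) asss)) \<cdot> lax S (map concat asss)"
    and opl_opl: "concat (concat asss) \<in> lists (Ob C) \<Longrightarrow>
      opl S (map (spread (tens S)) asss) \<cdot> opl S (concat asss) =
      opl S (concat (map (hat (tens S)) asss)) \<cdot> opl S (map concat asss)"

text \<open>The opposite structure consists of the same maps, read in the opposite category.\<close>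

definition lax_zero_oplax_plus :: "('o, 'm) cat \<Rightarrow> ('o, 'm) str \<Rightarrow> bool" where
  "lax_zero_oplax_plus C T \<longleftrightarrow> lax_plus_oplax_zero (op_cat C) T"

text \<open>A list of objects of a product is transposed to act componentwise.\<close>

definition prod_str :: "('o, 'm) str list \<Rightarrow> ('o list, 'm list) str" where
  "prod_str Ss =
    \<lparr>tens = (\<lambda>as. map (\<lambda>r. tens (Ss ! r) (map (\<lambda>a. a ! r) as)) [0..<length Ss]),
     tensm = (\<lambda>fs. map (\<lambda>r. tensm (Ss ! r) (map (\<lambda>f. f ! r) fs)) [0..<length Ss]),
     lax = (\<lambda>ass. map (\<lambda>r. lax (Ss ! r) (map (map (\<lambda>a. a ! r)) ass)) [0..<length Ss]),
     opl = (\<lambda>ass. map (\<lambda>r. opl (Ss ! r) (map (map (\<lambda>a. a ! r)) ass)) [0..<length Ss]),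
     unt = (\<lambda>a. map (\<lambda>r. unt (Ss ! r) (a ! r)) [0..<length Ss])\<rparr>"

abbreviation pow_str :: "('o, 'm) str \<Rightarrow> nat \<Rightarrow> ('o list, 'm list) str" where
  "pow_str S n \<equiv> prod_str (replicate n S)"


section \<open>Monoidal functors and monoidal natural transformations\<close>

text \<open>A pair \<open>(G, \<Gamma>)\<close>, with \<open>\<Gamma> as\<close> the component at \<open>as\<close> of \<open>\<Gamma>\<^sub>n\<close> for \<open>n = length as\<close>.\<close>

type_synonym ('a, 'f, 'b, 'g) mfunct = "('a, 'f, 'b, 'g) funct \<times> ('a list \<Rightarrow> 'g)"

definition angle :: "('b, 'g) cat \<Rightarrow> ('a, 'f, 'b, 'g) mfunct \<Rightarrow> 'a list \<Rightarrow> 'g list" where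
  "angle B = (\<lambda>(G, \<Gamma>) as. if as = [] then [\<Gamma> []] else map (\<lambda>a. Ide B (fobj G a)) as)"

definition monoidal_functor :: "('a, 'f) cat \<Rightarrow> ('a, 'f) str \<Rightarrow> ('b, 'g) cat \<Rightarrow> ('b, 'g) str \<Rightarrow>
    ('a, 'f, 'b, 'g) mfunct \<Rightarrow> bool" where
  "monoidal_functor A S B S' = (\<lambda>(G, \<Gamma>).
     is_functor A B G \<and>
     (\<forall>n. nat_trans (pow_cat A n) B (G \<odot> tensF S) (tensF S' \<odot> prodF (replicate n G)) \<Gamma>) \<and>
     (\<forall>a \<in> Ob A. \<Gamma> [a] \<cdot>\<^bsub>B\<^esub> farr G (unt S a) = unt S' (fobj G a)) \<and>
     (\<forall>ass. concat ass \<in> lists (Ob A) \<longrightarrow>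
        tensm S' (concat (map (angle B (G, \<Gamma>)) ass)) \<cdot>\<^bsub>B\<^esub>
          \<Gamma> (spread (tens S) ass) \<cdot>\<^bsub>B\<^esub> farr G (lax S ass) =
        lax S' (map (map (fobj G)) ass) \<cdot>\<^bsub>B\<^esub>
          tensm S' (map \<Gamma> ass) \<cdot>\<^bsub>B\<^esub> \<Gamma> (map (tens S) ass)) \<and>
     (\<forall>ass. concat ass \<in> lists (Ob A) \<longrightarrow>
        tensm S' (concat (map (angle B (G, \<Gamma>)) ass)) \<cdot>\<^bsub>B\<^esub>
          \<Gamma> (spread (tens S) ass) \<cdot>\<^bsub>B\<^esub> farr G (opl S ass) =
        opl S' (map (map (fobj G)) ass) \<cdot>\<^bsub>B\<^esub> \<Gamma> (concat ass)))"

definition monoidal_nat_trans :: "('a, 'f) cat \<Rightarrow> ('a, 'f) str \<Rightarrow> ('b, 'g) cat \<Rightarrow> ('b, 'g) str \<Rightarrow>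
    ('a, 'f, 'b, 'g) mfunct \<Rightarrow> ('a, 'f, 'b, 'g) mfunct \<Rightarrow> ('a \<Rightarrow> 'g) \<Rightarrow> bool" where
  "monoidal_nat_trans A S B S' = (\<lambda>(G, \<Gamma>) (G', \<Gamma>') \<omega>.
     nat_trans A B G G' \<omega> \<and>
     (\<forall>as \<in> lists (Ob A).
        \<Gamma>' as \<cdot>\<^bsub>B\<^esub> \<omega> (tens S as) = tensm S' (map \<omega> as) \<cdot>\<^bsub>B\<^esub> \<Gamma> as))"

text \<open>The category argument of \<open>compM\<close> is the codomain of the second functor \<open>(H, \<Xi>)\<close>.\<close>

definition compM :: "('c, 'h) cat \<Rightarrow> ('b, 'g, 'c, 'h) mfunct \<Rightarrow> ('a, 'f, 'b, 'g) mfunct \<Rightarrow>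
    ('a, 'f, 'c, 'h) mfunct" where
  "compM E = (\<lambda>(H, \<Xi>) (G, \<Gamma>).
     (H \<odot> G, \<lambda>as. \<Xi> (map (fobj G) as) \<cdot>\<^bsub>E\<^esub> farr H (\<Gamma> as)))"

definition prodM :: "('a, 'f, 'b, 'g) mfunct list \<Rightarrow>
    ('a list, 'f list, 'b list, 'g list) mfunct" where
  "prodM Gs = (prodF (map fst Gs),
     \<lambda>as. map (\<lambda>r. snd (Gs ! r) (map (\<lambda>a. a ! r) as)) [0..<length Gs])"

text \<open>A functor which strictly preserves the tensor products (starting from the structure \<open>S\<close> and
  ending in the category \<open>B\<close>), with identity structure.\<close>

definition strictM :: "('a, 'f) str \<Rightarrow> ('b, 'g) cat \<Rightarrow> ('a, 'f, 'b, 'g) funct \<Rightarrow>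
    ('a, 'f, 'b, 'g) mfunct" where
  "strictM S B F = (F, \<lambda>as. Ide B (fobj F (tens S as)))"


section \<open>Duoidal categories\<close>

text \<open>
  \<open>S\<close> is the structure \<open>(\<bullet>, \<Phi>, \<phi>, \<iota>)\<close> and \<open>T\<close> the structure \<open>(\<circ>, \<Psi>, \<psi>, \<upsilon>)\<close>. The component of
  \<open>\<xi>\<^sup>p\<^sub>n\<close> at the objects \<open>a(r,s)\<close>, \<open>1 \<le> r \<le> n\<close>, \<open>1 \<le> s \<le> p\<close>, is
  \<open>\<xi> n [[a(1,1), \<dots>, a(n,1)], \<dots>, [a(1,p), \<dots>, a(n,p)]]\<close>: its argument is a list of \<open>p\<close> objects
  of \<open>D\<^sup>n\<close>. The index \<open>n\<close> is explicit because it cannot be recovered when \<open>p = 0\<close>.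
\<close>

definition circM :: "('o, 'm) str \<Rightarrow> (nat \<Rightarrow> 'o list list \<Rightarrow> 'm) \<Rightarrow> nat \<Rightarrow>
    ('o list, 'm list, 'o, 'm) mfunct" where
  "circM T \<xi> n = (tensF T, \<xi> n)"

text \<open>The functors \<open>[k]\<close> of the structure \<open>T\<close> as monoidal functors with respect to \<open>S\<close>.\<close>

definition bracketM :: "('o, 'm) cat \<Rightarrow> ('o, 'm) str \<Rightarrow> ('o, 'm) str \<Rightarrow>
    (nat \<Rightarrow> 'o list list \<Rightarrow> 'm) \<Rightarrow> nat \<Rightarrow> ('o list, 'm list, 'o list, 'm list) mfunct" where
  "bracketM C S T \<xi> k =
     (if k = 0 then (bracketF T, \<lambda>as. [\<xi> 0 as])
      else strictM (pow_str S k) (pow_cat C k) idF)"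

definition concatM :: "('o, 'm) cat \<Rightarrow> ('o, 'm) str \<Rightarrow> nat list \<Rightarrow>
    ('o list list, 'm list list, 'o list, 'm list) mfunct" where
  "concatM C S ks =
     strictM (prod_str (map (pow_str S) ks)) (pow_cat C (sum_list ks)) concatF"

text \<open>The composite of \<open>\<circ>\<^sub>K\<^sub>+\<^sub>Z\<close> with the product of the \<open>[k(i)]\<close>, as a monoidal functor.\<close>

definition circ_bracketM :: "('o, 'm) cat \<Rightarrow> ('o, 'm) str \<Rightarrow> ('o, 'm) str \<Rightarrow>
    (nat \<Rightarrow> 'o list list \<Rightarrow> 'm) \<Rightarrow> nat list \<Rightarrow> ('o list list, 'm list list, 'o, 'm) mfunct" where
  "circ_bracketM C S T \<xi> ks =
     (let KZ = sum_list ks + sum_list (map Zn ks)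
      in compM C (circM T \<xi> KZ)
           (compM (pow_cat C KZ) (concatM C S (map (\<lambda>k. k + Zn k) ks))
             (prodM (map (bracketM C S T \<xi>) ks))))"

locale duoidal =
  fixes C :: "('o, 'm) cat"
    and S :: "('o, 'm) str"
    and T :: "('o, 'm) str"
    and \<xi> :: "nat \<Rightarrow> 'o list list \<Rightarrow> 'm"
  assumes bullet: "lax_plus_oplax_zero C S"
    and circ: "lax_zero_oplax_plus C T"
    and circ_monoidal: "monoidal_functor (pow_cat C n) (pow_str S n) C S (circM T \<xi> n)"
    and Psi_monoidal: "monoidal_nat_trans
      (prod_cat (map (pow_cat C) ks)) (prod_str (map (pow_str S) ks)) C S
      (circ_bracketM C S T \<xi> ks)
      (compM C (circM T \<xi> (length ks)) (prodM (map (circM T \<xi>) ks)))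
      (lax T)"
    and psi_monoidal: "monoidal_nat_trans
      (prod_cat (map (pow_cat C) ks)) (prod_str (map (pow_str S) ks)) C S
      (circ_bracketM C S T \<xi> ks)
      (compM C (circM T \<xi> (sum_list ks)) (concatM C S ks))
      (opl T)"
    and upsilon_monoidal: "monoidal_nat_trans C S C S
      (compM C (circM T \<xi> 1) (strictM S (pow_cat C 1) singF))
      (strictM S C idF)
      (unt T)"


section \<open>Comonoids and monoids\<close>

type_synonym ('o, 'm) alg = "'o \<times> 'm \<times> 'm"

text \<open>Arrows carry their source and target, since a single arrow of \<open>C\<close> may be a homomorphism
  for several structures on its domain and codomain.\<close>

definition alg_cat :: "('o, 'm) cat \<Rightarrow> ('o, 'm) alg set \<Rightarrow>
    (('o, 'm) alg \<Rightarrow> 'm \<Rightarrow> ('o, 'm) alg \<Rightarrow> bool) \<Rightarrow>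
    (('o, 'm) alg, ('o, 'm) alg \<times> 'm \<times> ('o, 'm) alg) cat" where
  "alg_cat C X hm =
    \<lparr>Ob = X,
     Arr = {(x, f, y). x \<in> X \<and> y \<in> X \<and> in_hom C f (fst x) (fst y) \<and> hm x f y},
     Dom = (\<lambda>(x, f, y). x),
     Cod = (\<lambda>(x, f, y). y),
     Ide = (\<lambda>x. (x, Ide C (fst x), x)),
     Cmp = (\<lambda>(y, g, z) (x, f, y'). (x, g \<cdot>\<^bsub>C\<^esub> f, z))\<rparr>"

definition comonoids :: "('o, 'm) cat \<Rightarrow> ('o, 'm) str \<Rightarrow> ('o, 'm) alg set" where
  "comonoids C S = {(a, \<delta>, \<epsilon>).
     a \<in> Ob C \<and> in_hom C \<delta> a (tens S [a, a]) \<and> in_hom C \<epsilon> a (tens S []) \<and>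
     lax S [[a, a], [a]] \<cdot>\<^bsub>C\<^esub> tensm S [\<delta>, unt S a] \<cdot>\<^bsub>C\<^esub> \<delta> =
       lax S [[a], [a, a]] \<cdot>\<^bsub>C\<^esub> tensm S [unt S a, \<delta>] \<cdot>\<^bsub>C\<^esub> \<delta> \<and>
     tensm S [\<epsilon>, Ide C a] \<cdot>\<^bsub>C\<^esub> \<delta> = opl S [[], [a]] \<cdot>\<^bsub>C\<^esub> unt S a \<and>
     tensm S [Ide C a, \<epsilon>] \<cdot>\<^bsub>C\<^esub> \<delta> = opl S [[a], []] \<cdot>\<^bsub>C\<^esub> unt S a}"

definition comonoid_hom :: "('o, 'm) cat \<Rightarrow> ('o, 'm) str \<Rightarrow>
    ('o, 'm) alg \<Rightarrow> 'm \<Rightarrow> ('o, 'm) alg \<Rightarrow> bool" where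
  "comonoid_hom C S = (\<lambda>(a, \<delta>, \<epsilon>) f (a', \<delta>', \<epsilon>').
     \<delta>' \<cdot>\<^bsub>C\<^esub> f = tensm S [f, f] \<cdot>\<^bsub>C\<^esub> \<delta> \<and> \<epsilon>' \<cdot>\<^bsub>C\<^esub> f = \<epsilon>)"

abbreviation comonoid_cat where
  "comonoid_cat C S \<equiv> alg_cat C (comonoids C S) (comonoid_hom C S)"

definition monoids :: "('o, 'm) cat \<Rightarrow> ('o, 'm) str \<Rightarrow> ('o, 'm) alg set" where
  "monoids C T = {(a, \<mu>, \<eta>).
     a \<in> Ob C \<and> in_hom C \<mu> (tens T [a, a]) a \<and> in_hom C \<eta> (tens T []) a \<and>
     \<mu> \<cdot>\<^bsub>C\<^esub> tensm T [\<mu>, unt T a] \<cdot>\<^bsub>C\<^esub> lax T [[a, a], [a]] =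
       \<mu> \<cdot>\<^bsub>C\<^esub> tensm T [unt T a, \<mu>] \<cdot>\<^bsub>C\<^esub> lax T [[a], [a, a]] \<and>
     \<mu> \<cdot>\<^bsub>C\<^esub> tensm T [\<eta>, Ide C a] = unt T a \<cdot>\<^bsub>C\<^esub> opl T [[], [a]] \<and>
     \<mu> \<cdot>\<^bsub>C\<^esub> tensm T [Ide C a, \<eta>] = unt T a \<cdot>\<^bsub>C\<^esub> opl T [[a], []]}"

definition monoid_hom :: "('o, 'm) cat \<Rightarrow> ('o, 'm) str \<Rightarrow>
    ('o, 'm) alg \<Rightarrow> 'm \<Rightarrow> ('o, 'm) alg \<Rightarrow> bool" where
  "monoid_hom C T = (\<lambda>(a, \<mu>, \<eta>) f (a', \<mu>', \<eta>').
     f \<cdot>\<^bsub>C\<^esub> \<mu> = \<mu>' \<cdot>\<^bsub>C\<^esub> tensm T [f, f] \<and> f \<cdot>\<^bsub>C\<^esub> \<eta> = \<eta>')"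

abbreviation monoid_cat where
  "monoid_cat C T \<equiv> alg_cat C (monoids C T) (monoid_hom C T)"

text \<open>The comultiplication uses \<open>\<xi>\<^sup>2\<^sub>n\<close> at \<open>a(r,1) = a(r,2) = a(r)\<close> and the counit uses
  \<open>\<xi>\<^sup>0\<^sub>n\<close>. Note that the components of \<open>\<Psi>\<close>, \<open>\<psi>\<close>, \<open>\<upsilon>\<close> run towards the iterated product,
  the plain product and the identity, respectively.\<close>

definition comonoid_tens :: "('o, 'm) cat \<Rightarrow> ('o, 'm) str \<Rightarrow> (nat \<Rightarrow> 'o list list \<Rightarrow> 'm) \<Rightarrow>
    ('o, 'm) alg list \<Rightarrow> ('o, 'm) alg" where
  "comonoid_tens C T \<xi> xs =
     (let n = length xs; as = map fst xs; \<delta>s = map (fst \<circ> snd) xs; \<epsilon>s = map (snd \<circ> snd) xs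
      in (tens T as, \<xi> n [as, as] \<cdot>\<^bsub>C\<^esub> tensm T \<delta>s, \<xi> n [] \<cdot>\<^bsub>C\<^esub> tensm T \<epsilon>s))"

definition comonoid_str :: "('o, 'm) cat \<Rightarrow> ('o, 'm) str \<Rightarrow> (nat \<Rightarrow> 'o list list \<Rightarrow> 'm) \<Rightarrow>
    (('o, 'm) alg, ('o, 'm) alg \<times> 'm \<times> ('o, 'm) alg) str" where
  "comonoid_str C T \<xi> =
     (let t = comonoid_tens C T \<xi>
      in \<lparr>tens = t,
          tensm = (\<lambda>fs. (t (map fst fs), tensm T (map (fst \<circ> snd) fs), t (map (snd \<circ> snd) fs))),
          lax = (\<lambda>xss. (t (spread t xss), lax T (map (map fst) xss), t (map t xss))),
          opl = (\<lambda>xss. (t (spread t xss), opl T (map (map fst) xss), t (concat xss))),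
          unt = (\<lambda>x. (t [x], unt T (fst x), x))\<rparr>)"

text \<open>The multiplication uses \<open>\<xi>\<^sup>n\<^sub>2\<close> at \<open>a(1,s) = a(2,s) = a(s)\<close> and the unit uses \<open>\<xi>\<^sup>n\<^sub>0\<close>.\<close>

definition monoid_tens :: "('o, 'm) cat \<Rightarrow> ('o, 'm) str \<Rightarrow> (nat \<Rightarrow> 'o list list \<Rightarrow> 'm) \<Rightarrow>
    ('o, 'm) alg list \<Rightarrow> ('o, 'm) alg" where
  "monoid_tens C S \<xi> xs =
     (let n = length xs; as = map fst xs; \<mu>s = map (fst \<circ> snd) xs; \<eta>s = map (snd \<circ> snd) xs
      in (tens S as,
          tensm S \<mu>s \<cdot>\<^bsub>C\<^esub> \<xi> 2 (map (\<lambda>a. [a, a]) as),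
          tensm S \<eta>s \<cdot>\<^bsub>C\<^esub> \<xi> 0 (replicate n [])))"

definition monoid_str :: "('o, 'm) cat \<Rightarrow> ('o, 'm) str \<Rightarrow> (nat \<Rightarrow> 'o list list \<Rightarrow> 'm) \<Rightarrow>
    (('o, 'm) alg, ('o, 'm) alg \<times> 'm \<times> ('o, 'm) alg) str" where
  "monoid_str C S \<xi> =
     (let t = monoid_tens C S \<xi>
      in \<lparr>tens = t,
          tensm = (\<lambda>fs. (t (map fst fs), tensm S (map (fst \<circ> snd) fs), t (map (snd \<circ> snd) fs))),
          lax = (\<lambda>xss. (t (map t xss), lax S (map (map fst) xss), t (spread t xss))),
          opl = (\<lambda>xss. (t (concat xss), opl S (map (map fst) xss), t (spread t xss))),
          unt = (\<lambda>x. (x, unt S (fst x), t [x]))\<rparr>)"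

end

theory Submission
  imports Defs
begin

text \<open>
  The argument rests on two observations. The first is that the coherence axioms need not be
  checked again for comonoids and monoids. The category of comonoids has a faithful functor to
  \<open>C\<close>, and the operations on comonoids have those of \<open>C\<close> as underlying morphisms. So the axioms hold as
  soon as the operations are defined: products of comonoids are comonoids, and products of
  homomorphisms and the components of \<open>\<Psi>\<close>, \<open>\<psi>\<close>, \<open>\<upsilon>\<close> are homomorphisms. The locale \<open>strict_lift\<close> makes this
  precise; there the sources and targets of both sides of each axiom are compared, which is a
  computation with lists that does not depend on what the product is.

  The second observation is how the operations lift. For fixed \<open>p\<close> write \<open>D p a\<close> for the \<open>p\<close>-fold product
  \<open>a \<bullet> \<dots> \<bullet> a\<close>. The interchange morphisms at arrays with equal columns are natural morphisms
  \<open>E p : \<circ>\<^sub>n (D p a\<^sub>1, \<dots>, D p a\<^sub>n) \<rightarrow> D p (\<circ>\<^sub>n (a\<^sub>1, \<dots>, a\<^sub>n))\<close>, a distributive law of the second product over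
  the endofunctor \<open>D p\<close>. Monoidality of \<open>\<Psi>\<close>, \<open>\<psi>\<close>, \<open>\<upsilon>\<close> says that they respect this law, and so they are
  homomorphisms of coalgebras for \<open>D p\<close> (\<open>lax_coalgebra_hom\<close>, \<open>opl_coalgebra_hom\<close>, \<open>unt_coalgebra_hom\<close>).
  For \<open>p = 2\<close> and \<open>p = 0\<close> this is compatibility with comultiplications and counits. That a product of
  comonoids satisfies the comonoid axioms (\<open>ctens_comonoid\<close>) follows from the compatibility of \<open>\<xi>\<close> with
  \<open>\<Phi>\<^sub>2\<^sub>,\<^sub>1\<close>, \<open>\<Phi>\<^sub>1\<^sub>,\<^sub>2\<close>, \<open>\<phi>\<^sub>0\<^sub>,\<^sub>1\<close>, \<open>\<phi>\<^sub>1\<^sub>,\<^sub>0\<close> and \<open>\<iota>\<close>, which is part of the monoidality of \<open>\<circ>\<^sub>n\<close>.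

  Part (2) is part (1) in the opposite category with the two products exchanged and the arrays
  transposed: monoids in \<open>C\<close> are comonoids in the opposite category. The facts about \<open>\<xi>\<close> used in (1) are
  collected in the locale \<open>interchange\<close>, whose two instances \<open>comonoid_interchange\<close> and
  \<open>monoid_interchange\<close> are derived from a symmetric description of \<open>\<xi>\<close> on arrays.
\<close>

section \<open>Categories, powers and opposites\<close>

lemma op_cat_simps [simp]:
  "Ob (op_cat C) = Ob C" "Arr (op_cat C) = Arr C" "Dom (op_cat C) = Cod C" "Cod (op_cat C) = Dom C"
  "Ide (op_cat C) = Ide C" "Cmp (op_cat C) g f = Cmp C f g"
  by (simp_all add: op_cat_def)

lemma op_op_cat [simp]: "op_cat (op_cat C) = C"
  by (simp add: op_cat_def)

lemma in_hom_op [simp]: "in_hom (op_cat C) f a b \<longleftrightarrow> in_hom C f b a"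
  by (auto simp: in_hom_def)

context category
begin

lemma in_hom_objs: "in_hom C f a b \<Longrightarrow> a \<in> Ob C \<and> b \<in> Ob C"
  using dom_in cod_in by (auto simp: in_hom_def)

lemma cmp_arr:
  "f \<in> Arr C \<Longrightarrow> g \<in> Arr C \<Longrightarrow> Cod C f = Dom C g \<Longrightarrow> g \<cdot> f \<in> Arr C"
  "f \<in> Arr C \<Longrightarrow> g \<in> Arr C \<Longrightarrow> Cod C f = Dom C g \<Longrightarrow> Dom C (g \<cdot> f) = Dom C f"
  "f \<in> Arr C \<Longrightarrow> g \<in> Arr C \<Longrightarrow> Cod C f = Dom C g \<Longrightarrow> Cod C (g \<cdot> f) = Cod C g"
  using cmp_in_hom [of f "Dom C f" "Cod C f" g "Cod C g"] by (auto simp: in_hom_def)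

lemma assoc_arr:
  "f \<in> Arr C \<Longrightarrow> g \<in> Arr C \<Longrightarrow> h \<in> Arr C \<Longrightarrow> Cod C f = Dom C g \<Longrightarrow> Cod C g = Dom C h \<Longrightarrow>
    (h \<cdot> g) \<cdot> f = h \<cdot> (g \<cdot> f)"
  using assoc [of f "Dom C f" "Cod C f" g "Cod C g" h "Cod C h"] by (auto simp: in_hom_def)

lemma category_op: "category (op_cat C)"
  by unfold_locales
    (auto simp: dom_in cod_in ide_in_hom ide_left ide_right
      intro: cmp_in_hom assoc [symmetric])

end

lemma category_op_iff: "category (op_cat C) \<longleftrightarrow> category C"
  using category.category_op by fastforce

lemma map2_replicate: "length xs = n \<Longrightarrow> map2 f (replicate n c) xs = map (f c) xs"
  by (induction xs arbitrary: n) auto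

lemma list_all2_replicate:
  "list_all2 P (replicate n c) xs \<longleftrightarrow> length xs = n \<and> (\<forall>x \<in> set xs. P c x)"
  by (auto simp: list_all2_conv_all_nth all_set_conv_all_nth)

lemma Ob_pow_cat: "Ob (pow_cat C n) = {as. length as = n \<and> set as \<subseteq> Ob C}"
  by (auto simp: prod_cat_def list_all2_replicate)

lemma Arr_pow_cat: "Arr (pow_cat C n) = {fs. length fs = n \<and> set fs \<subseteq> Arr C}"
  by (auto simp: prod_cat_def list_all2_replicate)

lemma pow_cat_simps [simp]:
  "length fs = n \<Longrightarrow> Dom (pow_cat C n) fs = map (Dom C) fs"
  "length fs = n \<Longrightarrow> Cod (pow_cat C n) fs = map (Cod C) fs"
  "length as = n \<Longrightarrow> Ide (pow_cat C n) as = map (Ide C) as"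
  by (simp_all add: prod_cat_def map2_replicate)

lemma Cmp_pow_cat:
  "length fs = n \<Longrightarrow> length gs = n \<Longrightarrow> Cmp (pow_cat C n) gs fs = map2 (Cmp C) gs fs"
proof (induction n arbitrary: fs gs)
  case (Suc n)
  then show ?case
    by (cases fs; cases gs) (auto simp: prod_cat_def)
qed (simp add: prod_cat_def)

lemma Ob_prod_pow_cat:
  "Ob (prod_cat (map (pow_cat C) ks)) =
    {ass. map length ass = ks \<and> set (concat ass) \<subseteq> Ob C}"
proof -
  have "list_all2 (\<lambda>D a. a \<in> Ob D) (map (pow_cat C) ks) ass \<longleftrightarrow>
      map length ass = ks \<and> set (concat ass) \<subseteq> Ob C" for ass
  proof (induction ks arbitrary: ass)
    case (Cons k ks)
    then show ?case
      by (cases ass) (simp_all add: Ob_pow_cat conj_ac)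
  qed auto
  then show ?thesis by (simp add: prod_cat_def)
qed

lemma Arr_prod_pow_cat:
  "Arr (prod_cat (map (pow_cat C) ks)) =
    {fss. map length fss = ks \<and> set (concat fss) \<subseteq> Arr C}"
proof -
  have "list_all2 (\<lambda>D a. a \<in> Arr D) (map (pow_cat C) ks) fss \<longleftrightarrow>
      map length fss = ks \<and> set (concat fss) \<subseteq> Arr C" for fss
  proof (induction ks arbitrary: fss)
    case (Cons k ks)
    then show ?case
      by (cases fss) (simp_all add: Arr_pow_cat conj_ac)
  qed auto
  then show ?thesis by (simp add: prod_cat_def)
qed

lemma Dom_Cod_prod_pow_cat:
  "Dom (prod_cat (map (pow_cat C) (map length fss))) fss = map (map (Dom C)) fss"
  "Cod (prod_cat (map (pow_cat C) (map length fss))) fss = map (map (Cod C)) fss"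
  by (induction fss) (auto simp: prod_cat_def map2_replicate)

lemma prodF_simps:
  "length as = n \<Longrightarrow> fobj (prodF (replicate n F)) as = map (fobj F) as"
  "length fs = n \<Longrightarrow> farr (prodF (replicate n F)) fs = map (farr F) fs"
  by (simp_all add: prodF_def map2_replicate)

lemma funct_simps [simp]:
  "fobj (tensF S) = tens S" "farr (tensF S) = tensm S"
  "fobj (bracketF S) = bracket (tens S)" "farr (bracketF S) = bracket (tensm S)"
  "fobj concatF = concat" "farr concatF = concat"
  "fobj singF = (\<lambda>a. [a])" "farr singF = (\<lambda>a. [a])"
  "fobj idF = (\<lambda>a. a)" "farr idF = (\<lambda>a. a)"
  "fobj (G \<odot> F) x = fobj G (fobj F x)" "farr (G \<odot> F) y = farr G (farr F y)"
  by (simp_all add: tensF_def bracketF_def concatF_def singF_def idF_def compF_def)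

text \<open>The families of natural transformations indexed by \<open>k\<^sub>1, \<dots>, k\<^sub>n\<close>, with the indices read
  off from the lengths of the arguments.\<close>

lemma nat_trans_prod_pow:
  "(\<forall>ks. nat_trans (prod_cat (map (pow_cat C) ks)) B (F ks) (G ks) \<tau>) \<longleftrightarrow>
    (\<forall>ass. set (concat ass) \<subseteq> Ob C \<longrightarrow>
      in_hom B (\<tau> ass) (fobj (F (map length ass)) ass) (fobj (G (map length ass)) ass)) \<and>
    (\<forall>fss. set (concat fss) \<subseteq> Arr C \<longrightarrow>
      Cmp B (\<tau> (map (map (Cod C)) fss)) (farr (F (map length fss)) fss) =
      Cmp B (farr (G (map length fss)) fss) (\<tau> (map (map (Dom C)) fss)))"
  (is "?L \<longleftrightarrow> ?R1 \<and> ?R2")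
proof
  assume L: ?L
  show "?R1 \<and> ?R2"
  proof (intro conjI allI impI)
    fix ass :: "'a list list" assume "set (concat ass) \<subseteq> Ob C"
    then show "in_hom B (\<tau> ass) (fobj (F (map length ass)) ass) (fobj (G (map length ass)) ass)"
      using L [rule_format, of "map length ass"]
      unfolding nat_trans_def Ob_prod_pow_cat by blast
  next
    fix fss :: "'b list list" assume "set (concat fss) \<subseteq> Arr C"
    then show "Cmp B (\<tau> (map (map (Cod C)) fss)) (farr (F (map length fss)) fss) =
        Cmp B (farr (G (map length fss)) fss) (\<tau> (map (map (Dom C)) fss))"
      using L [rule_format, of "map length fss"]
      unfolding nat_trans_def Arr_prod_pow_cat Dom_Cod_prod_pow_cat [symmetric] by blast
  qed
next
  assume R: "?R1 \<and> ?R2"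
  show ?L
    unfolding nat_trans_def
  proof (intro allI conjI ballI)
    fix ks ass assume "ass \<in> Ob (prod_cat (map (pow_cat C) ks))"
    then show "in_hom B (\<tau> ass) (fobj (F ks) ass) (fobj (G ks) ass)"
      using R unfolding Ob_prod_pow_cat by blast
  next
    fix ks fss assume "fss \<in> Arr (prod_cat (map (pow_cat C) ks))"
    then have "set (concat fss) \<subseteq> Arr C" and ks: "ks = map length fss"
      unfolding Arr_prod_pow_cat by blast+
    then show "Cmp B (\<tau> (Cod (prod_cat (map (pow_cat C) ks)) fss)) (farr (F ks) fss) =
        Cmp B (farr (G ks) fss) (\<tau> (Dom (prod_cat (map (pow_cat C) ks)) fss))"
      using R unfolding ks Dom_Cod_prod_pow_cat by blast
  qed
qed

lemma spread_alt: "concat (map (bracket t) ass) = spread t ass"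
  by (simp add: spread_def)

lemma lax_nat_iff:
  "(\<forall>ks. nat_trans (prod_cat (map (pow_cat C) ks)) B
      (tensF S \<odot> prodF (replicate (length ks) (tensF S)))
      (tensF S \<odot> concatF \<odot> prodF (replicate (length ks) (bracketF S))) \<tau>) \<longleftrightarrow>
    (\<forall>ass. set (concat ass) \<subseteq> Ob C \<longrightarrow>
      in_hom B (\<tau> ass) (tens S (map (tens S) ass)) (tens S (spread (tens S) ass))) \<and>
    (\<forall>fss. set (concat fss) \<subseteq> Arr C \<longrightarrow>
      Cmp B (\<tau> (map (map (Cod C)) fss)) (tensm S (map (tensm S) fss)) =
      Cmp B (tensm S (spread (tensm S) fss)) (\<tau> (map (map (Dom C)) fss)))"
  unfolding nat_trans_prod_pow by (simp add: prodF_simps spread_alt)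

lemma opl_nat_iff:
  "(\<forall>ks. nat_trans (prod_cat (map (pow_cat C) ks)) B
      (tensF S \<odot> concatF)
      (tensF S \<odot> concatF \<odot> prodF (replicate (length ks) (bracketF S))) \<tau>) \<longleftrightarrow>
    (\<forall>ass. set (concat ass) \<subseteq> Ob C \<longrightarrow>
      in_hom B (\<tau> ass) (tens S (concat ass)) (tens S (spread (tens S) ass))) \<and>
    (\<forall>fss. set (concat fss) \<subseteq> Arr C \<longrightarrow>
      Cmp B (\<tau> (map (map (Cod C)) fss)) (tensm S (concat fss)) =
      Cmp B (tensm S (spread (tensm S) fss)) (\<tau> (map (map (Dom C)) fss)))"
  unfolding nat_trans_prod_pow by (simp add: prodF_simps spread_alt)

lemma tens_functor_iff:
  "(\<forall>n. is_functor (pow_cat C n) B (tensF S)) \<longleftrightarrow>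
    (\<forall>as. set as \<subseteq> Ob C \<longrightarrow> tens S as \<in> Ob B \<and> tensm S (map (Ide C) as) = Ide B (tens S as)) \<and>
    (\<forall>fs. set fs \<subseteq> Arr C \<longrightarrow>
      in_hom B (tensm S fs) (tens S (map (Dom C) fs)) (tens S (map (Cod C) fs))) \<and>
    (\<forall>fs gs. set fs \<subseteq> Arr C \<longrightarrow> set gs \<subseteq> Arr C \<longrightarrow> map (Dom C) gs = map (Cod C) fs \<longrightarrow>
      tensm S (map2 (Cmp C) gs fs) = Cmp B (tensm S gs) (tensm S fs))"
  (is "?L \<longleftrightarrow> ?R")
proof
  assume L: ?L
  note L' = L[rule_format, unfolded is_functor_def Ob_pow_cat Arr_pow_cat]
  show ?R
  proof (intro conjI allI impI)
    fix fs gs assume h: "set fs \<subseteq> Arr C" "set gs \<subseteq> Arr C" "map (Dom C) gs = map (Cod C) fs"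
    then have len: "length gs = length fs" by (metis length_map)
    show "tensm S (map2 (Cmp C) gs fs) = Cmp B (tensm S gs) (tensm S fs)"
      using L'[of "length fs"] h len by (simp add: Cmp_pow_cat)
  qed (use L' in auto)
next
  assume R: ?R
  show ?L
  proof
    fix n
    show "is_functor (pow_cat C n) B (tensF S)"
      unfolding is_functor_def Ob_pow_cat Arr_pow_cat
      using R by (auto simp: Cmp_pow_cat)
  qed
qed

context lax_plus_oplax_zero
begin

text \<open>Functoriality and naturality are stated for lists of the form \<open>map f is\<close>, so that an arrow
  and its source and target carry the same index.\<close>

lemma tens_ob: "set as \<subseteq> Ob C \<Longrightarrow> tens S as \<in> Ob C"
  using tens_functor tens_functor_iff[of C C S] by blast

lemma tensm_ide:
  assumes "\<And>i. i \<in> set is \<Longrightarrow> x i \<in> Ob C"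
  shows "tensm S (map (\<lambda>i. Ide C (x i)) is) = Ide C (tens S (map x is))"
proof -
  have "set (map x is) \<subseteq> Ob C" using assms by auto
  then have "tensm S (map (Ide C) (map x is)) = Ide C (tens S (map x is))"
    using tens_functor tens_functor_iff[of C C S] by blast
  then show ?thesis by (simp add: comp_def)
qed

lemma tensm_hom:
  assumes "\<And>i. i \<in> set is \<Longrightarrow> in_hom C (f i) (x i) (y i)"
  shows "in_hom C (tensm S (map f is)) (tens S (map x is)) (tens S (map y is))"
proof -
  have "set (map f is) \<subseteq> Arr C" using assms by (auto simp: in_hom_def)
  then have "in_hom C (tensm S (map f is)) (tens S (map (Dom C) (map f is))) (tens S (map (Cod C)
      (map f is)))"
    using tens_functor tens_functor_iff[of C C S] by blast
  moreover have "map (Dom C) (map f is) = map x is" "map (Cod C) (map f is) = map y is"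
    using assms by (auto simp: in_hom_def)
  ultimately show ?thesis by (simp only:)
qed

lemma tensm_cmp:
  assumes "\<And>i. i \<in> set is \<Longrightarrow> in_hom C (f i) (x i) (y i)"
    and "\<And>i. i \<in> set is \<Longrightarrow> in_hom C (g i) (y i) (z i)"
  shows "tensm S (map g is) \<cdot> tensm S (map f is) = tensm S (map (\<lambda>i. g i \<cdot> f i) is)"
proof -
  have "set (map f is) \<subseteq> Arr C" "set (map g is) \<subseteq> Arr C"
    "map (Dom C) (map g is) = map (Cod C) (map f is)"
    using assms by (auto simp: in_hom_def)
  then have "tensm S (map2 (Cmp C) (map g is) (map f is)) = tensm S (map g is) \<cdot> tensm S (map f is)"
    using tens_functor tens_functor_iff[of C C S] by blast
  then show ?thesis by (simp add: zip_map_map zip_same_conv_map comp_def)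
qed

lemma lax_hom: "set (concat ass) \<subseteq> Ob C \<Longrightarrow>
    in_hom C (lax S ass) (tens S (map (tens S) ass)) (tens S (spread (tens S) ass))"
  using lax_nat lax_nat_iff[of C C S "lax S"] by blast

lemma opl_hom: "set (concat ass) \<subseteq> Ob C \<Longrightarrow>
    in_hom C (opl S ass) (tens S (concat ass)) (tens S (spread (tens S) ass))"
  using opl_nat opl_nat_iff[of C C S "opl S"] by blast

lemma unt_hom: "a \<in> Ob C \<Longrightarrow> in_hom C (unt S a) a (tens S [a])"
  using unt_nat by (simp add: nat_trans_def)

lemma lax_natural:
  assumes "\<And>i. i \<in> set (concat iss) \<Longrightarrow> in_hom C (f i) (x i) (y i)"
  shows "lax S (map (map y) iss) \<cdot> tensm S (map (\<lambda>is. tensm S (map f is)) iss) =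
    tensm S (spread (tensm S) (map (map f) iss)) \<cdot> lax S (map (map x) iss)"
proof -
  have "set (concat (map (map f) iss)) \<subseteq> Arr C" using assms by (auto simp: in_hom_def)
  then have "lax S (map (map (Cod C)) (map (map f) iss)) \<cdot>
      tensm S (map (tensm S) (map (map f) iss)) =
    tensm S (spread (tensm S) (map (map f) iss)) \<cdot> lax S (map (map (Dom C)) (map (map f) iss))"
    using lax_nat lax_nat_iff[of C C S "lax S"] by blast
  moreover have "map (map (Dom C)) (map (map f) iss) = map (map x) iss"
    "map (map (Cod C)) (map (map f) iss) = map (map y) iss"
    using assms by (auto simp: in_hom_def)
  ultimately show ?thesis by (simp only: map_map comp_def)
qed

lemma opl_natural:
  assumes "\<And>i. i \<in> set (concat iss) \<Longrightarrow> in_hom C (f i) (x i) (y i)"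
  shows "opl S (map (map y) iss) \<cdot> tensm S (map f (concat iss)) =
    tensm S (spread (tensm S) (map (map f) iss)) \<cdot> opl S (map (map x) iss)"
proof -
  have "set (concat (map (map f) iss)) \<subseteq> Arr C" using assms by (auto simp: in_hom_def)
  then have "opl S (map (map (Cod C)) (map (map f) iss)) \<cdot> tensm S (concat (map (map f) iss)) =
    tensm S (spread (tensm S) (map (map f) iss)) \<cdot> opl S (map (map (Dom C)) (map (map f) iss))"
    using opl_nat opl_nat_iff[of C C S "opl S"] by blast
  moreover have "map (map (Dom C)) (map (map f) iss) = map (map x) iss"
    "map (map (Cod C)) (map (map f) iss) = map (map y) iss"
    using assms by (auto simp: in_hom_def)
  ultimately show ?thesis by (simp only: map_concat)
qed

lemma unt_natural:
  assumes "in_hom C f x y"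
  shows "unt S y \<cdot> f = tensm S [f] \<cdot> unt S x"
  using unt_nat assms by (auto simp: nat_trans_def in_hom_def)

end

section \<open>Lifting a structure along a faithful functor\<close>

lemma set_concat_subset: "set (concat ass) \<subseteq> X \<Longrightarrow> as \<in> set ass \<Longrightarrow> set as \<subseteq> X"
  by auto

text \<open>The identities between lists behind the common sources and targets in the associativity
  axioms; \<open>t\<close> is an arbitrary operation.\<close>

lemma concat_tilde: "concat (concat (map tilde asss)) = concat (concat asss)"
  by (induction asss) (auto simp: tilde_def)

lemma concat_map_concat: "concat (map concat asss) = concat (concat asss)"
  by (induction asss) auto

lemma map_tilde: "map t (concat (map tilde asss)) = spread t (map (map t) asss)"
  by (induction asss) (auto simp: tilde_def spread_def bracket_def)

lemma map_map_tilde: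
  "map (map f) (concat (map tilde asss)) = concat (map tilde (map (map (map f)) asss))"
  by (induction asss) (auto simp: tilde_def)

lemma spread_Nil [simp]: "spread t [] = []"
  by (simp add: spread_def)

lemma spread_Cons: "spread t (as # ass) = bracket t as @ spread t ass"
  by (simp add: spread_def)

lemma spread_append: "spread t (ass @ bss) = spread t ass @ spread t bss"
  by (simp add: spread_def)

lemma spread_concat: "spread t (concat asss) = concat (map (spread t) asss)"
  by (induction asss) (simp_all add: spread_append)

lemma spread_eq_Nil [simp]: "spread t ass = [] \<longleftrightarrow> ass = []"
  by (cases ass) (auto simp: spread_def bracket_def)

lemma spread_tilde: "spread t (concat (map tilde asss)) = spread t (map (spread t) asss)"
proof (induction asss)
  case (Cons ass asss)
  then show ?case
    by (cases "ass = []") (simp_all add: tilde_def spread_Cons spread_append bracket_def)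
qed simp

lemma concat_hat: "concat (concat (map (hat t) asss)) = spread t (map concat asss)"
proof (induction asss)
  case (Cons ass asss)
  then show ?case
    by (cases "concat ass = []") (auto simp: hat_def spread_Cons bracket_def)
qed simp

lemma spread_hat1: "spread t (hat t ass) = bracket t (spread t ass)"
proof (cases "concat ass = []")
  case True
  then have "ass = replicate (length ass) []"
    by (intro replicate_eqI) auto
  then obtain n where "ass = replicate n []" by blast
  then show ?thesis
    by (cases n) (simp_all add: hat_def spread_Cons bracket_def)
next
  case False
  then have "ass \<noteq> []" by auto
  with False show ?thesis
    by (simp add: hat_def bracket_def)
qed

lemma spread_hat: "spread t (concat (map (hat t) asss)) = spread t (map (spread t) asss)"
  by (induction asss) (simp_all add: spread_Cons spread_append spread_hat1)

lemma map_spread_cong: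
  assumes "f (t []) = t' []"
  shows "map f (spread t ass) = spread t' (map (map f) ass)"
  using assms by (induction ass) (auto simp: spread_Cons bracket_def)

lemma map_hat:
  assumes "f (t []) = t' []"
  shows "map (map f) (hat t ass) = hat t' (map (map f) ass)"
  using assms by (auto simp: hat_def map_concat [symmetric])

text \<open>\<open>(U, V)\<close> are the object and arrow parts of a faithful functor \<open>A \<rightarrow> C\<close>, and \<open>R\<close> consists of
  operations on \<open>A\<close> which it maps strictly to those of a structure \<open>S\<close> on \<open>C\<close>. Then \<open>R\<close>
  satisfies the axioms as well: the two sides of each axiom have the same image, so that only
  their sources and targets have to be matched.\<close>

locale strict_lift = C: lax_plus_oplax_zero C S + A: category A
  for C :: "('o, 'm) cat" and S :: "('o, 'm) str" and A :: "('a, 'f) cat" +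
  fixes R :: "('a, 'f) str" and U :: "'a \<Rightarrow> 'o" and V :: "'f \<Rightarrow> 'm"
  assumes U_ob: "a \<in> Ob A \<Longrightarrow> U a \<in> Ob C"
    and V_hom: "in_hom A f a b \<Longrightarrow> in_hom C (V f) (U a) (U b)"
    and V_ide: "a \<in> Ob A \<Longrightarrow> V (Ide A a) = Ide C (U a)"
    and V_cmp: "in_hom A f a b \<Longrightarrow> in_hom A g b c \<Longrightarrow>
      V (g \<cdot>\<^bsub>A\<^esub> f) = V g \<cdot>\<^bsub>C\<^esub> V f"
    and faithful: "in_hom A f a b \<Longrightarrow> in_hom A g a b \<Longrightarrow> V f = V g \<Longrightarrow> f = g"
    and tens_ob: "set as \<subseteq> Ob A \<Longrightarrow> tens R as \<in> Ob A"
    and U_tens: "set as \<subseteq> Ob A \<Longrightarrow> U (tens R as) = tens S (map U as)"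
    and tensm_hom: "set fs \<subseteq> Arr A \<Longrightarrow>
      in_hom A (tensm R fs) (tens R (map (Dom A) fs)) (tens R (map (Cod A) fs))"
    and V_tensm: "set fs \<subseteq> Arr A \<Longrightarrow> V (tensm R fs) = tensm S (map V fs)"
    and lax_hom: "set (concat ass) \<subseteq> Ob A \<Longrightarrow>
      in_hom A (lax R ass) (tens R (map (tens R) ass)) (tens R (spread (tens R) ass))"
    and V_lax: "set (concat ass) \<subseteq> Ob A \<Longrightarrow> V (lax R ass) = lax S (map (map U) ass)"
    and opl_hom: "set (concat ass) \<subseteq> Ob A \<Longrightarrow>
      in_hom A (opl R ass) (tens R (concat ass)) (tens R (spread (tens R) ass))"
    and V_opl: "set (concat ass) \<subseteq> Ob A \<Longrightarrow> V (opl R ass) = opl S (map (map U) ass)"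
    and unt_hom: "a \<in> Ob A \<Longrightarrow> in_hom A (unt R a) a (tens R [a])"
    and V_unt: "a \<in> Ob A \<Longrightarrow> V (unt R a) = unt S (U a)"
begin

lemma U_list: "set as \<subseteq> Ob A \<Longrightarrow> map U as \<in> lists (Ob C)"
  by (auto intro!: U_ob)

lemma U_spread: "map U (spread (tens R) ass) = spread (tens S) (map (map U) ass)"
  by (rule map_spread_cong) (simp add: U_tens)

lemma spread_Ob: "set (concat ass) \<subseteq> Ob A \<Longrightarrow> set (spread (tens R) ass) \<subseteq> Ob A"
  by (auto simp: spread_def bracket_def tens_ob split: if_splits)

lemma U_maps:
  "set (concat ass) \<subseteq> Ob A \<Longrightarrow>
    map U (map (tens R) ass) = map (tens S) (map (map U) ass)"
  using U_tens [OF set_concat_subset] by simp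

lemma tensm_hom_map:
  assumes "\<And>i. i \<in> set is \<Longrightarrow> in_hom A (f i) (x i) (y i)"
  shows "in_hom A (tensm R (map f is)) (tens R (map x is)) (tens R (map y is))"
    and "V (tensm R (map f is)) = tensm S (map (\<lambda>i. V (f i)) is)"
proof -
  have *: "set (map f is) \<subseteq> Arr A" using assms by (auto simp: in_hom_def)
  have "map (Dom A) (map f is) = map x is" "map (Cod A) (map f is) = map y is"
    using assms by (auto simp: in_hom_def)
  with tensm_hom [OF *] show "in_hom A (tensm R (map f is)) (tens R (map x is)) (tens R (map y is))"
    by (simp only:)
  show "V (tensm R (map f is)) = tensm S (map (\<lambda>i. V (f i)) is)"
    using V_tensm [OF *] by (simp add: comp_def)
qed

text \<open>A square in \<open>A\<close> commutes if its image does.\<close>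

lemma square:
  assumes "in_hom A f a b" "in_hom A g b d" "in_hom A f' a b'" "in_hom A g' b' d"
    and "V g \<cdot>\<^bsub>C\<^esub> V f = V g' \<cdot>\<^bsub>C\<^esub> V f'"
  shows "g \<cdot>\<^bsub>A\<^esub> f = g' \<cdot>\<^bsub>A\<^esub> f'"
  using assms by (intro faithful [of _ a d]) (auto simp: V_cmp intro: A.cmp_in_hom)

lemma functor_lifts: "is_functor (pow_cat A n) A (tensF R)"
proof -
  have ide: "tensm R (map (Ide A) as) = Ide A (tens R as)" if "set as \<subseteq> Ob A" for as
  proof (rule faithful)
    have *: "\<And>i. i \<in> set as \<Longrightarrow> in_hom A (Ide A i) i i" using that A.ide_in_hom by auto
    show "in_hom A (tensm R (map (Ide A) as)) (tens R as) (tens R as)"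
      using tensm_hom_map(1) [of as "Ide A" "\<lambda>i. i" "\<lambda>i. i", OF *] by simp
    have "V (tensm R (map (Ide A) as)) = tensm S (map (\<lambda>i. V (Ide A i)) as)"
      using tensm_hom_map(2) [of as "Ide A" "\<lambda>i. i" "\<lambda>i. i", OF *] by simp
    also have "\<dots> = tensm S (map (\<lambda>i. Ide C (U i)) as)"
      using that by (intro arg_cong [of _ _ "tensm S"] map_cong) (auto simp: V_ide)
    also have "\<dots> = Ide C (tens S (map U as))"
      using that by (intro C.tensm_ide) (auto simp: U_ob)
    finally show "V (tensm R (map (Ide A) as)) = V (Ide A (tens R as))"
      using that by (simp add: V_ide tens_ob U_tens)
  qed (use that A.ide_in_hom tens_ob in auto)
  have cmp: "tensm R (map2 (Cmp A) gs fs) = tensm R gs \<cdot>\<^bsub>A\<^esub> tensm R fs"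
    if "set fs \<subseteq> Arr A" "set gs \<subseteq> Arr A" "map (Dom A) gs = map (Cod A) fs" for fs gs
  proof -
    let ?ps = "zip gs fs"
    have len: "length gs = length fs" using that(3) by (metis length_map)
    then have fs: "fs = map snd ?ps" and gs: "gs = map fst ?ps" by simp_all
    have "\<forall>i < length fs. Dom A (gs ! i) = Cod A (fs ! i)"
      using that(3) len by (metis nth_map)
    then have hf: "in_hom A (snd p) (Dom A (snd p)) (Cod A (snd p))"
      and hg: "in_hom A (fst p) (Cod A (snd p)) (Cod A (fst p))" if "p \<in> set ?ps" for p
      using that \<open>set fs \<subseteq> Arr A\<close> \<open>set gs \<subseteq> Arr A\<close> len
      by (auto simp: in_hom_def set_zip)
    note hgf = A.cmp_in_hom [OF hf hg]
    have "tensm R (map (\<lambda>p. fst p \<cdot>\<^bsub>A\<^esub> snd p) ?ps) =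
        tensm R (map fst ?ps) \<cdot>\<^bsub>A\<^esub> tensm R (map snd ?ps)"
    proof (rule faithful)
      have "V (tensm R (map (\<lambda>p. fst p \<cdot>\<^bsub>A\<^esub> snd p) ?ps)) =
          tensm S (map (\<lambda>p. V (fst p \<cdot>\<^bsub>A\<^esub> snd p)) ?ps)"
        by (rule tensm_hom_map(2) [OF hgf])
      also have "\<dots> = tensm S (map (\<lambda>p. V (fst p) \<cdot>\<^bsub>C\<^esub> V (snd p)) ?ps)"
        using V_cmp [OF hf hg] by (intro arg_cong [of _ _ "tensm S"] map_cong) auto
      also have "\<dots> = tensm S (map (\<lambda>p. V (fst p)) ?ps) \<cdot>\<^bsub>C\<^esub> tensm S (map (\<lambda>p. V (snd p)) ?ps)"
        by (rule C.tensm_cmp [symmetric]) (rule V_hom [OF hf], simp, rule V_hom [OF hg], simp)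
      also have "\<dots> = V (tensm R (map fst ?ps)) \<cdot>\<^bsub>C\<^esub> V (tensm R (map snd ?ps))"
        using tensm_hom_map(2) [of ?ps, OF hf] tensm_hom_map(2) [of ?ps, OF hg] by simp
      also have "\<dots> = V (tensm R (map fst ?ps) \<cdot>\<^bsub>A\<^esub> tensm R (map snd ?ps))"
        by (rule V_cmp [symmetric, OF tensm_hom_map(1) [OF hf] tensm_hom_map(1) [OF hg]])
      finally show "V (tensm R (map (\<lambda>p. fst p \<cdot>\<^bsub>A\<^esub> snd p) ?ps)) = \<dots>" .
      show "in_hom A (tensm R (map (\<lambda>p. fst p \<cdot>\<^bsub>A\<^esub> snd p) ?ps))
          (tens R (map (\<lambda>p. Dom A (snd p)) ?ps)) (tens R (map (\<lambda>p. Cod A (fst p)) ?ps))"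
        by (rule tensm_hom_map(1) [OF hgf])
      show "in_hom A (tensm R (map fst ?ps) \<cdot>\<^bsub>A\<^esub> tensm R (map snd ?ps))
          (tens R (map (\<lambda>p. Dom A (snd p)) ?ps)) (tens R (map (\<lambda>p. Cod A (fst p)) ?ps))"
        by (rule A.cmp_in_hom [OF tensm_hom_map(1) [OF hf] tensm_hom_map(1) [OF hg]])
    qed
    then show ?thesis
      by (simp only: fs [symmetric] gs [symmetric] case_prod_unfold)
  qed
  have "\<forall>n. is_functor (pow_cat A n) A (tensF R)"
    unfolding tens_functor_iff using ide cmp tensm_hom tens_ob by blast
  then show ?thesis ..
qed

lemma arrow_lists:
  assumes "set (concat fss) \<subseteq> Arr A"
  shows "i \<in> set (concat fss) \<Longrightarrow> in_hom A i (Dom A i) (Cod A i)"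
    and "set (concat (map (map (Dom A)) fss)) \<subseteq> Ob A"
    and "set (concat (map (map (Cod A)) fss)) \<subseteq> Ob A"
  using assms by (auto simp: in_hom_def intro!: A.dom_in A.cod_in)

lemma V_spread: "map V (spread (tensm R) fss) = spread (tensm S) (map (map V) fss)"
  by (rule map_spread_cong) (simp add: V_tensm)

lemma tensm_spread_hom:
  assumes "set (concat fss) \<subseteq> Arr A"
  shows "in_hom A (tensm R (spread (tensm R) fss))
      (tens R (spread (tens R) (map (map (Dom A)) fss)))
      (tens R (spread (tens R) (map (map (Cod A)) fss)))"
    and "V (tensm R (spread (tensm R) fss)) =
      tensm S (spread (tensm S) (map (map V) fss))"
proof -
  have e: "in_hom A (tensm R []) (tens R []) (tens R [])" using tensm_hom [of "[]"] by simp
  have *: "set (spread (tensm R) fss) \<subseteq> Arr A"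
    using assms e by (auto simp: spread_def bracket_def in_hom_def split: if_splits)
  moreover have "map (Dom A) (spread (tensm R) fss) = spread (tens R) (map (map (Dom A)) fss)"
      "map (Cod A) (spread (tensm R) fss) = spread (tens R) (map (map (Cod A)) fss)"
    using assms e by (auto intro!: map_spread_cong simp: in_hom_def)
  ultimately show "in_hom A (tensm R (spread (tensm R) fss))
      (tens R (spread (tens R) (map (map (Dom A)) fss)))
      (tens R (spread (tens R) (map (map (Cod A)) fss)))"
    using tensm_hom [of "spread (tensm R) fss"] by simp
  show "V (tensm R (spread (tensm R) fss)) = tensm S (spread (tensm S) (map (map V) fss))"
    using V_tensm [OF *] V_spread by simp
qed

lemma lax_naturality_lifts:
  assumes fss: "set (concat fss) \<subseteq> Arr A"
  shows "lax R (map (map (Cod A)) fss) \<cdot>\<^bsub>A\<^esub> tensm R (map (tensm R) fss) =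
    tensm R (spread (tensm R) fss) \<cdot>\<^bsub>A\<^esub> lax R (map (map (Dom A)) fss)"
proof (rule square)
  note obs = arrow_lists [OF fss]
  have in1: "in_hom A (tensm R fs) (tens R (map (Dom A) fs)) (tens R (map (Cod A) fs))"
    if "fs \<in> set fss" for fs
    using that fss by (intro tensm_hom) auto
  show "in_hom A (lax R (map (map (Dom A)) fss)) (tens R (map (tens R) (map (map (Dom A)) fss)))
      (tens R (spread (tens R) (map (map (Dom A)) fss)))"
    using obs by (intro lax_hom) auto
  show "in_hom A (lax R (map (map (Cod A)) fss)) (tens R (map (tens R) (map (map (Cod A)) fss)))
      (tens R (spread (tens R) (map (map (Cod A)) fss)))"
    using obs by (intro lax_hom) auto
  show "in_hom A (tensm R (map (tensm R) fss)) (tens R (map (tens R) (map (map (Dom A)) fss)))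
      (tens R (map (tens R) (map (map (Cod A)) fss)))"
    using tensm_hom_map(1) [of fss, OF in1] by (simp add: comp_def)
  show "in_hom A (tensm R (spread (tensm R) fss))
      (tens R (spread (tens R) (map (map (Dom A)) fss)))
      (tens R (spread (tens R) (map (map (Cod A)) fss)))"
    by (rule tensm_spread_hom(1) [OF fss])
  have "V (tensm R (map (tensm R) fss)) = tensm S (map (\<lambda>fs. V (tensm R fs)) fss)"
    by (rule tensm_hom_map(2) [OF in1])
  also have "\<dots> = tensm S (map (\<lambda>fs. tensm S (map V fs)) fss)"
    using fss by (intro arg_cong [of _ _ "tensm S"] map_cong) (auto intro!: V_tensm)
  finally show "V (lax R (map (map (Cod A)) fss)) \<cdot>\<^bsub>C\<^esub> V (tensm R (map (tensm R) fss)) =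
      V (tensm R (spread (tensm R) fss)) \<cdot>\<^bsub>C\<^esub> V (lax R (map (map (Dom A)) fss))"
    using C.lax_natural [of fss V "U \<circ> Dom A" "U \<circ> Cod A"] V_hom [OF obs(1)]
    by (simp add: V_lax [OF obs(2)] V_lax [OF obs(3)] tensm_spread_hom(2) [OF fss] comp_def)
qed

lemma opl_naturality_lifts:
  assumes fss: "set (concat fss) \<subseteq> Arr A"
  shows "opl R (map (map (Cod A)) fss) \<cdot>\<^bsub>A\<^esub> tensm R (concat fss) =
    tensm R (spread (tensm R) fss) \<cdot>\<^bsub>A\<^esub> opl R (map (map (Dom A)) fss)"
proof (rule square)
  note obs = arrow_lists [OF fss]
  show "in_hom A (opl R (map (map (Dom A)) fss)) (tens R (concat (map (map (Dom A)) fss)))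
      (tens R (spread (tens R) (map (map (Dom A)) fss)))"
    using obs by (intro opl_hom) auto
  show "in_hom A (opl R (map (map (Cod A)) fss)) (tens R (concat (map (map (Cod A)) fss)))
      (tens R (spread (tens R) (map (map (Cod A)) fss)))"
    using obs by (intro opl_hom) auto
  show "in_hom A (tensm R (concat fss)) (tens R (concat (map (map (Dom A)) fss)))
      (tens R (concat (map (map (Cod A)) fss)))"
    using tensm_hom [OF fss] by (simp only: map_concat)
  show "in_hom A (tensm R (spread (tensm R) fss))
      (tens R (spread (tens R) (map (map (Dom A)) fss)))
      (tens R (spread (tens R) (map (map (Cod A)) fss)))"
    by (rule tensm_spread_hom(1) [OF fss])
  show "V (opl R (map (map (Cod A)) fss)) \<cdot>\<^bsub>C\<^esub> V (tensm R (concat fss)) =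
      V (tensm R (spread (tensm R) fss)) \<cdot>\<^bsub>C\<^esub> V (opl R (map (map (Dom A)) fss))"
    using C.opl_natural [of fss V "U \<circ> Dom A" "U \<circ> Cod A"] V_hom [OF obs(1)]
    by (simp add: V_opl [OF obs(2)] V_opl [OF obs(3)] V_tensm [OF fss] tensm_spread_hom(2) [OF fss]
        comp_def)
qed

lemma tensm_lax_hom:
  assumes "set (concat (concat asss)) \<subseteq> Ob A"
  shows "in_hom A (tensm R (map (lax R) asss)) (tens R (map (\<lambda>ass. tens R (map (tens R) ass)) asss))
      (tens R (map (tens R) (map (spread (tens R)) asss)))"
    and "V (tensm R (map (lax R) asss)) = tensm S (map (lax S) (map (map (map U)) asss))"
proof -
  have *: "in_hom A (lax R ass) (tens R (map (tens R) ass)) (tens R (spread (tens R) ass))"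
      "V (lax R ass) = lax S (map (map U) ass)"
    if "ass \<in> set asss" for ass
    using lax_hom V_lax set_concat_subset [of "concat asss"] assms that
        by (auto simp: UN_subset_iff)
  show "in_hom A (tensm R (map (lax R) asss)) (tens R (map (\<lambda>ass. tens R (map (tens R) ass)) asss))
      (tens R (map (tens R) (map (spread (tens R)) asss)))"
    using tensm_hom_map(1) [of asss, OF *(1)] by (simp add: comp_def)
  have "map (\<lambda>ass. V (lax R ass)) asss = map (\<lambda>ass. lax S (map (map U) ass)) asss"
    using *(2) by auto
  then show "V (tensm R (map (lax R) asss)) = tensm S (map (lax S) (map (map (map U)) asss))"
    using tensm_hom_map(2) [of asss, OF *(1)] by (simp only: map_map comp_def)
qed

lemma tensm_opl_hom:
  assumes "set (concat (concat asss)) \<subseteq> Ob A"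
  shows "in_hom A (tensm R (map (opl R) asss)) (tens R (map (tens R) (map concat asss)))
      (tens R (map (tens R) (map (spread (tens R)) asss)))"
    and "V (tensm R (map (opl R) asss)) = tensm S (map (opl S) (map (map (map U)) asss))"
proof -
  have *: "in_hom A (opl R ass) (tens R (concat ass)) (tens R (spread (tens R) ass))"
      "V (opl R ass) = opl S (map (map U) ass)"
    if "ass \<in> set asss" for ass
    using opl_hom V_opl set_concat_subset [of "concat asss"] assms that
        by (auto simp: UN_subset_iff)
  show "in_hom A (tensm R (map (opl R) asss)) (tens R (map (tens R) (map concat asss)))
      (tens R (map (tens R) (map (spread (tens R)) asss)))"
    using tensm_hom_map(1) [of asss, OF *(1)] by (simp add: comp_def)
  have "map (\<lambda>ass. V (opl R ass)) asss = map (\<lambda>ass. opl S (map (map U) ass)) asss"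
    using *(2) by auto
  then show "V (tensm R (map (opl R) asss)) = tensm S (map (opl S) (map (map (map U)) asss))"
    using tensm_hom_map(2) [of asss, OF *(1)] by (simp only: map_map comp_def)
qed

context
  fixes asss
  assumes asss: "set (concat (concat asss)) \<subseteq> Ob A"
begin

lemma Usss: "concat (concat (map (map (map U)) asss)) \<in> lists (Ob C)"
  using U_list [OF asss] by (simp only: map_concat)

lemma Ob_lists:
  "set (concat (map (map (tens R)) asss)) \<subseteq> Ob A"
  "set (concat (map (spread (tens R)) asss)) \<subseteq> Ob A"
  "set (concat (concat (map tilde asss))) \<subseteq> Ob A"
  "set (concat (concat (map (hat (tens R)) asss))) \<subseteq> Ob A"
  "set (concat (map concat asss)) \<subseteq> Ob A"
proof -
  show "set (concat (map (map (tens R)) asss)) \<subseteq> Ob A"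
    using asss by (auto intro!: tens_ob)
  show "set (concat (map (spread (tens R)) asss)) \<subseteq> Ob A"
    using asss spread_Ob [of "concat asss"] by (simp add: spread_concat)
  show "set (concat (concat (map tilde asss))) \<subseteq> Ob A"
    using asss by (simp only: concat_tilde)
  show "set (concat (map concat asss)) \<subseteq> Ob A"
    using asss by auto
  then show "set (concat (concat (map (hat (tens R)) asss))) \<subseteq> Ob A"
    by (simp only: concat_hat spread_Ob)
qed

lemma U_lists:
  "map (map U) (map (map (tens R)) asss) = map (map (tens S)) (map (map (map U)) asss)"
  "map (map U) (map (spread (tens R)) asss) = map (spread (tens S)) (map (map (map U)) asss)"
  "map (map U) (concat (map tilde asss)) = concat (map tilde (map (map (map U)) asss))"
  "map (map U) (concat (map (hat (tens R)) asss)) =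
    concat (map (hat (tens S)) (map (map (map U)) asss))"
  "map (map U) (map concat asss) = map concat (map (map (map U)) asss)"
  "map (map U) (concat asss) = concat (map (map (map U)) asss)"
proof -
  show "map (map U) (map (map (tens R)) asss) = map (map (tens S)) (map (map (map U)) asss)"
    using asss by (auto intro!: U_tens)
  show "map (map U) (map (spread (tens R)) asss) = map (spread (tens S)) (map (map (map U)) asss)"
    by (simp add: U_spread)
  show "map (map U) (concat (map tilde asss)) = concat (map tilde (map (map (map U)) asss))"
    by (rule map_map_tilde)
  show "map (map U) (concat (map (hat (tens R)) asss)) =
    concat (map (hat (tens S)) (map (map (map U)) asss))"
    by (simp add: map_concat comp_def map_hat [of U "tens R" "tens S"] U_tens)
  show "map (map U) (map concat asss) = map concat (map (map (map U)) asss)"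
    by (simp add: map_concat)
  show "map (map U) (concat asss) = concat (map (map (map U)) asss)"
    by (simp add: map_concat)
qed

lemma lax_homs:
  "in_hom A (lax R (concat (map tilde asss))) (tens R (spread (tens R) (map (map (tens R)) asss)))
    (tens R (spread (tens R) (map (spread (tens R)) asss)))"
  "in_hom A (lax R (map (spread (tens R)) asss)) (tens R (map (tens R) (map (spread
      (tens R)) asss)))
    (tens R (spread (tens R) (map (spread (tens R)) asss)))"
  "in_hom A (lax R (map (map (tens R)) asss)) (tens R (map (\<lambda>ass. tens R (map (tens R) ass)) asss))
    (tens R (spread (tens R) (map (map (tens R)) asss)))"
  "in_hom A (lax R (concat asss)) (tens R (concat (map (map (tens R)) asss)))
    (tens R (concat (map (spread (tens R)) asss)))"
  "in_hom A (lax R (map concat asss)) (tens R (map (tens R) (map concat asss)))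
    (tens R (spread (tens R) (map concat asss)))"
  using lax_hom [OF Ob_lists(3), unfolded map_tilde spread_tilde] lax_hom [OF Ob_lists(2)]
    lax_hom [OF Ob_lists(1)] lax_hom [OF asss, unfolded map_concat spread_concat]
    lax_hom [OF Ob_lists(5)]
  by (simp_all add: comp_def)

lemma opl_homs:
  "in_hom A (opl R (map (map (tens R)) asss)) (tens R (concat (map (map (tens R)) asss)))
    (tens R (spread (tens R) (map (map (tens R)) asss)))"
  "in_hom A (opl R (map (spread (tens R)) asss)) (tens R (concat (map (spread (tens R)) asss)))
    (tens R (spread (tens R) (map (spread (tens R)) asss)))"
  "in_hom A (opl R (concat (map (hat (tens R)) asss))) (tens R (spread (tens R) (map concat asss)))
    (tens R (spread (tens R) (map (spread (tens R)) asss)))"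
  "in_hom A (opl R (concat asss)) (tens R (concat (concat asss)))
    (tens R (concat (map (spread (tens R)) asss)))"
  "in_hom A (opl R (map concat asss)) (tens R (concat (concat asss)))
    (tens R (spread (tens R) (map concat asss)))"
  using opl_hom [OF Ob_lists(1)] opl_hom [OF Ob_lists(2)] opl_hom [OF Ob_lists(4), unfolded
      concat_hat spread_hat]
    opl_hom [OF asss, unfolded spread_concat] opl_hom [OF Ob_lists(5)]
  by (simp_all only: concat_map_concat)

lemmas V_laxs = V_lax [OF Ob_lists(1)] V_lax [OF Ob_lists(2)] V_lax [OF Ob_lists(3)]
  V_lax [OF asss] V_lax [OF Ob_lists(5)] V_opl [OF Ob_lists(1)] V_opl [OF Ob_lists(2)]
  V_opl [OF Ob_lists(4)] V_opl [OF asss] V_opl [OF Ob_lists(5)]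
  tensm_lax_hom(2) [OF asss] tensm_opl_hom(2) [OF asss] U_lists

lemma associativities_lift:
  "lax R (concat (map tilde asss)) \<cdot>\<^bsub>A\<^esub> lax R (map (map (tens R)) asss) =
    lax R (map (spread (tens R)) asss) \<cdot>\<^bsub>A\<^esub> tensm R (map (lax R) asss)"
  "lax R (concat (map tilde asss)) \<cdot>\<^bsub>A\<^esub> opl R (map (map (tens R)) asss) =
    opl R (map (spread (tens R)) asss) \<cdot>\<^bsub>A\<^esub> lax R (concat asss)"
  "lax R (map (spread (tens R)) asss) \<cdot>\<^bsub>A\<^esub> tensm R (map (opl R) asss) =
    opl R (concat (map (hat (tens R)) asss)) \<cdot>\<^bsub>A\<^esub> lax R (map concat asss)"
  "opl R (map (spread (tens R)) asss) \<cdot>\<^bsub>A\<^esub> opl R (concat asss) =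
    opl R (concat (map (hat (tens R)) asss)) \<cdot>\<^bsub>A\<^esub> opl R (map concat asss)"
     apply (rule square [OF lax_homs(3) lax_homs(1) tensm_lax_hom(1) [OF asss] lax_homs(2)])
     apply (simp only: V_laxs C.lax_lax [OF Usss])
    apply (rule square [OF opl_homs(1) lax_homs(1) lax_homs(4) opl_homs(2)])
    apply (simp only: V_laxs C.lax_opl [OF Usss])
   apply (rule square [OF tensm_opl_hom(1) [OF asss] lax_homs(2) lax_homs(5) opl_homs(3)])
   apply (simp only: V_laxs C.opl_lax [OF Usss])
  apply (rule square [OF opl_homs(4) opl_homs(2) opl_homs(5) opl_homs(3)])
  apply (simp only: V_laxs C.opl_opl [OF Usss])
  done

end

theorem lax_plus_oplax_zero_lifts: "lax_plus_oplax_zero A R"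
proof
  show "is_functor (pow_cat A n) A (tensF R)" for n
    by (rule functor_lifts)
  show "nat_trans (prod_cat (map (pow_cat A) ks)) A
      (tensF R \<odot> prodF (replicate (length ks) (tensF R)))
      (tensF R \<odot> concatF \<odot> prodF (replicate (length ks) (bracketF R))) (lax R)" for ks
    by (rule lax_nat_iff [THEN iffD2, rule_format])
      (use lax_hom lax_naturality_lifts in blast)
  show "nat_trans (prod_cat (map (pow_cat A) ks)) A (tensF R \<odot> concatF)
      (tensF R \<odot> concatF \<odot> prodF (replicate (length ks) (bracketF R))) (opl R)" for ks
    by (rule opl_nat_iff [THEN iffD2, rule_format])
      (use opl_hom opl_naturality_lifts in blast)
  have unt_nat: "unt R (Cod A f) \<cdot>\<^bsub>A\<^esub> f = tensm R [f] \<cdot>\<^bsub>A\<^esub> unt R (Dom A f)" if f: "f \<in> Arr A" for f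
  proof (rule square)
    show f': "in_hom A f (Dom A f) (Cod A f)" using f by (simp add: in_hom_def)
    show "in_hom A (unt R (Cod A f)) (Cod A f) (tens R [Cod A f])"
      "in_hom A (unt R (Dom A f)) (Dom A f) (tens R [Dom A f])"
      using f A.dom_in A.cod_in unt_hom by auto
    show "in_hom A (tensm R [f]) (tens R [Dom A f]) (tens R [Cod A f])"
      using tensm_hom [of "[f]"] f by simp
    show "V (unt R (Cod A f)) \<cdot>\<^bsub>C\<^esub> V f = V (tensm R [f]) \<cdot>\<^bsub>C\<^esub> V (unt R (Dom A f))"
      using C.unt_natural [OF V_hom [OF f']] f by (simp add: V_unt A.dom_in A.cod_in V_tensm)
  qed
  then show "nat_trans A A idF (tensF R \<odot> singF) (unt R)"
    using unt_hom by (auto simp: nat_trans_def)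
  show "lax R ass = Ide A (tens R (map (tens R) ass))" if e: "concat ass = []" for ass
  proof (rule faithful)
    have ass: "set (concat ass) \<subseteq> Ob A" unfolding e by simp
    have t: "map (tens R) ass = spread (tens R) ass"
      using e by (induction ass) (auto simp: spread_Cons bracket_def)
    have Ob: "set (map (tens R) ass) \<subseteq> Ob A" using ass by (auto intro!: tens_ob)
    show "in_hom A (lax R ass) (tens R (map (tens R) ass)) (tens R (map (tens R) ass))"
      using lax_hom [OF ass] t by simp
    show "in_hom A (Ide A (tens R (map (tens R) ass))) (tens R (map (tens R) ass)) (tens R (map
        (tens R) ass))"
      using Ob by (intro A.ide_in_hom tens_ob)
    have "concat (map (map U) ass) = []" using e by auto
    then show "V (lax R ass) = V (Ide A (tens R (map (tens R) ass)))"
      using C.lax_trivial [of "map (map U) ass"] U_maps [OF ass]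
      by (simp only: V_lax [OF ass] V_ide [OF tens_ob [OF Ob]] U_tens [OF Ob])
  qed
  show "opl R ass = Ide A (tens R (concat ass))"
    if ass': "concat ass \<in> lists (Ob A)" and ne: "[] \<notin> set ass" for ass
  proof (rule faithful)
    have ass: "set (concat ass) \<subseteq> Ob A" using ass' by auto
    have t: "spread (tens R) ass = concat ass"
      using ne by (induction ass) (auto simp: spread_Cons bracket_def)
    show "in_hom A (opl R ass) (tens R (concat ass)) (tens R (concat ass))"
      using opl_hom [OF ass] t by simp
    show "in_hom A (Ide A (tens R (concat ass))) (tens R (concat ass)) (tens R (concat ass))"
      using ass by (intro A.ide_in_hom tens_ob)
    have "concat (map (map U) ass) \<in> lists (Ob C)"
      using U_list [OF ass] by (simp only: map_concat)
    moreover have "[] \<notin> set (map (map U) ass)"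
      using ne by auto
    ultimately show "V (opl R ass) = V (Ide A (tens R (concat ass)))"
      using C.opl_trivial [of "map (map U) ass"]
      unfolding V_opl [OF ass] V_ide [OF tens_ob [OF ass]] U_tens [OF ass] map_concat by blast
  qed
  have e: "tens R [] \<in> Ob A" "U (tens R []) = tens S []"
    by (simp_all add: tens_ob U_tens)
  show "opl R [[]] = unt R (tens R [])"
  proof (rule faithful)
    show "in_hom A (opl R [[]]) (tens R []) (tens R [tens R []])"
      using opl_hom [of "[[]]"] by (simp add: spread_Cons bracket_def)
  qed (use e C.opl_zero in \<open>simp_all add: unt_hom V_opl V_unt\<close>)
  show "lax R [as] \<cdot>\<^bsub>A\<^esub> unt R (tens R as) = Ide A (tens R as)"
    if as': "as \<in> lists (Ob A)" and ne: "as \<noteq> []" for as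
  proof (rule faithful)
    have as: "set as \<subseteq> Ob A" using as' by auto
    have u: "in_hom A (unt R (tens R as)) (tens R as) (tens R [tens R as])"
      by (rule unt_hom [OF tens_ob [OF as]])
    have l: "in_hom A (lax R [as]) (tens R [tens R as]) (tens R as)"
      using lax_hom [of "[as]"] as ne by (simp add: spread_Cons bracket_def)
    show "in_hom A (lax R [as] \<cdot>\<^bsub>A\<^esub> unt R (tens R as)) (tens R as) (tens R as)"
      by (rule A.cmp_in_hom [OF u l])
    show "in_hom A (Ide A (tens R as)) (tens R as) (tens R as)"
      by (rule A.ide_in_hom [OF tens_ob [OF as]])
    have "map U as \<in> lists (Ob C)" by (rule U_list [OF as])
    with C.lax_unt_outer [of "map U as"] as ne
    show "V (lax R [as] \<cdot>\<^bsub>A\<^esub> unt R (tens R as)) = V (Ide A (tens R as))"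
      by (simp add: V_cmp [OF u l] V_lax V_unt tens_ob U_tens V_ide)
  qed
  show "lax R (map (\<lambda>a. [a]) as) \<cdot>\<^bsub>A\<^esub> tensm R (map (unt R) as) = Ide A (tens R as)"
    if as': "as \<in> lists (Ob A)" and ne: "as \<noteq> []" for as
  proof (rule faithful)
    have as: "set as \<subseteq> Ob A" using as' by auto
    have unts: "in_hom A (unt R a) a (tens R [a])" if "a \<in> set as" for a
      using as that by (auto intro: unt_hom)
    have u: "in_hom A (tensm R (map (unt R) as)) (tens R as) (tens R (map (tens R) (map
        (\<lambda>a. [a]) as)))"
      using tensm_hom_map(1) [of as "unt R" "\<lambda>a. a" "\<lambda>a. tens R [a]", OF unts]
          by (simp add: comp_def)
    have c: "concat (map (\<lambda>a. [a]) as) = as" by simp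
    have s: "spread (tens R) (map (\<lambda>a. [a]) as) = as"
      by (induction as) (auto simp: spread_Cons bracket_def)
    have l: "in_hom A (lax R (map (\<lambda>a. [a]) as)) (tens R (map (tens R) (map (\<lambda>a. [a]) as)))
        (tens R as)"
      using lax_hom [of "map (\<lambda>a. [a]) as"] as unfolding s c by blast
    show "in_hom A (lax R (map (\<lambda>a. [a]) as) \<cdot>\<^bsub>A\<^esub> tensm R (map (unt R) as)) (tens R as) (tens R as)"
      by (rule A.cmp_in_hom [OF u l])
    show "in_hom A (Ide A (tens R as)) (tens R as) (tens R as)"
      by (rule A.ide_in_hom [OF tens_ob [OF as]])
    have "V (lax R (map (\<lambda>a. [a]) as)) = lax S (map (\<lambda>a. [a]) (map U as))"
      using V_lax [of "map (\<lambda>a. [a]) as"] as by (simp add: comp_def)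
    moreover have "V (tensm R (map (unt R) as)) = tensm S (map (unt S) (map U as))"
    proof -
      have "map (\<lambda>a. V (unt R a)) as = map (unt S) (map U as)" using as by (auto simp: V_unt)
      then show ?thesis using tensm_hom_map(2) [of as "unt R" "\<lambda>a. a" "\<lambda>a. tens R [a]", OF unts]
          by (simp only:)
    qed
    moreover have "map U as \<in> lists (Ob C)" by (rule U_list [OF as])
    ultimately show "V (lax R (map (\<lambda>a. [a]) as) \<cdot>\<^bsub>A\<^esub> tensm R (map (unt R) as)) =
        V (Ide A (tens R as))"
      using C.lax_unt_inner [of "map U as"] ne
      by (simp only: V_cmp [OF u l] tens_ob [OF as] U_tens [OF as] V_ide map_is_Nil_conv)
        simp
  qed
qed (use associativities_lift in \<open>auto simp: lists_eq_set\<close>)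

end

section \<open>Comonoids and the second tensor product\<close>

context lax_plus_oplax_zero
begin

lemma tensm_two_hom:
  assumes "in_hom C f a b" and "in_hom C g c d"
  shows "in_hom C (tensm S [f, g]) (tens S [a, c]) (tens S [b, d])"
  using tensm_hom [of "[True, False]" "\<lambda>i. if i then f else g" "\<lambda>i. if i then a else c"
      "\<lambda>i. if i then b else d"] assms by simp

lemma tensm_two_cmp:
  assumes "in_hom C f a b" "in_hom C f' b c" "in_hom C g a' b'" "in_hom C g' b' c'"
  shows "tensm S [f', g'] \<cdot> tensm S [f, g] = tensm S [f' \<cdot> f, g' \<cdot> g]"
  using tensm_cmp [of "[True, False]" "\<lambda>i. if i then f else g" "\<lambda>i. if i then a else a'"
      "\<lambda>i. if i then b else b'" "\<lambda>i. if i then f' else g'" "\<lambda>i. if i then c else c'"] assms by simp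

lemma tensm_diag_hom:
  assumes "in_hom C f a b"
  shows "in_hom C (tensm S (replicate p f)) (tens S (replicate p a)) (tens S (replicate p b))"
  using tensm_hom [of "replicate p ()" "\<lambda>_. f" "\<lambda>_. a" "\<lambda>_. b"] assms by simp

lemma tensm_Nil: "tensm S [] = Ide C (tens S [])"
  using tensm_ide [of "[]"] by simp

end

text \<open>The places of the list \<open>spread t (map (map f) iss)\<close>: one for each entry \<open>i\<close>, labelled
  \<open>Some i\<close>, and one for each empty block, labelled \<open>None\<close>. With them a bracketed list is of the
  form \<open>map f xs\<close>, the form in which the functoriality of the tensor products is used.\<close>

definition slots :: "'i list list \<Rightarrow> 'i option list" where
  "slots iss = spread (\<lambda>_. None) (map (map Some) iss)"

lemma spread_as_map: "spread (\<lambda>_. z) (map (map f) iss) =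
    map (case_option z f) (slots iss)"
  by (induction iss) (auto simp: slots_def spread_Cons bracket_def)

lemma spread_const_cong: "t [] = z \<Longrightarrow> spread t iss = spread (\<lambda>_. z) iss"
  by (induction iss) (auto simp: spread_Cons bracket_def)

lemma set_slots: "q \<in> set (slots iss) \<Longrightarrow>
    q = None \<or> (\<exists>i \<in> set (concat iss). q = Some i)"
  by (induction iss) (auto simp: slots_def spread_Cons bracket_def split: if_splits)

lemma (in lax_plus_oplax_zero) tensm_spread_hom:
  assumes "\<And>i. i \<in> set (concat iss) \<Longrightarrow> in_hom C (f i) (x i) (y i)" and "in_hom C f0 x0 y0"
  shows "in_hom C (tensm S (spread (\<lambda>_. f0) (map (map f) iss)))
    (tens S (spread (\<lambda>_. x0) (map (map x) iss))) (tens S (spread (\<lambda>_. y0) (map (map y) iss)))"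
  unfolding spread_as_map
  by (rule tensm_hom, drule set_slots) (use assms in \<open>auto simp del: set_concat\<close>)

text \<open>The part of a duoidal structure which acts on comonoids. \<open>E p [a\<^sub>1, \<dots>, a\<^sub>n]\<close> stands for
  the interchange morphism \<open>\<xi>\<^sup>p\<^sub>n\<close> at the array with \<open>p\<close> equal entries \<open>a\<^sub>r\<close> for each \<open>r\<close>, and
  \<open>E2 [(a\<^sub>1, b\<^sub>1), \<dots>, (a\<^sub>n, b\<^sub>n)]\<close> for \<open>\<xi>\<^sup>2\<^sub>n\<close> at the array with entries \<open>a\<^sub>r\<close>, \<open>b\<^sub>r\<close> for each
  \<open>r\<close>. In the opposite category, with the two products exchanged, the arrays are transposed;
  keeping \<open>E\<close> and \<open>E2\<close> abstract lets one locale serve both situations.\<close>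

locale interchange = S: lax_plus_oplax_zero C S + T: lax_plus_oplax_zero "op_cat C" T
  for C :: "('o, 'm) cat" (structure) and S T :: "('o, 'm) str" +
  fixes E :: "nat \<Rightarrow> 'o list \<Rightarrow> 'm" and E2 :: "('o \<times> 'o) list \<Rightarrow> 'm"
  assumes E_hom: "set as \<subseteq> Ob C \<Longrightarrow>
      in_hom C (E p as) (tens T (map (\<lambda>a. tens S (replicate p a)) as))
        (tens S (replicate p (tens T as)))"
    and E_natural_list: "set fs \<subseteq> Arr C \<Longrightarrow>
      E p (map (Cod C) fs) \<cdot> tensm T (map (\<lambda>f. tensm S (replicate p f)) fs) =
      tensm S (replicate p (tensm T fs)) \<cdot> E p (map (Dom C) fs)"
    and E_lax: "set (concat ass) \<subseteq> Ob C \<Longrightarrow>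
      E p (map (tens T) ass) \<cdot> tensm T (map (E p) ass) \<cdot>
        lax T (map (map (\<lambda>a. tens S (replicate p a))) ass) =
      tensm S (replicate p (lax T ass)) \<cdot> E p (spread (tens T) ass) \<cdot>
        tensm T (spread (\<lambda>_. E p []) (map (map (\<lambda>a. Ide C (tens S (replicate p a)))) ass))"
    and E_opl: "set (concat ass) \<subseteq> Ob C \<Longrightarrow>
      E p (concat ass) \<cdot> opl T (map (map (\<lambda>a. tens S (replicate p a))) ass) =
      tensm S (replicate p (opl T ass)) \<cdot> E p (spread (tens T) ass) \<cdot>
        tensm T (spread (\<lambda>_. E p []) (map (map (\<lambda>a. Ide C (tens S (replicate p a)))) ass))"
    and E_unt: "a \<in> Ob C \<Longrightarrow>
      unt T (tens S (replicate p a)) = tensm S (replicate p (unt T a)) \<cdot> E p [a]"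
    and E2_diag: "E2 (map (\<lambda>a. (a, a)) as) = E 2 as"
    and E2_hom: "set ps \<subseteq> Ob C \<times> Ob C \<Longrightarrow>
      in_hom C (E2 ps) (tens T (map (\<lambda>(a, b). tens S [a, b]) ps))
        (tens S [tens T (map fst ps), tens T (map snd ps)])"
    and E2_natural_list: "set fgs \<subseteq> Arr C \<times> Arr C \<Longrightarrow>
      E2 (map (map_prod (Cod C) (Cod C)) fgs) \<cdot> tensm T (map (\<lambda>(f, g). tensm S [f, g]) fgs) =
      tensm S [tensm T (map fst fgs), tensm T (map snd fgs)] \<cdot>
        E2 (map (map_prod (Dom C) (Dom C)) fgs)"
    and coassoc_left: "set as \<subseteq> Ob C \<Longrightarrow>
      E 3 as \<cdot> tensm T (map (\<lambda>a. lax S [[a, a], [a]]) as) =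
      lax S [[tens T as, tens T as], [tens T as]] \<cdot> tensm S [E 2 as, E 1 as] \<cdot>
        E2 (map (\<lambda>a. (tens S [a, a], tens S [a])) as)"
    and coassoc_right: "set as \<subseteq> Ob C \<Longrightarrow>
      E 3 as \<cdot> tensm T (map (\<lambda>a. lax S [[a], [a, a]]) as) =
      lax S [[tens T as], [tens T as, tens T as]] \<cdot> tensm S [E 1 as, E 2 as] \<cdot>
        E2 (map (\<lambda>a. (tens S [a], tens S [a, a])) as)"
    and counit_left: "set as \<subseteq> Ob C \<Longrightarrow>
      tensm S [E 0 as, Ide C (tens T as)] \<cdot> E2 (map (\<lambda>a. (tens S [], a)) as) \<cdot>
        tensm T (map (\<lambda>a. opl S [[], [a]]) as) =
      opl S [[], [tens T as]] \<cdot> E 1 as"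
    and counit_right: "set as \<subseteq> Ob C \<Longrightarrow>
      tensm S [Ide C (tens T as), E 0 as] \<cdot> E2 (map (\<lambda>a. (a, tens S [])) as) \<cdot>
        tensm T (map (\<lambda>a. opl S [[a], []]) as) =
      opl S [[tens T as], []] \<cdot> E 1 as"
    and E_unt1: "set as \<subseteq> Ob C \<Longrightarrow> E 1 as \<cdot> tensm T (map (unt S) as) = unt S (tens T as)"
begin

abbreviation D :: "nat \<Rightarrow> 'o \<Rightarrow> 'o" where
  "D p a \<equiv> tens S (replicate p a)"

abbreviation Dm :: "nat \<Rightarrow> 'm \<Rightarrow> 'm" where
  "Dm p f \<equiv> tensm S (replicate p f)"

lemma T_ob: "set as \<subseteq> Ob C \<Longrightarrow> tens T as \<in> Ob C"
  using T.tens_ob by simp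

lemma T_hom:
  assumes "\<And>i. i \<in> set is \<Longrightarrow> in_hom C (f i) (x i) (y i)"
  shows "in_hom C (tensm T (map f is)) (tens T (map x is)) (tens T (map y is))"
  using T.tensm_hom [of "is" f y x] assms by simp

lemma T_cmp:
  assumes "\<And>i. i \<in> set is \<Longrightarrow> in_hom C (f i) (x i) (y i)"
    and "\<And>i. i \<in> set is \<Longrightarrow> in_hom C (g i) (y i) (z i)"
  shows "tensm T (map g is) \<cdot> tensm T (map f is) = tensm T (map (\<lambda>i. g i \<cdot> f i) is)"
  using T.tensm_cmp [of "is" g z y f x] assms by simp

lemma T_ide:
  assumes "\<And>i. i \<in> set is \<Longrightarrow> x i \<in> Ob C"
  shows "tensm T (map (\<lambda>i. Ide C (x i)) is) = Ide C (tens T (map x is))"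
  using T.tensm_ide [of "is" x] assms by simp

lemma T_lax_hom: "set (concat ass) \<subseteq> Ob C \<Longrightarrow>
    in_hom C (lax T ass) (tens T (spread (tens T) ass)) (tens T (map (tens T) ass))"
  using T.lax_hom [of ass] by simp

lemma T_opl_hom: "set (concat ass) \<subseteq> Ob C \<Longrightarrow>
    in_hom C (opl T ass) (tens T (spread (tens T) ass)) (tens T (concat ass))"
  using T.opl_hom [of ass] by simp

lemma T_unt_hom: "a \<in> Ob C \<Longrightarrow> in_hom C (unt T a) (tens T [a]) a"
  using T.unt_hom [of a] by simp

lemma T_lax_natural:
  assumes "\<And>i. i \<in> set (concat iss) \<Longrightarrow> in_hom C (f i) (x i) (y i)"
  shows "tensm T (map (\<lambda>is. tensm T (map f is)) iss) \<cdot> lax T (map (map x) iss) =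
    lax T (map (map y) iss) \<cdot> tensm T (spread (tensm T) (map (map f) iss))"
  using T.lax_natural [of iss f y x] assms by simp

lemma T_opl_natural:
  assumes "\<And>i. i \<in> set (concat iss) \<Longrightarrow> in_hom C (f i) (x i) (y i)"
  shows "tensm T (map f (concat iss)) \<cdot> opl T (map (map x) iss) =
    opl T (map (map y) iss) \<cdot> tensm T (spread (tensm T) (map (map f) iss))"
  using T.opl_natural [of iss f y x] assms by simp

lemma T_unt_natural:
  assumes "in_hom C f x y"
  shows "f \<cdot> unt T x = unt T y \<cdot> tensm T [f]"
  using T.unt_natural [of f y x] assms by simp

lemma E_natural:
  assumes "\<And>i. i \<in> set is \<Longrightarrow> in_hom C (f i) (x i) (y i)"
  shows "E p (map y is) \<cdot> tensm T (map (\<lambda>i. Dm p (f i)) is) =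
    Dm p (tensm T (map f is)) \<cdot> E p (map x is)"
proof -
  have "set (map f is) \<subseteq> Arr C" using assms by (auto simp: in_hom_def)
  from E_natural_list [OF this, of p]
  have "E p (map (\<lambda>i. Cod C (f i)) is) \<cdot> tensm T (map (\<lambda>i. Dm p (f i)) is) =
    Dm p (tensm T (map f is)) \<cdot> E p (map (\<lambda>i. Dom C (f i)) is)"
    by (simp only: map_map comp_def)
  moreover have "map (\<lambda>i. Cod C (f i)) is = map y is" "map (\<lambda>i. Dom C (f i)) is = map x is"
    using assms by (auto simp: in_hom_def)
  ultimately show ?thesis by (simp only:)
qed

lemma E2_natural:
  assumes "\<And>i. i \<in> set is \<Longrightarrow> in_hom C (f i) (x i) (y i)"
    and "\<And>i. i \<in> set is \<Longrightarrow> in_hom C (g i) (x' i) (y' i)"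
  shows "E2 (map (\<lambda>i. (y i, y' i)) is) \<cdot> tensm T (map (\<lambda>i. tensm S [f i, g i]) is) =
    tensm S [tensm T (map f is), tensm T (map g is)] \<cdot> E2 (map (\<lambda>i. (x i, x' i)) is)"
proof -
  have "set (map (\<lambda>i. (f i, g i)) is) \<subseteq> Arr C \<times> Arr C" using assms by (auto simp: in_hom_def)
  from E2_natural_list [OF this]
  have "E2 (map (\<lambda>i. (Cod C (f i), Cod C (g i))) is) \<cdot> tensm T (map (\<lambda>i. tensm S [f i, g i]) is) =
    tensm S [tensm T (map f is), tensm T (map g is)] \<cdot> E2 (map (\<lambda>i. (Dom C (f i), Dom C (g i))) is)"
    by (simp add: comp_def)
  moreover have "map (\<lambda>i. (Cod C (f i), Cod C (g i))) is = map (\<lambda>i. (y i, y' i)) is"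
      "map (\<lambda>i. (Dom C (f i), Dom C (g i))) is = map (\<lambda>i. (x i, x' i)) is"
    using assms by (auto simp: in_hom_def)
  ultimately show ?thesis by (simp only:)
qed

lemma E2_hom_map:
  assumes "\<And>i. i \<in> set is \<Longrightarrow> x i \<in> Ob C" and "\<And>i. i \<in> set is \<Longrightarrow> y i \<in> Ob C"
  shows "in_hom C (E2 (map (\<lambda>i. (x i, y i)) is)) (tens T (map (\<lambda>i. tens S [x i, y i]) is))
        (tens S [tens T (map x is), tens T (map y is)])"
proof -
  have "set (map (\<lambda>i. (x i, y i)) is) \<subseteq> Ob C \<times> Ob C" using assms by auto
  from E2_hom [OF this] show ?thesis by (simp add: comp_def)
qed

lemma E_hom_map:
  assumes "\<And>i. i \<in> set is \<Longrightarrow> x i \<in> Ob C"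
  shows "in_hom C (E p (map x is)) (tens T (map (\<lambda>i. D p (x i)) is)) (D p (tens T (map x is)))"
proof -
  have "set (map x is) \<subseteq> Ob C" using assms by auto
  from E_hom [OF this, of p] show ?thesis by (simp add: comp_def)
qed

lemma T_spread_hom:
  assumes "\<And>i. i \<in> set (concat iss) \<Longrightarrow> in_hom C (f i) (x i) (y i)" and "in_hom C f0 x0 y0"
  shows "in_hom C (tensm T (spread (\<lambda>_. f0) (map (map f) iss)))
    (tens T (spread (\<lambda>_. x0) (map (map x) iss))) (tens T (spread (\<lambda>_. y0) (map (map y) iss)))"
  using T.tensm_spread_hom [of iss f y x f0 y0 x0] assms by simp

lemma T_spread_cmp:
  assumes "\<And>i. i \<in> set (concat iss) \<Longrightarrow> in_hom C (f i) (x i) (y i)" and "in_hom C f0 x0 y0"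
    and "\<And>i. i \<in> set (concat iss) \<Longrightarrow> in_hom C (g i) (y i) (z i)" and "in_hom C g0 y0 z0"
  shows "tensm T (spread (\<lambda>_. g0) (map (map g) iss)) \<cdot> tensm T (spread (\<lambda>_. f0) (map (map f) iss)) =
    tensm T (spread (\<lambda>_. g0 \<cdot> f0) (map (map (\<lambda>i. g i \<cdot> f i)) iss))"
proof -
  let ?is = "slots iss"
  have "tensm T (map (case_option g0 g) ?is) \<cdot> tensm T (map (case_option f0 f) ?is) =
      tensm T (map (\<lambda>q. case_option g0 g q \<cdot> case_option f0 f q) ?is)"
    by (rule T_cmp [where x = "case_option x0 x" and y = "case_option y0 y" and z =
        "case_option z0 z"];
        drule set_slots) (use assms in \<open>auto simp del: set_concat\<close>)
  also have "(\<lambda>q. case_option g0 g q \<cdot> case_option f0 f q) = case_option (g0 \<cdot> f0) (\<lambda>i. g i \<cdot> f i)"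
    by (auto split: option.split)
  finally show ?thesis unfolding spread_as_map .
qed

subsection \<open>Coalgebras for the functors \<open>a \<mapsto> a \<bullet> \<dots> \<bullet> a\<close>\<close>

text \<open>For fixed \<open>p\<close> the morphisms \<open>E p\<close> are a distributive law for the endofunctor \<open>D p\<close>, so
  that the products \<open>\<circ>\<^sub>n\<close> and the transformations \<open>\<Psi>\<close>, \<open>\<psi>\<close>, \<open>\<upsilon>\<close> lift to its coalgebras \<open>s : a \<rightarrow>
  D p a\<close>. A comultiplication is such a structure for \<open>p = 2\<close>, a counit is one for \<open>p = 0\<close>. The
  coalgebras are indexed: \<open>x i\<close> is the object and \<open>s i\<close> the structure.\<close>

definition costr :: "nat \<Rightarrow> ('i \<Rightarrow> 'o) \<Rightarrow> ('i \<Rightarrow> 'm) \<Rightarrow> 'i list \<Rightarrow> 'm" where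
  "costr p x s is = E p (map x is) \<cdot> tensm T (map s is)"

context
  fixes p :: nat and x :: "'i \<Rightarrow> 'o" and s :: "'i \<Rightarrow> 'm" and J :: "'i set"
  assumes s: "\<And>i. i \<in> J \<Longrightarrow> in_hom C (s i) (x i) (D p (x i))"
begin

lemma x_ob: "i \<in> J \<Longrightarrow> x i \<in> Ob C"
  using s S.in_hom_objs by blast

lemma Dx_ob: "i \<in> J \<Longrightarrow> D p (x i) \<in> Ob C"
  using s S.in_hom_objs by blast

lemma tensm_s_hom:
  "set is \<subseteq> J \<Longrightarrow>
    in_hom C (tensm T (map s is)) (tens T (map x is)) (tens T (map (\<lambda>i. D p (x i)) is))"
  by (rule T_hom) (use s in auto)

lemma E_x_hom:
  "set is \<subseteq> J \<Longrightarrow>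
    in_hom C (E p (map x is)) (tens T (map (\<lambda>i. D p (x i)) is)) (D p (tens T (map x is)))"
  by (rule E_hom_map) (use x_ob in auto)

lemma costr_hom:
  "set is \<subseteq> J \<Longrightarrow> in_hom C (costr p x s is) (tens T (map x is)) (D p (tens T (map x is)))"
  unfolding costr_def by (rule S.cmp_in_hom [OF tensm_s_hom E_x_hom])

lemma tensm_coalgebra_hom:
  assumes "set is \<subseteq> J"
    and f: "\<And>i. i \<in> set is \<Longrightarrow> in_hom C (f i) (x i) (y i)"
    and u: "\<And>i. i \<in> set is \<Longrightarrow> in_hom C (u i) (y i) (D p (y i))"
    and fu: "\<And>i. i \<in> set is \<Longrightarrow> u i \<cdot> f i = Dm p (f i) \<cdot> s i"
  shows "costr p y u is \<cdot> tensm T (map f is) = Dm p (tensm T (map f is)) \<cdot> costr p x s is"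
proof -
  let ?cf = "tensm T (map f is)" and ?cu = "tensm T (map u is)" and ?cs = "tensm T (map s is)"
  let ?cDf = "tensm T (map (\<lambda>i. Dm p (f i)) is)"
  have s': "\<And>i. i \<in> set is \<Longrightarrow> in_hom C (s i) (x i) (D p (x i))" using s assms(1) by blast
  have Df: "\<And>i. i \<in> set is \<Longrightarrow> in_hom C (Dm p (f i)) (D p (x i)) (D p (y i))"
    by (rule S.tensm_diag_hom [OF f])
  have y: "\<And>i. i \<in> set is \<Longrightarrow> y i \<in> Ob C" using f S.in_hom_objs by blast
  note homs = T_hom [of "is" f x y, OF f] T_hom [of "is" u y "\<lambda>i. D p
      (y i)", OF u] tensm_s_hom [OF assms(1)] E_x_hom [OF assms(1)]
    T_hom [of "is" "\<lambda>i. Dm p (f i)" "\<lambda>i. D p (x i)"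
        "\<lambda>i. D p (y i)", OF Df] E_hom_map [of "is" y p, OF y]
    S.tensm_diag_hom [OF T_hom [of "is" f x y, OF f], of p]
  have "costr p y u is \<cdot> ?cf = E p (map y is) \<cdot> (?cu \<cdot> ?cf)"
    using homs unfolding costr_def in_hom_def by (simp add: S.assoc_arr)
  also have "?cu \<cdot> ?cf = tensm T (map (\<lambda>i. u i \<cdot> f i) is)"
    by (rule T_cmp [OF f u])
  also have "\<dots> = tensm T (map (\<lambda>i. Dm p (f i) \<cdot> s i) is)"
    by (rule arg_cong [of _ _ "tensm T"], rule map_cong) (use fu in auto)
  also have "\<dots> = ?cDf \<cdot> ?cs"
    by (rule T_cmp [of "is", OF s' Df, symmetric])
  also have "E p (map y is) \<cdot> (?cDf \<cdot> ?cs) = (E p (map y is) \<cdot> ?cDf) \<cdot> ?cs"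
    using homs unfolding in_hom_def by (simp add: S.assoc_arr)
  also have "E p (map y is) \<cdot> ?cDf = Dm p ?cf \<cdot> E p (map x is)"
    by (rule E_natural [OF f])
  also have "(Dm p ?cf \<cdot> E p (map x is)) \<cdot> ?cs = Dm p ?cf \<cdot> costr p x s is"
    using homs unfolding costr_def in_hom_def by (simp add: S.assoc_arr)
  finally show ?thesis .
qed

lemma E_Nil_hom: "in_hom C (E p []) (tens T []) (D p (tens T []))"
  using E_hom [of "[]" p] by simp

lemma T_Nil_hom: "in_hom C (tensm T []) (tens T []) (tens T [])"
  using T_hom [of "[]"] by simp

context
  fixes iss :: "'i list list"
  assumes iss: "set (concat iss) \<subseteq> J"
begin

lemma spread_structure:
  "E p (spread (tens T) (map (map x) iss)) \<cdot>
      tensm T (spread (\<lambda>_. costr p x s []) (map (map s) iss)) =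
    (E p (spread (tens T) (map (map x) iss)) \<cdot>
      tensm T (spread (\<lambda>_. E p []) (map (map (\<lambda>i. Ide C (D p (x i)))) iss))) \<cdot>
      tensm T (spread (tensm T) (map (map s) iss))"
  (is "?E \<cdot> ?c = (?E \<cdot> ?a) \<cdot> ?b")
    and spread_E_hom:
  "in_hom C (E p (spread (tens T) (map (map x) iss)) \<cdot>
      tensm T (spread (\<lambda>_. E p []) (map (map (\<lambda>i. Ide C (D p (x i)))) iss)))
     (tens T (spread (\<lambda>_. tens T []) (map (map (\<lambda>i. D p (x i))) iss)))
     (D p (tens T (spread (tens T) (map (map x) iss))))"
    and spread_s_hom:
  "in_hom C (tensm T (spread (tensm T) (map (map s) iss)))
     (tens T (spread (tens T) (map (map x) iss)))
     (tens T (spread (\<lambda>_. tens T []) (map (map (\<lambda>i. D p (x i))) iss)))"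
proof -
  have s': "\<And>i. i \<in> set (concat iss) \<Longrightarrow> in_hom C (s i) (x i) (D p (x i))" using s iss by blast
  have i': "\<And>i. i \<in> set (concat iss) \<Longrightarrow> in_hom C (Ide C (D p (x i))) (D p (x i)) (D p (x i))"
    using Dx_ob S.ide_in_hom iss by blast
  have sx: "spread (tens T) (map (map x) iss) = spread (\<lambda>_. tens T []) (map (map x) iss)"
    by (rule spread_const_cong) simp
  have b': "?b = tensm T (spread (\<lambda>_. tensm T []) (map (map s) iss))"
    by (rule arg_cong [of _ _ "tensm T"], rule spread_const_cong) simp
  show hb: "in_hom C ?b (tens T (spread (tens T) (map (map x) iss)))
     (tens T (spread (\<lambda>_. tens T []) (map (map (\<lambda>i. D p (x i))) iss)))"
    unfolding b' sx by (rule T_spread_hom [OF s' T_Nil_hom])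
  have ha: "in_hom C ?a (tens T (spread (\<lambda>_. tens T []) (map (map (\<lambda>i. D p (x i))) iss)))
     (tens T (spread (\<lambda>_. D p (tens T [])) (map (map (\<lambda>i. D p (x i))) iss)))"
    by (rule T_spread_hom [OF i' E_Nil_hom])
  have ob: "set (spread (tens T) (map (map x) iss)) \<subseteq> Ob C"
    using iss x_ob T_ob [of "[]"] unfolding sx
        by (induction iss) (auto simp: spread_Cons bracket_def)
  have "map (D p) (spread (tens T) (map (map x) iss)) =
      spread (\<lambda>_. D p (tens T [])) (map (map (D p)) (map (map x) iss))"
    by (rule map_spread_cong) auto
  then have hE: "in_hom C ?E (tens T (spread (\<lambda>_. D p (tens T [])) (map (map (\<lambda>i. D p (x i))) iss)))
     (D p (tens T (spread (tens T) (map (map x) iss))))"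
    using E_hom [OF ob, of p] by (simp add: comp_def)
  show "in_hom C (?E \<cdot> ?a) (tens T (spread (\<lambda>_. tens T []) (map (map (\<lambda>i. D p (x i))) iss)))
     (D p (tens T (spread (tens T) (map (map x) iss))))"
    by (rule S.cmp_in_hom [OF ha hE])
  have "?a \<cdot> ?b =
      tensm T (spread (\<lambda>_. costr p x s []) (map (map (\<lambda>i. Ide C (D p (x i)) \<cdot> s i)) iss))"
    unfolding b' costr_def using T_spread_cmp [OF s' T_Nil_hom i' E_Nil_hom] by simp
  also have "map (map (\<lambda>i. Ide C (D p (x i)) \<cdot> s i)) iss = map (map s) iss"
    using S.ide_left [OF s'] by auto
  finally have "?c = ?a \<cdot> ?b" ..
  then show "?E \<cdot> ?c = (?E \<cdot> ?a) \<cdot> ?b"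
    using S.assoc [OF hb ha hE] by simp
qed

lemma lax_coalgebra_hom:
  "costr p (\<lambda>is. tens T (map x is)) (costr p x s) iss \<cdot> lax T (map (map x) iss) =
    Dm p (lax T (map (map x) iss)) \<cdot> E p (spread (tens T) (map (map x) iss)) \<cdot>
      tensm T (spread (\<lambda>_. costr p x s []) (map (map s) iss))"
proof -
  let ?l = "lax T (map (map x) iss)" and ?lD = "lax T (map (map (\<lambda>i. D p (x i))) iss)"
  let ?E = "E p (map (\<lambda>is. tens T (map x is)) iss)"
  let ?cE = "tensm T (map (\<lambda>is. E p (map x is)) iss)"
  let ?cs = "tensm T (map (\<lambda>is. tensm T (map s is)) iss)"
  let ?b = "tensm T (spread (tensm T) (map (map s) iss))"
  let ?a = "E p (spread (tens T) (map (map x) iss)) \<cdot>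
      tensm T (spread (\<lambda>_. E p []) (map (map (\<lambda>i. Ide C (D p (x i)))) iss))"
  have sub: "\<And>is. is \<in> set iss \<Longrightarrow> set is \<subseteq> J" using iss by auto
  have xs: "set (concat (map (map x) iss)) \<subseteq> Ob C"
      "set (concat (map (map (\<lambda>i. D p (x i))) iss)) \<subseteq> Ob C"
    using iss x_ob Dx_ob by fastforce+
  have s': "\<And>i. i \<in> set (concat iss) \<Longrightarrow> in_hom C (s i) (x i) (D p (x i))" using s iss by blast
  note h1 = tensm_s_hom [OF sub] and h2 = E_x_hom [OF sub]
  have Tx: "\<And>is. is \<in> set iss \<Longrightarrow> tens T (map x is) \<in> Ob C"
    using h1 S.in_hom_objs by blast
  have sD: "spread (tens T) (map (map (\<lambda>i. D p (x i))) iss) =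
      spread (\<lambda>_. tens T []) (map (map (\<lambda>i. D p (x i))) iss)"
    by (rule spread_const_cong) simp
  note homs = T_hom [of iss "\<lambda>is. tensm T (map s is)" "\<lambda>is. tens T (map x is)"
      "\<lambda>is. tens T (map (\<lambda>i. D p (x i)) is)", OF h1] T_hom [of iss "\<lambda>is. E p (map x is)"
          "\<lambda>is. tens T (map (\<lambda>i. D p (x i)) is)"
              "\<lambda>is. D p (tens T (map x is))", OF h2] E_hom_map [of iss "\<lambda>is. tens T
                  (map x is)" p, OF Tx] spread_E_hom spread_s_hom
    T_lax_hom [OF xs(1), unfolded map_map comp_def] T_lax_hom [OF xs(2), unfolded map_map comp_def
        sD]
    S.tensm_diag_hom [OF T_lax_hom [OF xs(1), unfolded map_map comp_def], of p]
  have "tensm T (map (costr p x s) iss) = ?cE \<cdot> ?cs"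
    using T_cmp [of iss, OF h1 h2] by (simp add: costr_def [abs_def])
  then have "costr p (\<lambda>is. tens T (map x is)) (costr p x s) iss \<cdot> ?l = ?E \<cdot> ?cE \<cdot> (?cs \<cdot> ?l)"
    unfolding costr_def [of p "\<lambda>is. tens T (map x is)"] using homs
    by (simp add: S.assoc_arr S.cmp_arr in_hom_def)
  also have "?cs \<cdot> ?l = ?lD \<cdot> ?b"
    by (rule T_lax_natural [OF s'])
  also have "?E \<cdot> ?cE \<cdot> (?lD \<cdot> ?b) = (?E \<cdot> ?cE \<cdot> ?lD) \<cdot> ?b"
    using homs by (simp add: S.assoc_arr S.cmp_arr in_hom_def)
  also have "?E \<cdot> ?cE \<cdot> ?lD = Dm p ?l \<cdot> ?a"
    using E_lax [OF xs(1), of p] by (simp add: comp_def)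
  also have "(Dm p ?l \<cdot> ?a) \<cdot> ?b = Dm p ?l \<cdot> (?a \<cdot> ?b)"
    by (rule S.assoc [symmetric], rule spread_s_hom, rule spread_E_hom,
      rule S.tensm_diag_hom [OF T_lax_hom [OF xs(1)]])
  finally show ?thesis unfolding spread_structure .
qed

lemma opl_coalgebra_hom:
  "costr p x s (concat iss) \<cdot> opl T (map (map x) iss) =
    Dm p (opl T (map (map x) iss)) \<cdot> E p (spread (tens T) (map (map x) iss)) \<cdot>
      tensm T (spread (\<lambda>_. costr p x s []) (map (map s) iss))"
proof -
  let ?l = "opl T (map (map x) iss)" and ?lD = "opl T (map (map (\<lambda>i. D p (x i))) iss)"
  let ?E = "E p (map x (concat iss))"
  let ?cs = "tensm T (map s (concat iss))"
  let ?b = "tensm T (spread (tensm T) (map (map s) iss))"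
  let ?a = "E p (spread (tens T) (map (map x) iss)) \<cdot>
      tensm T (spread (\<lambda>_. E p []) (map (map (\<lambda>i. Ide C (D p (x i)))) iss))"
  have xs: "set (concat (map (map x) iss)) \<subseteq> Ob C"
      "set (concat (map (map (\<lambda>i. D p (x i))) iss)) \<subseteq> Ob C"
    using iss x_ob Dx_ob by fastforce+
  have s': "\<And>i. i \<in> set (concat iss) \<Longrightarrow> in_hom C (s i) (x i) (D p (x i))" using s iss by blast
  have sD: "spread (tens T) (map (map (\<lambda>i. D p (x i))) iss) =
      spread (\<lambda>_. tens T []) (map (map (\<lambda>i. D p (x i))) iss)"
    by (rule spread_const_cong) simp
  note homs = tensm_s_hom [OF iss] E_x_hom [OF iss] spread_E_hom spread_s_hom
    T_opl_hom [OF xs(1), folded map_concat] T_opl_hom [OF xs(2), unfolded sD, folded map_concat]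
  have "costr p x s (concat iss) \<cdot> ?l = ?E \<cdot> (?cs \<cdot> ?l)"
    unfolding costr_def using homs by (simp add: S.assoc_arr S.cmp_arr in_hom_def)
  also have "?cs \<cdot> ?l = ?lD \<cdot> ?b"
    by (rule T_opl_natural [OF s'])
  also have "?E \<cdot> (?lD \<cdot> ?b) = (?E \<cdot> ?lD) \<cdot> ?b"
    using homs by (simp add: S.assoc_arr S.cmp_arr in_hom_def)
  also have "?E \<cdot> ?lD = Dm p ?l \<cdot> ?a"
    using E_opl [OF xs(1), of p] by (simp add: comp_def map_concat)
  also have "(Dm p ?l \<cdot> ?a) \<cdot> ?b = Dm p ?l \<cdot> (?a \<cdot> ?b)"
    by (rule S.assoc [symmetric], rule spread_s_hom, rule spread_E_hom,
      rule S.tensm_diag_hom [OF T_opl_hom [OF xs(1)]])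
  finally show ?thesis unfolding spread_structure .
qed

end

lemma unt_coalgebra_hom:
  assumes "i \<in> J"
  shows "s i \<cdot> unt T (x i) = Dm p (unt T (x i)) \<cdot> costr p x s [i]"
proof -
  have x: "x i \<in> Ob C" by (rule x_ob [OF assms])
  have "s i \<cdot> unt T (x i) = unt T (D p (x i)) \<cdot> tensm T [s i]"
    by (rule T_unt_natural [OF s [OF assms]])
  also have "unt T (D p (x i)) = Dm p (unt T (x i)) \<cdot> E p [x i]"
    by (rule E_unt [OF x])
  also have "(Dm p (unt T (x i)) \<cdot> E p [x i]) \<cdot> tensm T [s i] =
      Dm p (unt T (x i)) \<cdot> (E p [x i] \<cdot> tensm T [s i])"
    using tensm_s_hom [of "[i]"] E_x_hom [of "[i]"] S.tensm_diag_hom [OF T_unt_hom [OF x], of p]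
        assms
    by (simp add: S.assoc_arr S.cmp_arr in_hom_def)
  finally show ?thesis by (simp add: costr_def)
qed

end

end

lemma replicate_two: "replicate 2 a = [a, a]"
  by (simp add: numeral_2_eq_2)

lemma comonoidD:
  assumes "x \<in> comonoids C S"
  shows "fst x \<in> Ob C"
    and "in_hom C (fst (snd x)) (fst x) (tens S [fst x, fst x])"
    and "in_hom C (snd (snd x)) (fst x) (tens S [])"
    and "lax S [[fst x, fst x], [fst x]] \<cdot>\<^bsub>C\<^esub> tensm S [fst (snd x), unt S (fst x)] \<cdot>\<^bsub>C\<^esub>
        fst (snd x) =
      lax S [[fst x], [fst x, fst x]] \<cdot>\<^bsub>C\<^esub> tensm S [unt S (fst x), fst (snd x)] \<cdot>\<^bsub>C\<^esub> fst (snd x)"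
    and "tensm S [snd (snd x), Ide C (fst x)] \<cdot>\<^bsub>C\<^esub> fst (snd x) =
      opl S [[], [fst x]] \<cdot>\<^bsub>C\<^esub> unt S (fst x)"
    and "tensm S [Ide C (fst x), snd (snd x)] \<cdot>\<^bsub>C\<^esub> fst (snd x) =
      opl S [[fst x], []] \<cdot>\<^bsub>C\<^esub> unt S (fst x)"
  using assms by (auto simp: comonoids_def)

lemma comonoid_hom_alt:
  "comonoid_hom C S x f y \<longleftrightarrow>
    fst (snd y) \<cdot>\<^bsub>C\<^esub> f = tensm S [f, f] \<cdot>\<^bsub>C\<^esub> fst (snd x) \<and> snd (snd y) \<cdot>\<^bsub>C\<^esub> f = snd (snd x)"
  by (simp add: comonoid_hom_def case_prod_unfold)

context lax_plus_oplax_zero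
begin

lemma comonoid_hom_ide: "x \<in> comonoids C S \<Longrightarrow> comonoid_hom C S x (Ide C (fst x)) x"
  using comonoidD [of x C S] tensm_ide [of "[fst x, fst x]" "\<lambda>a. a"] ide_left ide_right
  by (auto simp: comonoid_hom_alt)

lemma comonoid_hom_cmp:
  assumes x: "x \<in> comonoids C S" "y \<in> comonoids C S" "z \<in> comonoids C S"
    and f: "in_hom C f (fst x) (fst y)" "comonoid_hom C S x f y"
    and g: "in_hom C g (fst y) (fst z)" "comonoid_hom C S y g z"
  shows "comonoid_hom C S x (g \<cdot> f) z"
proof -
  note hx = comonoidD(2,3) [OF x(1)] and hy = comonoidD(2,3) [OF x(2)] and hz =
      comonoidD(2,3) [OF x(3)]
  note eqs = f(2) [unfolded comonoid_hom_alt] g(2) [unfolded comonoid_hom_alt]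
  note ff = tensm_two_hom [OF f(1) f(1)] and gg = tensm_two_hom [OF g(1) g(1)]
  have "fst (snd z) \<cdot> (g \<cdot> f) = (fst (snd z) \<cdot> g) \<cdot> f"
    by (rule assoc [OF f(1) g(1) hz(1)])
  also have "\<dots> = tensm S [g, g] \<cdot> (fst (snd y) \<cdot> f)"
    using eqs assoc [OF f(1) hy(1) gg] by simp
  also have "\<dots> = (tensm S [g, g] \<cdot> tensm S [f, f]) \<cdot> fst (snd x)"
    using eqs assoc [OF hx(1) ff gg] by simp
  also have "tensm S [g, g] \<cdot> tensm S [f, f] = tensm S [g \<cdot> f, g \<cdot> f]"
    by (rule tensm_two_cmp [OF f(1) g(1) f(1) g(1)])
  finally have 1: "fst (snd z) \<cdot> (g \<cdot> f) = tensm S [g \<cdot> f, g \<cdot> f] \<cdot> fst (snd x)" .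
  have "snd (snd z) \<cdot> (g \<cdot> f) = snd (snd x)"
    using eqs assoc [OF f(1) g(1) hz(2)] by simp
  with 1 show ?thesis by (simp add: comonoid_hom_alt)
qed

end

context interchange
begin

subsection \<open>Products of comonoids\<close>

text \<open>The product \<open>\<circ>\<^sub>n\<close> of comonoids: its comultiplication and its counit are the structures of
  the product as a coalgebra for \<open>D 2\<close> and for \<open>D 0\<close>.\<close>

abbreviation comult_tens :: "('o, 'm) alg list \<Rightarrow> 'm" where
  "comult_tens \<equiv> costr 2 fst (\<lambda>x. fst (snd x))"

abbreviation counit_tens :: "('o, 'm) alg list \<Rightarrow> 'm" where
  "counit_tens \<equiv> costr 0 fst (\<lambda>x. snd (snd x))"

definition ctens :: "('o, 'm) alg list \<Rightarrow> ('o, 'm) alg" where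
  "ctens xs = (tens T (map fst xs), comult_tens xs, counit_tens xs)"

lemma comult_hom: "x \<in> comonoids C S \<Longrightarrow> in_hom C (fst (snd x)) (fst x) (D 2 (fst x))"
  using comonoidD(2) unfolding replicate_two by blast

lemma counit_hom: "x \<in> comonoids C S \<Longrightarrow> in_hom C (snd (snd x)) (fst x) (D 0 (fst x))"
  using comonoidD(3) [of x C S] by simp

text \<open>The step common to the comonoid axioms: for morphisms \<open>F\<close>, \<open>G\<close> which factor through
  products of morphisms \<open>f\<close>, \<open>g\<close>, the composite \<open>(F \<bullet> G) \<delta>\<close> factors through the product of the
  composites \<open>(f \<bullet> g) \<delta>\<close>.\<close>

lemma two_after_comul:
  assumes xs: "set xs \<subseteq> comonoids C S"
    and f: "\<And>x. x \<in> set xs \<Longrightarrow> in_hom C (f x) (fst x) (u x)"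
    and g: "\<And>x. x \<in> set xs \<Longrightarrow> in_hom C (g x) (fst x) (v x)"
    and d: "in_hom C d (tens T (map u xs)) P"
    and e: "in_hom C e (tens T (map v xs)) Q"
  shows "tensm S [d \<cdot> tensm T (map f xs), e \<cdot> tensm T (map g xs)] \<cdot> fst (snd (ctens xs)) =
    (tensm S [d, e] \<cdot> E2 (map (\<lambda>x. (u x, v x)) xs)) \<cdot>
      tensm T (map (\<lambda>x. tensm S [f x, g x] \<cdot> fst (snd x)) xs)"
    and "in_hom C (tensm S [d, e] \<cdot> E2 (map (\<lambda>x. (u x, v x)) xs))
      (tens T (map (\<lambda>x. tens S [u x, v x]) xs)) (tens S [P, Q])"
    and "\<And>x. x \<in> set xs \<Longrightarrow>
      in_hom C (tensm S [f x, g x] \<cdot> fst (snd x)) (fst x) (tens S [u x, v x])"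
proof -
  let ?cf = "tensm T (map f xs)" and ?cg = "tensm T (map g xs)" and ?cs =
      "tensm T (map (\<lambda>x. fst (snd x)) xs)"
  let ?cfg = "tensm T (map (\<lambda>x. tensm S [f x, g x]) xs)"
  let ?E = "E2 (map (\<lambda>x. (fst x, fst x)) xs)" and ?E' = "E2 (map (\<lambda>x. (u x, v x)) xs)"
  have s: "in_hom C (fst (snd x)) (fst x) (tens S [fst x, fst x])" if "x \<in> set xs" for x
    using comonoidD(2) that xs by blast
  have fg: "in_hom C (tensm S [f x, g x]) (tens S [fst x, fst x])
      (tens S [u x, v x])" if "x \<in> set xs" for x
    by (rule S.tensm_two_hom [OF f [OF that] g [OF that]])
  have obs: "fst x \<in> Ob C" "u x \<in> Ob C" "v x \<in> Ob C" if "x \<in> set xs" for x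
    using f g that S.in_hom_objs by blast+
  have hcf: "in_hom C ?cf (tens T (map fst xs)) (tens T (map u xs))" by (rule T_hom [OF f])
  have hcg: "in_hom C ?cg (tens T (map fst xs)) (tens T (map v xs))" by (rule T_hom [OF g])
  have hcs: "in_hom C ?cs (tens T (map fst xs)) (tens T (map (\<lambda>x. tens S [fst x, fst x]) xs))"
    by (rule T_hom [OF s])
  have hcfg: "in_hom C ?cfg (tens T (map (\<lambda>x. tens S [fst x, fst x]) xs)) (tens T (map
      (\<lambda>x. tens S [u x, v x]) xs))"
    by (rule T_hom [OF fg])
  have hE: "in_hom C ?E (tens T (map (\<lambda>x. tens S [fst x, fst x]) xs)) (tens S [tens T
      (map fst xs), tens T (map fst xs)])"
    by (rule E2_hom_map [OF obs(1) obs(1)])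
  have hE': "in_hom C ?E' (tens T (map (\<lambda>x. tens S [u x, v x]) xs)) (tens S [tens T
      (map u xs), tens T (map v xs)])"
    by (rule E2_hom_map [OF obs(2) obs(3)])
  have hde: "in_hom C (tensm S [d, e]) (tens S [tens T (map u xs), tens T (map v xs)])
      (tens S [P, Q])"
    by (rule S.tensm_two_hom [OF d e])
  have hcfcg: "in_hom C (tensm S [?cf, ?cg]) (tens S [tens T (map fst xs), tens T (map fst xs)])
      (tens S [tens T (map u xs), tens T (map v xs)])"
    by (rule S.tensm_two_hom [OF hcf hcg])
  show "in_hom C (tensm S [d, e] \<cdot> ?E') (tens T (map (\<lambda>x. tens S [u x, v x]) xs)) (tens S [P, Q])"
    by (rule S.cmp_in_hom [OF hE' hde])
  show "in_hom C (tensm S [f x, g x] \<cdot>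
      fst (snd x)) (fst x) (tens S [u x, v x])" if "x \<in> set xs" for x
    by (rule S.cmp_in_hom [OF s [OF that] fg [OF that]])
  have "E 2 (map fst xs) = ?E" using E2_diag [of "map fst xs"] by (simp add: comp_def)
  then have "tensm S [d \<cdot> ?cf, e \<cdot> ?cg] \<cdot> fst (snd (ctens xs)) =
      (tensm S [d, e] \<cdot> tensm S [?cf, ?cg]) \<cdot> (?E \<cdot> ?cs)"
    using S.tensm_two_cmp [OF hcf d hcg e] by (simp add: ctens_def costr_def)
  also have "\<dots> = tensm S [d, e] \<cdot> ((tensm S [?cf, ?cg] \<cdot> ?E) \<cdot> ?cs)"
    using hcs hE hcfcg hde by (simp add: in_hom_def S.assoc_arr S.cmp_arr)
  also have "tensm S [?cf, ?cg] \<cdot> ?E = ?E' \<cdot> ?cfg"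
    by (rule E2_natural [OF f g, symmetric])
  also have "tensm S [d, e] \<cdot> ((?E' \<cdot> ?cfg) \<cdot> ?cs) = (tensm S [d, e] \<cdot> ?E') \<cdot> (?cfg \<cdot> ?cs)"
    using hcs hcfg hE' hde by (simp add: in_hom_def S.assoc_arr S.cmp_arr)
  also have "?cfg \<cdot> ?cs = tensm T (map (\<lambda>x. tensm S [f x, g x] \<cdot> fst (snd x)) xs)"
    by (rule T_cmp [OF s fg])
  finally show "tensm S [d \<cdot> ?cf, e \<cdot> ?cg] \<cdot> fst (snd (ctens xs)) =
    (tensm S [d, e] \<cdot> ?E') \<cdot> tensm T (map (\<lambda>x. tensm S [f x, g x] \<cdot> fst (snd x)) xs)" .
qed

text \<open>A composite \<open>l (f \<bullet> g) \<delta>\<close> of the product is determined by those of the factors if \<open>l\<close> is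
  compatible with the interchange morphisms. For \<open>l = \<Phi>\<^sub>2\<^sub>,\<^sub>1\<close> and \<open>l = \<Phi>\<^sub>1\<^sub>,\<^sub>2\<close> this gives
  coassociativity.\<close>

lemma coassoc_step:
  assumes xs: "set xs \<subseteq> comonoids C S"
    and f: "\<And>x. x \<in> set xs \<Longrightarrow> in_hom C (f x) (fst x) (u x)"
    and g: "\<And>x. x \<in> set xs \<Longrightarrow> in_hom C (g x) (fst x) (v x)"
    and d: "in_hom C d (tens T (map u xs)) P"
    and e: "in_hom C e (tens T (map v xs)) Q"
    and l: "\<And>x. x \<in> set xs \<Longrightarrow> in_hom C (l x) (tens S [u x, v x]) (w x)"
    and l': "in_hom C l' (tens S [P, Q]) R"
    and k: "in_hom C k (tens T (map w xs)) R"
    and eq: "k \<cdot> tensm T (map l xs) = l' \<cdot> tensm S [d, e] \<cdot> E2 (map (\<lambda>x. (u x, v x)) xs)"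
  shows "l' \<cdot> tensm S [d \<cdot> tensm T (map f xs), e \<cdot> tensm T (map g xs)] \<cdot> fst (snd (ctens xs)) =
    k \<cdot> tensm T (map (\<lambda>x. l x \<cdot> tensm S [f x, g x] \<cdot> fst (snd x)) xs)"
proof -
  let ?m = "tensm S [d, e] \<cdot> E2 (map (\<lambda>x. (u x, v x)) xs)"
  let ?h = "tensm T (map (\<lambda>x. tensm S [f x, g x] \<cdot> fst (snd x)) xs)"
  note step = two_after_comul [OF xs f g d e]
  note hh = T_hom [of xs "\<lambda>x. tensm S [f x, g x] \<cdot>
      fst (snd x)" fst "\<lambda>x. tens S [u x, v x]", OF step(3)]
  note hl = T_hom [of xs l "\<lambda>x. tens S [u x, v x]" w, OF l]
  have "l' \<cdot> tensm S [d \<cdot> tensm T (map f xs), e \<cdot> tensm T (map g xs)] \<cdot> fst (snd (ctens xs)) =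
      l' \<cdot> ?m \<cdot> ?h"
    by (simp only: step(1))
  also have "\<dots> = (l' \<cdot> ?m) \<cdot> ?h"
    by (rule S.assoc [OF hh step(2) l'])
  also have "l' \<cdot> ?m = k \<cdot> tensm T (map l xs)"
    by (rule eq [symmetric])
  also have "(k \<cdot> tensm T (map l xs)) \<cdot> ?h = k \<cdot> tensm T (map l xs) \<cdot> ?h"
    by (rule S.assoc [OF hh hl k, symmetric])
  also have "tensm T (map l xs) \<cdot> ?h =
      tensm T (map (\<lambda>x. l x \<cdot> tensm S [f x, g x] \<cdot> fst (snd x)) xs)"
    by (rule T_cmp [OF step(3) l])
  finally show ?thesis .
qed

text \<open>Likewise if \<open>(f \<bullet> g) \<delta>\<close> is \<open>l \<iota>\<close> for each factor, then it is \<open>l \<iota>\<close> for the product. The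
  counit laws are the cases \<open>l = \<phi>\<^sub>0\<^sub>,\<^sub>1\<close> and \<open>l = \<phi>\<^sub>1\<^sub>,\<^sub>0\<close>.\<close>

lemma counit_step:
  assumes xs: "set xs \<subseteq> comonoids C S"
    and f: "\<And>x. x \<in> set xs \<Longrightarrow> in_hom C (f x) (fst x) (u x)"
    and g: "\<And>x. x \<in> set xs \<Longrightarrow> in_hom C (g x) (fst x) (v x)"
    and d: "in_hom C d (tens T (map u xs)) P"
    and e: "in_hom C e (tens T (map v xs)) Q"
    and l: "\<And>x. x \<in> set xs \<Longrightarrow> in_hom C (l x) (tens S [fst x]) (tens S [u x, v x])"
    and l': "in_hom C l' (tens S [tens T (map fst xs)]) R"
    and fg: "\<And>x. x \<in> set xs \<Longrightarrow> tensm S [f x, g x] \<cdot> fst (snd x) = l x \<cdot> unt S (fst x)"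
    and eq: "tensm S [d, e] \<cdot> E2 (map (\<lambda>x. (u x, v x)) xs) \<cdot> tensm T (map l xs) =
      l' \<cdot> E 1 (map fst xs)"
  shows "tensm S [d \<cdot> tensm T (map f xs), e \<cdot> tensm T (map g xs)] \<cdot> fst (snd (ctens xs)) =
    l' \<cdot> unt S (tens T (map fst xs))"
proof -
  let ?e = "tensm S [d, e]" and ?E = "E2 (map (\<lambda>x. (u x, v x)) xs)"
  let ?l = "tensm T (map l xs)" and ?u = "tensm T (map (\<lambda>x. unt S (fst x)) xs)"
  have as: "set (map fst xs) \<subseteq> Ob C" 
    using comonoidD(1) [OF subsetD [OF xs]] by (simp add: image_subset_iff)
  have unts: "in_hom C (unt S (fst x)) (fst x) (tens S [fst x])" if "x \<in> set xs" for x
    using as that S.unt_hom by auto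
  have uv: "u x \<in> Ob C" "v x \<in> Ob C" if "x \<in> set xs" for x
    using f g that S.in_hom_objs by blast+
  note step = two_after_comul [OF xs f g d e]
  note hu = T_hom [of xs "\<lambda>x. unt S (fst x)" fst "\<lambda>x. tens S [fst x]", OF unts]
  note hl = T_hom [of xs l "\<lambda>x. tens S [fst x]" "\<lambda>x. tens S [u x, v x]", OF l]
  note hE = E2_hom_map [of xs u v, OF uv]
  note he = S.tensm_two_hom [OF d e]
  have h1: "in_hom C (E 1 (map fst xs)) (tens T (map (\<lambda>x. tens S [fst x]) xs)) (tens S [tens T
      (map fst xs)])"
    using E_hom [OF as, of 1] by (simp add: comp_def)
  have "tensm T (map (\<lambda>x. tensm S [f x, g x] \<cdot> fst (snd x)) xs) =
      tensm T (map (\<lambda>x. l x \<cdot> unt S (fst x)) xs)"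
    by (rule arg_cong [of _ _ "tensm T"], rule map_cong) (use fg in auto)
  also have "\<dots> = ?l \<cdot> ?u"
    by (rule T_cmp [OF unts l, symmetric])
  finally have "tensm S [d \<cdot> tensm T (map f xs), e \<cdot> tensm T (map g xs)] \<cdot> fst (snd (ctens xs)) =
      (?e \<cdot> ?E) \<cdot> ?l \<cdot> ?u"
    by (simp only: step(1))
  also have "\<dots> = (?e \<cdot> ?E \<cdot> ?l) \<cdot> ?u"
    using hu hl hE he by (simp add: in_hom_def S.assoc_arr S.cmp_arr)
  also have "?e \<cdot> ?E \<cdot> ?l = l' \<cdot> E 1 (map fst xs)" by (rule eq)
  also have "(l' \<cdot> E 1 (map fst xs)) \<cdot> ?u = l' \<cdot> E 1 (map fst xs) \<cdot> ?u"
    by (rule S.assoc [OF hu h1 l', symmetric])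
  also have "E 1 (map fst xs) \<cdot> ?u = unt S (tens T (map fst xs))"
    using E_unt1 [OF as] by (simp add: comp_def)
  finally show ?thesis .
qed

lemma ctens_comonoid:
  assumes xs: "set xs \<subseteq> comonoids C S"
  shows "ctens xs \<in> comonoids C S"
proof -
  let ?as = "map fst xs"
  let ?c = "tens T ?as"
  let ?d = "comult_tens xs" and ?e = "counit_tens xs"
  note com = comonoidD [OF subsetD [OF xs]]
  have as: "set ?as \<subseteq> Ob C" using com(1) by (simp add: image_subset_iff)
  have c: "?c \<in> Ob C" by (rule T_ob [OF as])
  have d: "in_hom C ?d ?c (tens S [?c, ?c])"
    using costr_hom [where J = "comonoids C S" and x = fst and s = "\<lambda>x. fst (snd x)" and p =
        2, OF comult_hom xs]
    unfolding replicate_two .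
  have e: "in_hom C ?e ?c (tens S [])"
    using costr_hom [where J = "comonoids C S" and x = fst and s = "\<lambda>x. snd (snd x)" and p =
        0, OF counit_hom xs]
    by simp
  have unts: "in_hom C (unt S (fst x)) (fst x) (tens S [fst x])" if "x \<in> set xs" for x
    using com(1) that S.unt_hom by auto
  have ids: "in_hom C (Ide C (fst x)) (fst x) (fst x)" if "x \<in> set xs" for x
    using com(1) that S.ide_in_hom by auto
  have E2: "in_hom C (E 2 ?as) (tens T (map (\<lambda>x. tens S [fst x, fst x]) xs)) (tens S [?c, ?c])"
    using E_hom [OF as, of 2] by (simp add: replicate_two comp_def)
  have E1: "in_hom C (E 1 ?as) (tens T (map (\<lambda>x. tens S [fst x]) xs)) (tens S [?c])"
    using E_hom [OF as, of 1] by (simp add: comp_def)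
  have E3: "in_hom C (E 3 ?as) (tens T (map (\<lambda>x. tens S [fst x, fst x, fst x]) xs))
      (tens S [?c, ?c, ?c])"
    using E_hom [OF as, of 3] by (simp add: numeral_3_eq_3 comp_def)
  have E0: "in_hom C (E 0 ?as) (tens T (map (\<lambda>x. tens S []) xs)) (tens S [])"
    using E_hom [OF as, of 0] by (simp add: comp_def)
  have u1: "E 1 ?as \<cdot> tensm T (map (\<lambda>x. unt S (fst x)) xs) = unt S ?c"
    using E_unt1 [OF as] by (simp add: comp_def)
  have i1: "Ide C ?c \<cdot> tensm T (map (\<lambda>x. Ide C (fst x)) xs) = Ide C ?c"
  proof -
    have "tensm T (map (\<lambda>x. Ide C (fst x)) xs) = Ide C ?c"
      by (rule T_ide) (rule com(1))
    then show ?thesis using S.ide_left [OF S.ide_in_hom [OF c]] by simp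
  qed
  have l21: "in_hom C (lax S [[a, a], [a]]) (tens S [tens S [a, a], tens S [a]]) (tens S [a, a, a])"
    and l12: "in_hom C (lax S [[a], [a, a]]) (tens S [tens S [a], tens S [a, a]])
        (tens S [a, a, a])"
    and o01: "in_hom C (opl S [[], [a]]) (tens S [a]) (tens S [tens S [], a])"
    and o10: "in_hom C (opl S [[a], []]) (tens S [a]) (tens S [a, tens S []])"
    if "a \<in> Ob C" for a
    using S.lax_hom [of "[[a, a], [a]]"] S.lax_hom [of "[[a], [a, a]]"]
      S.opl_hom [of "[[], [a]]"] S.opl_hom [of "[[a], []]"] that
    by (simp_all add: spread_Cons bracket_def)
  have lax_eq: "E 3 ?as \<cdot> tensm T (map (\<lambda>x. lax S [[fst x, fst x], [fst x]]) xs) =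
      lax S [[?c, ?c], [?c]] \<cdot> tensm S [E 2 ?as, E 1 ?as] \<cdot>
          E2 (map (\<lambda>x. (tens S [fst x, fst x], tens S [fst x])) xs)"
    "E 3 ?as \<cdot> tensm T (map (\<lambda>x. lax S [[fst x], [fst x, fst x]]) xs) =
      lax S [[?c], [?c, ?c]] \<cdot> tensm S [E 1 ?as, E 2 ?as] \<cdot>
          E2 (map (\<lambda>x. (tens S [fst x], tens S [fst x, fst x])) xs)"
    using coassoc_left [OF as] coassoc_right [OF as] by (simp_all add: comp_def)
  have opl_eq: "tensm S [E 0 ?as, Ide C ?c] \<cdot> E2 (map (\<lambda>x. (tens S [], fst x)) xs) \<cdot>
        tensm T (map (\<lambda>x. opl S [[], [fst x]]) xs) = opl S [[], [?c]] \<cdot> E 1 ?as"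
    "tensm S [Ide C ?c, E 0 ?as] \<cdot> E2 (map (\<lambda>x. (fst x, tens S [])) xs) \<cdot>
        tensm T (map (\<lambda>x. opl S [[fst x], []]) xs) = opl S [[?c], []] \<cdot> E 1 ?as"
    using counit_left [OF as] counit_right [OF as] by (simp_all add: comp_def)
  have d': "fst (snd (ctens xs)) = ?d" by (simp add: ctens_def)
  have df: "?d = E 2 ?as \<cdot> tensm T (map (\<lambda>x. fst (snd x)) xs)"
    and ef: "?e = E 0 ?as \<cdot> tensm T (map (\<lambda>x. snd (snd x)) xs)"
    by (simp_all add: costr_def)
  have "lax S [[?c, ?c], [?c]] \<cdot> tensm S [?d, unt S ?c] \<cdot> ?d =
      E 3 ?as \<cdot> tensm T (map (\<lambda>x. lax S [[fst x, fst x], [fst x]] \<cdot>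
          tensm S [fst (snd x), unt S (fst x)] \<cdot> fst (snd x)) xs)"
    using coassoc_step [OF xs com(2) unts E2 E1 l21 [OF com(1)] l21 [OF c] E3 lax_eq(1)]
    unfolding u1 d' df [symmetric] .
  also have "\<dots> = E 3 ?as \<cdot> tensm T (map (\<lambda>x. lax S [[fst x], [fst x, fst x]] \<cdot>
      tensm S [unt S (fst x), fst (snd x)] \<cdot> fst (snd x)) xs)"
    using com(4) by (simp cong: map_cong)
  also have "\<dots> = lax S [[?c], [?c, ?c]] \<cdot> tensm S [unt S ?c, ?d] \<cdot> ?d"
    using coassoc_step [OF xs unts com(2) E1 E2 l12 [OF com(1)] l12 [OF c] E3 lax_eq(2)]
    unfolding u1 d' df [symmetric] by (rule sym)
  finally have coassoc: "lax S [[?c, ?c], [?c]] \<cdot> tensm S [?d, unt S ?c] \<cdot> ?d =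
      lax S [[?c], [?c, ?c]] \<cdot> tensm S [unt S ?c, ?d] \<cdot> ?d" .
  have left: "tensm S [?e, Ide C ?c] \<cdot> ?d = opl S [[], [?c]] \<cdot> unt S ?c"
    using counit_step [OF xs com(3) ids E0 S.ide_in_hom [OF c] o01 [OF com(1)] o01 [OF c] com(5)
        opl_eq(1)]
    unfolding i1 d' ef [symmetric] .
  have right: "tensm S [Ide C ?c, ?e] \<cdot> ?d = opl S [[?c], []] \<cdot> unt S ?c"
    using counit_step [OF xs ids com(3) S.ide_in_hom [OF c] E0 o10 [OF com(1)] o10 [OF c] com(6)
        opl_eq(2)]
    unfolding i1 d' ef [symmetric] .
  show ?thesis
    unfolding comonoids_def ctens_def using c d e coassoc left right by simp
qed

text \<open>The functor \<open>D 0\<close> is constant, so that its coalgebra morphisms are the morphisms over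
  \<open>\<bullet>\<^sub>0\<close>.\<close>

lemma Dm_zero: "in_hom C f a (tens S []) \<Longrightarrow> Dm 0 g \<cdot> f = f"
  using S.ide_left by (simp add: S.tensm_Nil)

lemma costr_map: "costr p x s (map h is) = costr p (\<lambda>i. x (h i)) (\<lambda>i. s (h i)) is"
  by (simp add: costr_def comp_def)

lemma tensm_comonoid_hom:
  assumes "\<And>i. i \<in> set is \<Longrightarrow> X i \<in> comonoids C S" "\<And>i. i \<in> set is \<Longrightarrow> Y i \<in> comonoids C S"
    and f: "\<And>i. i \<in> set is \<Longrightarrow> in_hom C (f i) (fst (X i)) (fst (Y i))"
    and hm: "\<And>i. i \<in> set is \<Longrightarrow> comonoid_hom C S (X i) (f i) (Y i)"
  shows "comonoid_hom C S (ctens (map X is)) (tensm T (map f is)) (ctens (map Y is))"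
proof -
  note X = assms(1) and Y = assms(2)
  have 2: "costr 2 (\<lambda>i. fst (Y i)) (\<lambda>i. fst (snd (Y i))) is \<cdot> tensm T (map f is) =
      Dm 2 (tensm T (map f is)) \<cdot> costr 2 (\<lambda>i. fst (X i)) (\<lambda>i. fst (snd (X i))) is"
    by (rule tensm_coalgebra_hom [where J = "set is"])
      (use comult_hom [OF X] comult_hom [OF Y] f hm in \<open>auto simp: comonoid_hom_alt replicate_two\<close>)
  have "snd (snd (Y i)) \<cdot> f i = Dm 0 (f i) \<cdot> snd (snd (X i))" if "i \<in> set is" for i
    using hm [OF that] Dm_zero [OF counit_hom [OF X [OF that], simplified]]
        by (simp add: comonoid_hom_alt)
  then have "costr 0 (\<lambda>i. fst (Y i)) (\<lambda>i. snd (snd (Y i))) is \<cdot> tensm T (map f is) =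
      Dm 0 (tensm T (map f is)) \<cdot> costr 0 (\<lambda>i. fst (X i)) (\<lambda>i. snd (snd (X i))) is"
    by (intro tensm_coalgebra_hom [where J = "set is" and y = "\<lambda>i. fst (Y i)"])
      (use counit_hom [OF X] counit_hom [OF Y] f in auto)
  also have "\<dots> = costr 0 (\<lambda>i. fst (X i)) (\<lambda>i. snd (snd (X i))) is"
    using costr_hom [where J = "set is" and x = "\<lambda>i. fst (X i)" and s =
        "\<lambda>i. snd (snd (X i))" and p = 0]
      counit_hom [OF X] by (intro Dm_zero) auto
  finally show ?thesis
    using 2 by (simp add: comonoid_hom_alt ctens_def costr_map replicate_two)
qed

lemma fst_ctens: "fst (ctens xs) = tens T (map fst xs)"
  by (simp add: ctens_def)

lemma ctens_spread:
  "map fst (spread ctens xss) = spread (tens T) (map (map fst) xss)"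
  "comult_tens (spread ctens xss) =
    E 2 (spread (tens T) (map (map fst) xss)) \<cdot>
      tensm T (spread (\<lambda>_. comult_tens []) (map (map (\<lambda>x. fst (snd x))) xss))"
  "counit_tens (spread ctens xss) =
    E 0 (spread (tens T) (map (map fst) xss)) \<cdot>
      tensm T (spread (\<lambda>_. counit_tens []) (map (map (\<lambda>x. snd (snd x))) xss))"
proof -
  show 1: "map fst (spread ctens xss) = spread (tens T) (map (map fst) xss)"
    by (rule map_spread_cong) (auto simp: ctens_def)
  have 2: "map (\<lambda>x. fst (snd x)) (spread ctens xss) =
      spread (\<lambda>_. comult_tens []) (map (map (\<lambda>x. fst (snd x))) xss)"
    by (rule map_spread_cong) (auto simp: ctens_def)
  have 3: "map (\<lambda>x. snd (snd x)) (spread ctens xss) =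
      spread (\<lambda>_. counit_tens []) (map (map (\<lambda>x. snd (snd x))) xss)"
    by (rule map_spread_cong) (auto simp: ctens_def)
  show "comult_tens (spread ctens xss) =
    E 2 (spread (tens T) (map (map fst) xss)) \<cdot>
      tensm T (spread (\<lambda>_. comult_tens []) (map (map (\<lambda>x. fst (snd x))) xss))"
    unfolding costr_def [of _ _ _ "spread ctens xss"] 1 2 ..
  show "counit_tens (spread ctens xss) =
    E 0 (spread (tens T) (map (map fst) xss)) \<cdot>
      tensm T (spread (\<lambda>_. counit_tens []) (map (map (\<lambda>x. snd (snd x))) xss))"
    unfolding costr_def [of _ _ _ "spread ctens xss"] 1 3 ..
qed

lemma spread_comonoids:
  assumes "set (concat xss) \<subseteq> comonoids C S"
  shows "set (spread ctens xss) \<subseteq> comonoids C S"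
  using assms ctens_comonoid [of "[]"] by (induction xss) (auto simp: spread_Cons bracket_def)

lemma counit_spread_hom:
  assumes "set (concat xss) \<subseteq> comonoids C S"
  shows "in_hom C (counit_tens (spread ctens xss))
    (tens T (map fst (spread ctens xss))) (tens S [])"
  using costr_hom [where J = "comonoids C S" and x = fst and s = "\<lambda>x. snd (snd x)" and p =
      0, OF counit_hom
    spread_comonoids [OF assms]] by simp

lemma lax_comonoid_hom:
  assumes xss: "set (concat xss) \<subseteq> comonoids C S"
  shows "comonoid_hom C S (ctens (spread ctens xss)) (lax T (map (map fst) xss)) (ctens
      (map ctens xss))"
proof -
  note 2 = lax_coalgebra_hom [where J = "comonoids C S" and x = fst and s =
      "\<lambda>x. fst (snd x)" and p = 2,
      OF comult_hom xss, folded ctens_spread]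
  note 0 = lax_coalgebra_hom [where J = "comonoids C S" and x = fst and s =
      "\<lambda>x. snd (snd x)" and p = 0,
      OF counit_hom xss, folded ctens_spread]
  have d: "fst (snd (ctens (map ctens xss))) =
      costr 2 (\<lambda>is. tens T (map fst is)) (comult_tens) xss"
    and e: "snd (snd (ctens (map ctens xss))) =
      costr 0 (\<lambda>is. tens T (map fst is)) (counit_tens) xss"
    by (simp_all add: ctens_def costr_map)
  show ?thesis
    using 2 0 Dm_zero [OF counit_spread_hom [OF xss]]
    by (simp add: comonoid_hom_alt d e ctens_def [of "spread ctens xss"] replicate_two)
qed

lemma opl_comonoid_hom:
  assumes xss: "set (concat xss) \<subseteq> comonoids C S"
  shows "comonoid_hom C S (ctens (spread ctens xss)) (opl T (map (map fst) xss)) (ctens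
      (concat xss))"
proof -
  note 2 = opl_coalgebra_hom [where J = "comonoids C S" and x = fst and s =
      "\<lambda>x. fst (snd x)" and p = 2,
      OF comult_hom xss, folded ctens_spread]
  note 0 = opl_coalgebra_hom [where J = "comonoids C S" and x = fst and s =
      "\<lambda>x. snd (snd x)" and p = 0,
      OF counit_hom xss, folded ctens_spread]
  have d: "fst (snd (ctens (concat xss))) = comult_tens (concat xss)"
    and e: "snd (snd (ctens (concat xss))) = counit_tens (concat xss)"
    by (simp_all add: ctens_def)
  show ?thesis
    using 2 0 Dm_zero [OF counit_spread_hom [OF xss]]
    by (simp add: comonoid_hom_alt d e ctens_def [of "spread ctens xss"] replicate_two)
qed

lemma unt_comonoid_hom:
  assumes x: "x \<in> comonoids C S"
  shows "comonoid_hom C S (ctens [x]) (unt T (fst x)) x"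
proof -
  note 2 = unt_coalgebra_hom [where J = "comonoids C S" and x = fst and s =
      "\<lambda>x. fst (snd x)" and p = 2,
      OF comult_hom x]
  note 0 = unt_coalgebra_hom [where J = "comonoids C S" and x = fst and s =
      "\<lambda>x. snd (snd x)" and p = 0,
      OF counit_hom x]
  have "in_hom C (counit_tens [x]) (tens T (map fst [x])) (tens S [])"
    using costr_hom [where J = "comonoids C S" and x = fst and s = "\<lambda>x. snd (snd x)" and p =
        0, OF counit_hom, of "[x]"] x
    by simp
  then show ?thesis
    using 2 0 Dm_zero [of "counit_tens [x]"]
    by (simp add: comonoid_hom_alt ctens_def replicate_two)
qed

end

section \<open>The interchange morphisms of a duoidal category\<close>

lemma tens_pow_str:
  "tens (pow_str S n) as = map (\<lambda>r. tens S (map (\<lambda>a. a ! r) as)) [0..<n]"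
  "tensm (pow_str S n) fs = map (\<lambda>r. tensm S (map (\<lambda>f. f ! r) fs)) [0..<n]"
  "lax (pow_str S n) ass = map (\<lambda>r. lax S (map (map (\<lambda>a. a ! r)) ass)) [0..<n]"
  "opl (pow_str S n) ass = map (\<lambda>r. opl S (map (map (\<lambda>a. a ! r)) ass)) [0..<n]"
  "unt (pow_str S n) a = map (\<lambda>r. unt S (a ! r)) [0..<n]"
  by (simp_all add: prod_str_def)

text \<open>The operations of the power structures act on a list of columns, one for each \<open>j\<close> in \<open>J\<close>,
  by combining the entries of each row, one for each \<open>i\<close> in \<open>I\<close>.\<close>

lemma pow_str_array:
  "tens (pow_str S (length I)) (map (\<lambda>j. map (\<lambda>i. x i j) I) J) = map (\<lambda>i. tens S (map (x i) J)) I"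
  "tensm (pow_str S (length I)) (map (\<lambda>j. map (\<lambda>i. f i j) I) J) = map (\<lambda>i. tensm S (map (f i) J)) I"
  "lax (pow_str S (length I)) (map (map (\<lambda>j. map (\<lambda>i. x i j) I)) jss) =
    map (\<lambda>i. lax S (map (map (x i)) jss)) I"
  "opl (pow_str S (length I)) (map (map (\<lambda>j. map (\<lambda>i. x i j) I)) jss) =
    map (\<lambda>i. opl S (map (map (x i)) jss)) I"
  "unt (pow_str S (length I)) (map y I) = map (\<lambda>i. unt S (y i)) I"
  by (rule nth_equalityI; auto simp: tens_pow_str comp_def cong: map_cong)+

lemma prod_pow_str_array:
  "tens (prod_str (map (pow_str S) (map length iss))) (map (\<lambda>j. map (map (\<lambda>i. x i j)) iss) J) =
    map (map (\<lambda>i. tens S (map (x i) J))) iss"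
proof (rule nth_equalityI)
  fix r
  assume "r < length (tens (prod_str (map (pow_str S) (map length iss))) (map (\<lambda>j. map (map
      (\<lambda>i. x i j)) iss) J))"
  then have r: "r < length iss" by (simp add: prod_str_def)
  then have "tens (prod_str (map (pow_str S) (map length iss))) (map (\<lambda>j. map (map
      (\<lambda>i. x i j)) iss) J) ! r =
      tens (pow_str S (length (iss ! r))) (map (\<lambda>j. map (\<lambda>i. x i j) (iss ! r)) J)"
    unfolding prod_str_def [of "map (pow_str S) (map length iss)"] by (simp add: comp_def)
  then show "tens (prod_str (map (pow_str S) (map length iss))) (map (\<lambda>j. map (map
      (\<lambda>i. x i j)) iss) J) ! r =
      map (map (\<lambda>i. tens S (map (x i) J))) iss ! r"
    using r by (simp only: pow_str_array nth_map)
qed (simp add: prod_str_def)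

context duoidal
begin

sublocale S: lax_plus_oplax_zero C S
  by (rule bullet)

sublocale T: lax_plus_oplax_zero "op_cat C" T
  using circ by (simp add: lax_zero_oplax_plus_def)

lemma T_hom:
  assumes "\<And>i. i \<in> set is \<Longrightarrow> in_hom C (f i) (x i) (y i)"
  shows "in_hom C (tensm T (map f is)) (tens T (map x is)) (tens T (map y is))"
  using T.tensm_hom [of "is" f y x] assms by simp

lemma T_ide:
  assumes "\<And>i. i \<in> set is \<Longrightarrow> x i \<in> Ob C"
  shows "tensm T (map (\<lambda>i. Ide C (x i)) is) = Ide C (tens T (map x is))"
  using T.tensm_ide [of "is" x] assms by simp

text \<open>The component of \<open>\<xi>\<close> at an array of objects \<open>x i j\<close>, from the product of the rows \<open>\<bullet>\<^sub>j x i
  j\<close> to the product of the columns \<open>\<circ>\<^sub>i x i j\<close>. Arbitrary lists serve as index sets, so that no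
  positions in lists have to be computed and the roles of rows and columns can be exchanged.\<close>

definition grid :: "'i list \<Rightarrow> 'j list \<Rightarrow> ('i \<Rightarrow> 'j \<Rightarrow> 'o) \<Rightarrow> 'm" where
  "grid I J x = \<xi> (length I) (map (\<lambda>j. map (\<lambda>i. x i j) I) J)"

lemma circ_functor:
  "nat_trans (pow_cat (pow_cat C n) p) C (tensF T \<odot> tensF (pow_str S n))
    (tensF S \<odot> prodF (replicate p (tensF T))) (\<xi> n)"
  using circ_monoidal [of n] by (simp add: monoidal_functor_def circM_def)

lemma circ_coherence:
  "a \<in> Ob (pow_cat C n) \<Longrightarrow>
    \<xi> n [a] \<cdot>\<^bsub>C\<^esub> tensm T (unt (pow_str S n) a) = unt S (tens T a)"
  "concat ass \<in> lists (Ob (pow_cat C n)) \<Longrightarrow>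
    tensm S (concat (map (angle C (circM T \<xi> n)) ass)) \<cdot>\<^bsub>C\<^esub>
      \<xi> n (spread (tens (pow_str S n)) ass) \<cdot>\<^bsub>C\<^esub> tensm T (lax (pow_str S n) ass) =
    lax S (map (map (tens T)) ass) \<cdot>\<^bsub>C\<^esub> tensm S (map (\<xi> n) ass) \<cdot>\<^bsub>C\<^esub>
      \<xi> n (map (tens (pow_str S n)) ass)"
  "concat ass \<in> lists (Ob (pow_cat C n)) \<Longrightarrow>
    tensm S (concat (map (angle C (circM T \<xi> n)) ass)) \<cdot>\<^bsub>C\<^esub>
      \<xi> n (spread (tens (pow_str S n)) ass) \<cdot>\<^bsub>C\<^esub> tensm T (opl (pow_str S n) ass) =
    opl S (map (map (tens T)) ass) \<cdot>\<^bsub>C\<^esub> \<xi> n (concat ass)"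
  using circ_monoidal [of n] by (simp_all add: monoidal_functor_def circM_def)

lemma grid_hom:
  assumes "\<And>i j. i \<in> set I \<Longrightarrow> j \<in> set J \<Longrightarrow> x i j \<in> Ob C"
  shows "in_hom C (grid I J x) (tens T (map (\<lambda>i. tens S (map (x i) J)) I))
    (tens S (map (\<lambda>j. tens T (map (\<lambda>i. x i j) I)) J))"
proof -
  let ?a = "map (\<lambda>j. map (\<lambda>i. x i j) I) J"
  have "?a \<in> Ob (pow_cat (pow_cat C (length I)) (length J))"
    using assms by (auto simp: Ob_pow_cat)
  then show ?thesis
    using circ_functor [where n = "length I" and p = "length J"]
    unfolding nat_trans_def grid_def by (auto simp: prodF_simps pow_str_array comp_def)
qed

lemma grid_natural:
  assumes "\<And>i j. i \<in> set I \<Longrightarrow> j \<in> set J \<Longrightarrow> in_hom C (f i j) (x i j) (y i j)"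
  shows "grid I J y \<cdot>\<^bsub>C\<^esub> tensm T (map (\<lambda>i. tensm S (map (f i) J)) I) =
    tensm S (map (\<lambda>j. tensm T (map (\<lambda>i. f i j) I)) J) \<cdot>\<^bsub>C\<^esub> grid I J x"
proof -
  let ?f = "map (\<lambda>j. map (\<lambda>i. f i j) I) J"
  have f: "?f \<in> Arr (pow_cat (pow_cat C (length I)) (length J))"
    using assms by (auto simp: Arr_pow_cat in_hom_def)
  have "Dom (pow_cat (pow_cat C (length I)) (length J)) ?f = map (\<lambda>j. map (\<lambda>i. x i j) I) J"
    "Cod (pow_cat (pow_cat C (length I)) (length J)) ?f = map (\<lambda>j. map (\<lambda>i. y i j) I) J"
    using assms by (auto simp: in_hom_def)
  with f circ_functor [where n = "length I" and p = "length J"]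
  have "\<xi> (length I) (map (\<lambda>j. map (\<lambda>i. y i j) I) J) \<cdot>\<^bsub>C\<^esub>
      farr (tensF T \<odot> tensF (pow_str S (length I))) ?f =
    farr (tensF S \<odot> prodF (replicate (length J) (tensF T))) ?f \<cdot>\<^bsub>C\<^esub>
      \<xi> (length I) (map (\<lambda>j. map (\<lambda>i. x i j) I) J)"
    unfolding nat_trans_def by metis
  then show ?thesis
    by (simp add: grid_def prodF_simps pow_str_array comp_def)
qed

subsection \<open>Compatibility with \<open>\<Phi>\<close>, \<open>\<phi>\<close> and \<open>\<iota>\<close>\<close>

lemma angle_spread:
  "concat (map (angle C (circM T \<xi> n)) ass) =
    spread (\<lambda>_. \<xi> n []) (map (map (\<lambda>a. Ide C (tens T a))) ass)"
  by (induction ass) (auto simp: spread_Cons bracket_def angle_def circM_def)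

lemma array_concat: "concat (map (map (\<lambda>j. map (\<lambda>i. x i j) I)) jss) \<in> lists (Ob (pow_cat C
    (length I)))"
  if "\<And>i j. i \<in> set I \<Longrightarrow> j \<in> set (concat jss) \<Longrightarrow> x i j \<in> Ob C"
  using that by (fastforce simp: Ob_pow_cat)

lemma spread_array:
  "spread (tens (pow_str S (length I))) (map (map (\<lambda>j. map (\<lambda>i. x i j) I)) jss) =
    map (\<lambda>q. map (\<lambda>i. case_option (tens S []) (x i) q) I) (slots jss)"
proof -
  have e: "tens (pow_str S (length I)) [] = map (\<lambda>i. tens S []) I"
    using pow_str_array(1) [where I = I and J = "[]"] by simp
  have "spread (tens (pow_str S (length I))) (map (map (\<lambda>j. map (\<lambda>i. x i j) I)) jss) =
      spread (\<lambda>_. map (\<lambda>i. tens S []) I) (map (map (\<lambda>j. map (\<lambda>i. x i j) I)) jss)"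
    by (rule spread_const_cong, rule e)
  also have "\<dots> = map (\<lambda>q. map (\<lambda>i. case_option (tens S []) (x i) q) I) (slots jss)"
    unfolding spread_as_map by (auto split: option.split)
  finally show ?thesis .
qed

lemma grid_slots_hom:
  assumes "\<And>i j. i \<in> set I \<Longrightarrow> j \<in> set (concat jss) \<Longrightarrow> x i j \<in> Ob C"
  shows "in_hom C (grid I (slots jss) (\<lambda>i. case_option (tens S []) (x i)))
    (tens T (map (\<lambda>i. tens S (spread (tens S) (map (map (x i)) jss))) I))
    (tens S (spread (\<lambda>_. tens T (map (\<lambda>i. tens S []) I)) (map (map (\<lambda>j. tens T (map
        (\<lambda>i. x i j) I))) jss)))"
proof -
  have "\<And>i q. i \<in> set I \<Longrightarrow> q \<in> set (slots jss) \<Longrightarrow> case_option (tens S []) (x i) q \<in> Ob C"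
    using assms S.tens_ob [of "[]"] by (auto dest!: set_slots simp del: set_concat)
  note h = grid_hom [of I "slots jss" "\<lambda>i. case_option (tens S []) (x i)", OF this]
  have 1: "spread (tens S) (map (map (x i)) jss) =
      map (case_option (tens S []) (x i)) (slots jss)" for i
    unfolding spread_as_map [symmetric] by (rule spread_const_cong) simp
  have 2: "spread (\<lambda>_. tens T (map (\<lambda>i. tens S []) I)) (map (map (\<lambda>j. tens T (map
      (\<lambda>i. x i j) I))) jss) =
      map (\<lambda>q. tens T (map (\<lambda>i. case_option (tens S []) (x i) q) I)) (slots jss)"
    unfolding spread_as_map by (auto split: option.split)
  show ?thesis unfolding 1 2 using h by simp
qed

lemma grid_lax_S:
  assumes x: "\<And>i j. i \<in> set I \<Longrightarrow> j \<in> set (concat jss) \<Longrightarrow> x i j \<in> Ob C"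
  shows "tensm S (spread (\<lambda>_. \<xi> (length I) []) (map (map (\<lambda>j. Ide C (tens T (map
      (\<lambda>i. x i j) I)))) jss)) \<cdot>\<^bsub>C\<^esub>
      grid I (slots jss) (\<lambda>i. case_option (tens S []) (x i)) \<cdot>\<^bsub>C\<^esub>
      tensm T (map (\<lambda>i. lax S (map (map (x i)) jss)) I) =
    lax S (map (map (\<lambda>j. tens T (map (\<lambda>i. x i j) I))) jss) \<cdot>\<^bsub>C\<^esub>
      tensm S (map (\<lambda>js. grid I js x) jss) \<cdot>\<^bsub>C\<^esub> grid I jss (\<lambda>i js. tens S (map (x i) js))"
proof -
  let ?ass = "map (map (\<lambda>j. map (\<lambda>i. x i j) I)) jss"
  let ?n = "length I"
  have "concat ?ass \<in> lists (Ob (pow_cat C ?n))"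
    by (rule array_concat [OF x])
  from circ_coherence(2) [OF this] show ?thesis
    unfolding angle_spread spread_array pow_str_array grid_def
    by (simp only: map_concat map_map comp_def pow_str_array length_map)
qed

lemma grid_opl_S:
  assumes x: "\<And>i j. i \<in> set I \<Longrightarrow> j \<in> set (concat jss) \<Longrightarrow> x i j \<in> Ob C"
  shows "tensm S (spread (\<lambda>_. \<xi> (length I) []) (map (map (\<lambda>j. Ide C (tens T (map
      (\<lambda>i. x i j) I)))) jss)) \<cdot>\<^bsub>C\<^esub>
      grid I (slots jss) (\<lambda>i. case_option (tens S []) (x i)) \<cdot>\<^bsub>C\<^esub>
      tensm T (map (\<lambda>i. opl S (map (map (x i)) jss)) I) =
    opl S (map (map (\<lambda>j. tens T (map (\<lambda>i. x i j) I))) jss) \<cdot>\<^bsub>C\<^esub> grid I (concat jss) x"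
proof -
  let ?ass = "map (map (\<lambda>j. map (\<lambda>i. x i j) I)) jss"
  let ?n = "length I"
  have "concat ?ass \<in> lists (Ob (pow_cat C ?n))"
    by (rule array_concat [OF x])
  from circ_coherence(3) [OF this] show ?thesis
    unfolding angle_spread spread_array pow_str_array grid_def
    by (simp only: map_concat map_map comp_def pow_str_array length_map)
qed

text \<open>The two equations with the composites bracketed as in the opposite category.\<close>

lemma grid_S_left:
  assumes x: "\<And>i j. i \<in> set I \<Longrightarrow> j \<in> set (concat jss) \<Longrightarrow> x i j \<in> Ob C"
  shows "(tensm S (spread (\<lambda>_. \<xi> (length I) []) (map (map (\<lambda>j. Ide C (tens T (map
      (\<lambda>i. x i j) I)))) jss)) \<cdot>\<^bsub>C\<^esub>
      grid I (slots jss) (\<lambda>i. case_option (tens S []) (x i))) \<cdot>\<^bsub>C\<^esub>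
      tensm T (map (\<lambda>i. lax S (map (map (x i)) jss)) I) =
    (lax S (map (map (\<lambda>j. tens T (map (\<lambda>i. x i j) I))) jss) \<cdot>\<^bsub>C\<^esub>
      tensm S (map (\<lambda>js. grid I js x) jss)) \<cdot>\<^bsub>C\<^esub> grid I jss (\<lambda>i js. tens S (map (x i) js))"
    and "(tensm S (spread (\<lambda>_. \<xi> (length I) []) (map (map (\<lambda>j. Ide C (tens T (map
        (\<lambda>i. x i j) I)))) jss)) \<cdot>\<^bsub>C\<^esub>
      grid I (slots jss) (\<lambda>i. case_option (tens S []) (x i))) \<cdot>\<^bsub>C\<^esub>
      tensm T (map (\<lambda>i. opl S (map (map (x i)) jss)) I) =
    opl S (map (map (\<lambda>j. tens T (map (\<lambda>i. x i j) I))) jss) \<cdot>\<^bsub>C\<^esub> grid I (concat jss) x"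
proof -
  let ?t = "\<lambda>j. tens T (map (\<lambda>i. x i j) I)"
  have t: "?t j \<in> Ob C" if "j \<in> set (concat jss)" for j
    using T.tens_ob [of "map (\<lambda>i. x i j) I"] x that by (auto simp del: set_concat)
  have xi: "set (concat (map (map (x i)) jss)) \<subseteq> Ob C" if "i \<in> set I" for i
    using x [OF that] by (fastforce simp: map_concat [symmetric])
  have ts: "set (concat (map (map ?t) jss)) \<subseteq> Ob C"
    using t by fastforce
  have e: "in_hom C (\<xi> (length I) []) (tens T (map (\<lambda>i. tens S []) I)) (tens S [])"
    \<comment> \<open>The array has no entries, so that its values do not matter.\<close>
    using grid_hom [of I "[]" undefined] by (simp add: grid_def)
  note hl = T_hom [of I "\<lambda>i. lax S (map (map (x i)) jss)" _ "\<lambda>i. tens S (spread (tens S) (map (map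
      (x i)) jss))",
      OF S.lax_hom [OF xi]]
  note ho = T_hom [of I "\<lambda>i. opl S (map (map (x i)) jss)" _ "\<lambda>i. tens S (spread (tens S) (map (map
      (x i)) jss))",
      OF S.opl_hom [OF xi]]
  note hg = grid_slots_hom [of I jss x, OF x]
  have ha: "in_hom C (tensm S (spread (\<lambda>_. \<xi> (length I) []) (map (map (\<lambda>j. Ide C (?t j))) jss)))
      (tens S (spread (\<lambda>_. tens T (map (\<lambda>i. tens S []) I)) (map (map ?t) jss)))
      (tens S (spread (\<lambda>_. tens S []) (map (map ?t) jss)))"
    by (rule S.tensm_spread_hom [OF S.ide_in_hom [OF t] e])
  have h1: "in_hom C (lax S (map (map ?t) jss)) (tens S (map (\<lambda>js. tens S (map ?t js)) jss)) (tens S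
      (spread (tens S) (map (map ?t) jss)))"
    using S.lax_hom [OF ts] by (simp add: comp_def)
  have x': "x i j \<in> Ob C" if "js \<in> set jss" "i \<in> set I" "j \<in> set js" for js i j
    using x that by auto
  have h2: "in_hom C (tensm S (map (\<lambda>js. grid I js x) jss)) (tens S (map (\<lambda>js. tens T (map
      (\<lambda>i. tens S (map (x i) js)) I)) jss))
      (tens S (map (\<lambda>js. tens S (map ?t js)) jss))"
    by (rule S.tensm_hom, rule grid_hom) (use x' in auto)
  have h3: "in_hom C (grid I jss (\<lambda>i js. tens S (map (x i) js))) (tens T (map (\<lambda>i. tens S (map
      (\<lambda>js. tens S (map (x i) js)) jss)) I))
     (tens S (map (\<lambda>js. tens T (map (\<lambda>i. tens S (map (x i) js)) I)) jss))"
    by (rule grid_hom, rule S.tens_ob) (use x' in auto)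
  show "(tensm S (spread (\<lambda>_. \<xi> (length I) []) (map (map (\<lambda>j. Ide C (tens T (map
      (\<lambda>i. x i j) I)))) jss)) \<cdot>\<^bsub>C\<^esub>
      grid I (slots jss) (\<lambda>i. case_option (tens S []) (x i))) \<cdot>\<^bsub>C\<^esub>
      tensm T (map (\<lambda>i. lax S (map (map (x i)) jss)) I) =
    (lax S (map (map (\<lambda>j. tens T (map (\<lambda>i. x i j) I))) jss) \<cdot>\<^bsub>C\<^esub>
      tensm S (map (\<lambda>js. grid I js x) jss)) \<cdot>\<^bsub>C\<^esub> grid I jss (\<lambda>i js. tens S (map (x i) js))"
    using grid_lax_S [of I jss x, OF x] S.assoc [OF hl hg ha] S.assoc [OF h3 h2 h1] by simp
  show "(tensm S (spread (\<lambda>_. \<xi> (length I) []) (map (map (\<lambda>j. Ide C (tens T (map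
      (\<lambda>i. x i j) I)))) jss)) \<cdot>\<^bsub>C\<^esub>
      grid I (slots jss) (\<lambda>i. case_option (tens S []) (x i))) \<cdot>\<^bsub>C\<^esub>
      tensm T (map (\<lambda>i. opl S (map (map (x i)) jss)) I) =
    opl S (map (map (\<lambda>j. tens T (map (\<lambda>i. x i j) I))) jss) \<cdot>\<^bsub>C\<^esub> grid I (concat jss) x"
    using grid_opl_S [of I jss x, OF x] S.assoc [OF ho hg ha] by simp
qed

lemma grid_unt_S:
  assumes y: "\<And>i. i \<in> set I \<Longrightarrow> y i \<in> Ob C"
  shows "grid I [()] (\<lambda>i _. y i) \<cdot>\<^bsub>C\<^esub> tensm T (map (\<lambda>i. unt S (y i)) I) = unt S (tens T (map y I))"
proof -
  have "map y I \<in> Ob (pow_cat C (length I))" using y by (auto simp: Ob_pow_cat)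
  from circ_coherence(1) [OF this] show ?thesis
    unfolding pow_str_array grid_def by simp
qed

subsection \<open>Compatibility with \<open>\<Psi>\<close>, \<open>\<psi>\<close> and \<open>\<upsilon>\<close>\<close>

context
  fixes iss :: "'i list list" and J :: "'j list" and x :: "'i \<Rightarrow> 'j \<Rightarrow> 'o"
  assumes x: "\<And>i j. i \<in> set (concat iss) \<Longrightarrow> j \<in> set J \<Longrightarrow> x i j \<in> Ob C"
begin

text \<open>Arrays whose rows are grouped into blocks of lengths \<open>ks\<close>. A column of \<open>arr\<close> is an object
  of \<open>C\<^bsup>k(1)\<^esup> \<times> \<dots> \<times> C\<^bsup>k(n)\<^esup>\<close>, and \<open>xS i\<close> is the product of the row \<open>i\<close>.\<close>

abbreviation "ks \<equiv> map length iss"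
abbreviation "arr \<equiv> map (\<lambda>j. map (map (\<lambda>i. x i j)) iss) J"
abbreviation "xS \<equiv> \<lambda>i. tens S (map (x i) J)"

lemma arr_ob: "arr \<in> lists (Ob (prod_cat (map (pow_cat C) ks)))"
proof -
  have "map (map (\<lambda>i. x i j)) iss \<in> Ob (prod_cat (map (pow_cat C) ks))" if "j \<in> set J" for j
  proof -
    have "set (concat (map (map (\<lambda>i. x i j)) iss)) = (\<lambda>i. x i j) ` set (concat iss)" by auto
    also have "\<dots> \<subseteq> Ob C" using x [OF _ that] by blast
    finally show ?thesis unfolding Ob_prod_pow_cat by (simp add: comp_def del: set_concat)
  qed
  then show ?thesis by auto
qed

lemma xS_ob: "i \<in> set (concat iss) \<Longrightarrow> xS i \<in> Ob C"
  using x by (intro S.tens_ob) (auto simp del: set_concat)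

text \<open>The structure morphism of the monoidal functor \<open>\<circ>\<^sub>K\<^sub>+\<^sub>Z \<cdot> ([k\<^sub>1] \<times> \<dots> \<times> [k\<^sub>n])\<close>: an empty
  block becomes a row of objects \<open>\<circ>\<^sub>0\<close>, and the structure of \<open>[0]\<close>, which is \<open>\<xi>\<close> with no rows,
  is the only one among those of the \<open>[k\<^sub>i]\<close> that is not an identity.\<close>

lemma circ_bracket_component:
  "snd (circ_bracketM C S T \<xi> ks) arr =
    grid (slots iss) J (\<lambda>q j. case_option (tens T []) (\<lambda>i. x i j) q) \<cdot>\<^bsub>C\<^esub>
      tensm T (spread (\<lambda>_. \<xi> 0 (map (\<lambda>_. []) J)) (map (map (\<lambda>i. Ide C (xS i))) iss))"
proof -
  let ?KZ = "sum_list ks + sum_list (map Zn ks)"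
  let ?br = "map (bracketM C S T \<xi>) ks"
  let ?z = "tens S (map (\<lambda>_. tens T []) J)"
  let ?y = "\<lambda>q j. case_option (tens T []) (\<lambda>i. x i j) q"
  have KZ: "length (slots iss) = ?KZ"
    by (induction iss) (auto simp: slots_def spread_Cons bracket_def Zn_def)
  have br: "fobj (prodF (map fst ?br)) (map (map (\<lambda>i. x i j)) iss) =
      map (bracket (tens T)) (map (map (\<lambda>i. x i j)) iss)" for j
    by (rule nth_equalityI) (auto simp: prodF_def bracketM_def strictM_def bracket_def)
  have spr: "spread (tens T) (map (map (\<lambda>i. x i j)) iss) = map (\<lambda>q. ?y q j) (slots iss)" for j
    unfolding spread_as_map [symmetric] by (rule spread_const_cong) simp
  let ?as' = "map (\<lambda>j. map (bracket (tens T)) (map (map (\<lambda>i. x i j)) iss)) J"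
  \<comment> \<open>The places of each block after the functors \<open>[k\<^sub>i]\<close> have been applied.\<close>
  let ?slots = "map (\<lambda>is. if is = [] then [None] else map Some is) iss"
  have slots: "slots iss = concat ?slots"
    by (simp add: slots_def spread_def bracket_def comp_def if_distrib cong: if_cong)
  have as': "?as' = map (\<lambda>j. map (map (\<lambda>q. ?y q j)) ?slots) J"
    by (auto simp: bracket_def)
  have ks': "map (\<lambda>k. k + Zn k) ks = map length ?slots"
    by (auto simp: Zn_def)
  have T': "tens (prod_str (map (pow_str S) (map (\<lambda>k. k + Zn k) ks))) ?as' =
      map (map (\<lambda>q. tens S (map (?y q) J))) ?slots"
    unfolding as' ks' by (rule prod_pow_str_array)
  have A: "concat (tens (prod_str (map (pow_str S) (map (\<lambda>k. k + Zn k) ks))) ?as') =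
      map (\<lambda>q. tens S (map (?y q) J)) (slots iss)"
    unfolding T' slots by (simp only: map_concat)
  let ?B = "case_option (\<xi> 0 (map (\<lambda>_. []) J)) (\<lambda>i. Ide C (xS i))"
  have "snd (?br ! r) (map (\<lambda>a. a ! r) arr) = map ?B (?slots ! r)" if r: "r < length iss" for r
  proof (cases "iss ! r = []")
    case True
    with r show ?thesis by (simp add: bracketM_def grid_def comp_def)
  next
    case False
    have "map (\<lambda>a. a ! r) arr = map (\<lambda>j. map (\<lambda>i. x i j) (iss ! r)) J"
      using r by simp
    then show ?thesis
      using r False by (simp add: bracketM_def strictM_def pow_str_array comp_def)
  qed
  then have "map (\<lambda>r. snd (?br ! r) (map (\<lambda>a. a ! r) arr)) [0..<length ?br] = map (map ?B) ?slots"
    by (intro nth_equalityI) (simp_all del: map_map)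
  then have B: "snd (prodM ?br) arr = map (map ?B) ?slots"
    by (simp add: prodM_def)
  \<comment> \<open>The concatenation contributes a composition with identities, which does not change the list
    because each entry ends at the object in question.\<close>
  have hB: "in_hom C (?B q) (case_option (tens T []) xS q) (tens S (map (?y q) J))" if "q \<in> set
      (slots iss)" for q
  proof (cases q)
    case None
    then show ?thesis using grid_hom [of "[]" J undefined] by (simp add: grid_def)
  next
    case (Some i)
    then show ?thesis using xS_ob [of i] S.ide_in_hom set_slots [OF that]
        by (auto simp del: set_concat)
  qed
  have "map2 (Cmp C) (map (Ide C) (map (\<lambda>q. tens S (map (?y q) J)) (slots iss))) (map ?B
      (slots iss)) = map ?B (slots iss)"
    using S.ide_left [OF hB] by (simp add: zip_map_map zip_same_conv_map)
  then have cmp: "Cmp (pow_cat C ?KZ) (Ide (pow_cat C ?KZ) (map (\<lambda>q. tens S (map (?y q) J))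
      (slots iss)))
      (map ?B (slots iss)) = map ?B (slots iss)"
    using KZ by (simp add: Cmp_pow_cat)
  have KZ': "sum_list (map (\<lambda>k. k + Zn k) ks) = ?KZ"
    using sum_list_addf [of "\<lambda>k. k" Zn ks] by simp
  have fst_br: "map (fobj (prodF (map fst ?br))) arr = ?as'"
    using br by simp
  have "snd (compM (pow_cat C ?KZ) (concatM C S (map (\<lambda>k. k + Zn k) ks)) (prodM ?br)) arr =
    Cmp (pow_cat C ?KZ) (Ide (pow_cat C ?KZ) (concat (tens (prod_str (map (pow_str S) (map
        (\<lambda>k. k + Zn k) ks)))
      (map (fobj (prodF (map fst ?br))) arr)))) (concat (snd (prodM ?br) arr))"
    unfolding compM_def concatM_def strictM_def KZ' by (simp add: prodM_def)
  also have "\<dots> = map ?B (slots iss)"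
    unfolding fst_br A B map_concat [symmetric] slots [symmetric] by (rule cmp)
  finally have inner: "snd (compM (pow_cat C ?KZ) (concatM C S (map (\<lambda>k. k + Zn k) ks))
      (prodM ?br)) arr =
    map ?B (slots iss)" .
  have "map (fobj (fst (compM (pow_cat C ?KZ) (concatM C S (map (\<lambda>k. k + Zn k) ks))
      (prodM ?br)))) arr =
      map concat (map (fobj (prodF (map fst ?br))) arr)"
    by (simp add: compM_def concatM_def strictM_def prodM_def)
  also have "\<dots> = map (\<lambda>j. map (\<lambda>q. ?y q j) (slots iss)) J"
    unfolding fst_br
    by (rule nth_equalityI) (simp_all only: length_map nth_map spread_alt spr)
  finally have outer: "map (fobj (fst (compM (pow_cat C ?KZ) (concatM C S (map (\<lambda>k. k + Zn k) ks))
      (prodM ?br)))) arr =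
    map (\<lambda>j. map (\<lambda>q. ?y q j) (slots iss)) J" .
  have "snd (circ_bracketM C S T \<xi> ks) arr =
      \<xi> ?KZ (map (fobj (fst (compM (pow_cat C ?KZ) (concatM C S (map (\<lambda>k. k + Zn k) ks))
          (prodM ?br)))) arr) \<cdot>\<^bsub>C\<^esub>
      tensm T (snd (compM (pow_cat C ?KZ) (concatM C S (map (\<lambda>k. k + Zn k) ks)) (prodM ?br)) arr)"
    unfolding circ_bracketM_def Let_def compM_def [of C] circM_def by (simp add: case_prod_unfold)
  then show ?thesis
    unfolding inner outer spread_as_map grid_def KZ .
qed

lemma circ_circ_component:
  "snd (compM C (circM T \<xi> (length ks)) (prodM (map (circM T \<xi>) ks))) arr =
    grid iss J (\<lambda>is j. tens T (map (\<lambda>i. x i j) is)) \<cdot>\<^bsub>C\<^esub> tensm T (map (\<lambda>is. grid is J x) iss)"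
proof -
  have "fobj (prodF (map fst (map (circM T \<xi>) ks))) (map (map (\<lambda>i. x i j)) iss) =
      map (\<lambda>is. tens T (map (\<lambda>i. x i j) is)) iss" for j
    by (rule nth_equalityI) (auto simp: prodF_def circM_def)
  moreover have "snd (prodM (map (circM T \<xi>) ks)) arr = map (\<lambda>is. grid is J x) iss"
    by (rule nth_equalityI) (auto simp: prodM_def circM_def grid_def comp_def cong: map_cong)
  ultimately show ?thesis
    by (simp add: compM_def circM_def prodM_def grid_def comp_def)
qed

lemma circ_concat_component:
  "snd (compM C (circM T \<xi> (sum_list ks)) (concatM C S ks)) arr = grid (concat iss) J x"
proof -
  have "concat (tens (prod_str (map (pow_str S) ks)) arr) = map xS (concat iss)"
    unfolding prod_pow_str_array by (simp only: map_concat)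
  moreover have "length (concat iss) = sum_list ks" by (simp add: length_concat)
  moreover have "map concat arr = map (\<lambda>j. map (\<lambda>i. x i j) (concat iss)) J"
    by (simp add: map_concat)
  ultimately have "snd (compM C (circM T \<xi> (sum_list ks)) (concatM C S ks)) arr =
      grid (concat iss) J x \<cdot>\<^bsub>C\<^esub> tensm T (map (\<lambda>i. Ide C (xS i)) (concat iss))"
    by (simp add: compM_def circM_def concatM_def strictM_def grid_def comp_def cong: map_cong)
  also have "tensm T (map (\<lambda>i. Ide C (xS i)) (concat iss)) = Ide C (tens T (map xS (concat iss)))"
    by (rule T_ide) (rule xS_ob)
  also have "grid (concat iss) J x \<cdot>\<^bsub>C\<^esub> Ide C (tens T (map xS (concat iss))) =
      grid (concat iss) J x"
    by (rule S.ide_right [OF grid_hom]) (rule x)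
  finally show ?thesis .
qed

lemma grid_lax_T:
  "(grid iss J (\<lambda>is j. tens T (map (\<lambda>i. x i j) is)) \<cdot>\<^bsub>C\<^esub> tensm T (map (\<lambda>is. grid is J x) iss)) \<cdot>\<^bsub>C\<^esub>
      lax T (map (map xS) iss) =
    tensm S (map (\<lambda>j. lax T (map (map (\<lambda>i. x i j)) iss)) J) \<cdot>\<^bsub>C\<^esub>
      grid (slots iss) J (\<lambda>q j. case_option (tens T []) (\<lambda>i. x i j) q) \<cdot>\<^bsub>C\<^esub>
      tensm T (spread (\<lambda>_. \<xi> 0 (map (\<lambda>_. []) J)) (map (map (\<lambda>i. Ide C (xS i))) iss))"
proof -
  have "snd (compM C (circM T \<xi> (length ks)) (prodM (map (circM T \<xi>) ks))) arr \<cdot>\<^bsub>C\<^esub>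
      lax T (tens (prod_str (map (pow_str S) ks)) arr) =
      tensm S (map (lax T) arr) \<cdot>\<^bsub>C\<^esub> snd (circ_bracketM C S T \<xi> ks) arr"
    using Psi_monoidal [of ks] arr_ob unfolding monoidal_nat_trans_def case_prod_unfold by blast
  then show ?thesis
    unfolding circ_circ_component circ_bracket_component prod_pow_str_array by (simp add: comp_def)
qed

lemma grid_opl_T:
  "grid (concat iss) J x \<cdot>\<^bsub>C\<^esub> opl T (map (map xS) iss) =
    tensm S (map (\<lambda>j. opl T (map (map (\<lambda>i. x i j)) iss)) J) \<cdot>\<^bsub>C\<^esub>
      grid (slots iss) J (\<lambda>q j. case_option (tens T []) (\<lambda>i. x i j) q) \<cdot>\<^bsub>C\<^esub>
      tensm T (spread (\<lambda>_. \<xi> 0 (map (\<lambda>_. []) J)) (map (map (\<lambda>i. Ide C (xS i))) iss))"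
proof -
  have "snd (compM C (circM T \<xi> (sum_list ks)) (concatM C S ks)) arr \<cdot>\<^bsub>C\<^esub>
      opl T (tens (prod_str (map (pow_str S) ks)) arr) =
      tensm S (map (opl T) arr) \<cdot>\<^bsub>C\<^esub> snd (circ_bracketM C S T \<xi> ks) arr"
    using psi_monoidal [of ks] arr_ob unfolding monoidal_nat_trans_def case_prod_unfold by blast
  then show ?thesis
    unfolding circ_concat_component circ_bracket_component prod_pow_str_array
        by (simp add: comp_def)
qed

lemma grid_lax_T_right:
  "grid iss J (\<lambda>is j. tens T (map (\<lambda>i. x i j) is)) \<cdot>\<^bsub>C\<^esub> tensm T (map (\<lambda>is. grid is J x) iss) \<cdot>\<^bsub>C\<^esub>
      lax T (map (map xS) iss) =
    tensm S (map (\<lambda>j. lax T (map (map (\<lambda>i. x i j)) iss)) J) \<cdot>\<^bsub>C\<^esub>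
      grid (slots iss) J (\<lambda>q j. case_option (tens T []) (\<lambda>i. x i j) q) \<cdot>\<^bsub>C\<^esub>
      tensm T (spread (\<lambda>_. \<xi> 0 (map (\<lambda>_. []) J)) (map (map (\<lambda>i. Ide C (xS i))) iss))"
proof -
  have x': "x i j \<in> Ob C" if "is \<in> set iss" "i \<in> set is" "j \<in> set J" for "is" i j
    using x that by auto
  have h1: "in_hom C (grid iss J (\<lambda>is j. tens T (map (\<lambda>i. x i j) is)))
      (tens T (map (\<lambda>is. tens S (map (\<lambda>j. tens T (map (\<lambda>i. x i j) is)) J)) iss))
      (tens S (map (\<lambda>j. tens T (map (\<lambda>is. tens T (map (\<lambda>i. x i j) is)) iss)) J))"
    by (rule grid_hom, rule T.tens_ob [simplified]) (use x' in auto)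
  have h2: "in_hom C (tensm T (map (\<lambda>is. grid is J x) iss)) (tens T (map (\<lambda>is. tens T
      (map xS is)) iss))
      (tens T (map (\<lambda>is. tens S (map (\<lambda>j. tens T (map (\<lambda>i. x i j) is)) J)) iss))"
    by (rule T_hom, rule grid_hom) (use x' in auto)
  have "set (concat (map (map xS) iss)) \<subseteq> Ob C"
    using xS_ob by fastforce
  then have h3: "in_hom C (lax T (map (map xS) iss)) (tens T (spread (tens T) (map (map xS) iss)))
      (tens T (map (\<lambda>is. tens T (map xS is)) iss))"
    using T.lax_hom [of "map (map xS) iss"] by (simp add: comp_def)
  show ?thesis
    using grid_lax_T S.assoc [OF h3 h2 h1] by simp
qed

lemma grid_opl_T_left:
  "grid (concat iss) J x \<cdot>\<^bsub>C\<^esub> opl T (map (map xS) iss) =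
    (tensm S (map (\<lambda>j. opl T (map (map (\<lambda>i. x i j)) iss)) J) \<cdot>\<^bsub>C\<^esub>
      grid (slots iss) J (\<lambda>q j. case_option (tens T []) (\<lambda>i. x i j) q)) \<cdot>\<^bsub>C\<^esub>
      tensm T (spread (\<lambda>_. \<xi> 0 (map (\<lambda>_. []) J)) (map (map (\<lambda>i. Ide C (xS i))) iss))"
proof -
  let ?y = "\<lambda>q j. case_option (tens T []) (\<lambda>i. x i j) q"
  have y: "?y q j \<in> Ob C" if "q \<in> set (slots iss)" "j \<in> set J" for q j
    using set_slots [OF that(1)] x that(2) T.tens_ob [of "[]"] by (auto simp del: set_concat)
  have s1: "map (\<lambda>q. ?y q j) (slots iss) = spread (tens T) (map (map (\<lambda>i. x i j)) iss)" for j
    unfolding spread_as_map [symmetric] by (rule spread_const_cong [symmetric]) simp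
  have s2: "map (\<lambda>q. tens S (map (?y q) J)) (slots iss) =
      spread (\<lambda>_. tens S (map (\<lambda>j. tens T []) J)) (map (map xS) iss)"
    unfolding spread_as_map by (auto split: option.split)
  have h2: "in_hom C (grid (slots iss) J ?y) (tens T (spread (\<lambda>_. tens S (map (\<lambda>j. tens T []) J))
      (map (map xS) iss)))
      (tens S (map (\<lambda>j. tens T (spread (tens T) (map (map (\<lambda>i. x i j)) iss))) J))"
    unfolding s1 [symmetric] s2 [symmetric] by (rule grid_hom [OF y])
  have xj: "set (concat (map (map (\<lambda>i. x i j)) iss)) \<subseteq> Ob C" if "j \<in> set J" for j
    using x [OF _ that] by fastforce
  have h1: "in_hom C (tensm S (map (\<lambda>j. opl T (map (map (\<lambda>i. x i j)) iss)) J))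
      (tens S (map (\<lambda>j. tens T (spread (tens T) (map (map (\<lambda>i. x i j)) iss))) J))
      (tens S (map (\<lambda>j. tens T (concat (map (map (\<lambda>i. x i j)) iss))) J))"
    by (rule S.tensm_hom, rule T.opl_hom [simplified in_hom_op], simp add: xj del: set_concat)
  have e: "in_hom C (\<xi> 0 (map (\<lambda>_. []) J)) (tens T []) (tens S (map (\<lambda>j. tens T []) J))"
    using grid_hom [of "[]" J undefined] by (simp add: grid_def)
  have i: "in_hom C (Ide C (xS i)) (xS i) (xS i)" if "i \<in> set (concat iss)" for i
    using xS_ob [OF that] S.ide_in_hom by blast
  have h3: "in_hom C (tensm T (spread (\<lambda>_. \<xi> 0 (map (\<lambda>_. []) J)) (map (map (\<lambda>i. Ide C
      (xS i))) iss)))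
      (tens T (spread (\<lambda>_. tens T []) (map (map xS) iss)))
      (tens T (spread (\<lambda>_. tens S (map (\<lambda>j. tens T []) J)) (map (map xS) iss)))"
    using T.tensm_spread_hom [of iss "\<lambda>i. Ide C (xS i)" xS xS "\<xi> 0 (map (\<lambda>_. []) J)"
      "tens S (map (\<lambda>j. tens T []) J)" "tens T []"] i e by simp
  show ?thesis
    using grid_opl_T S.assoc [OF h3 h2 h1] by simp
qed

end

lemma grid_unt_T:
  assumes y: "\<And>j. j \<in> set J \<Longrightarrow> y j \<in> Ob C"
  shows "unt T (tens S (map y J)) = tensm S (map (\<lambda>j. unt T (y j)) J) \<cdot>\<^bsub>C\<^esub> grid [()] J (\<lambda>_. y)"
proof -
  have ys: "map y J \<in> lists (Ob C)" "set (map y J) \<subseteq> Ob C" using y by auto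
  have g: "in_hom C (grid [()] J (\<lambda>_. y)) (tens T [tens S (map y J)]) (tens S (map
      (\<lambda>j. tens T [y j]) J))"
    using grid_hom [of "[()]" J "\<lambda>_. y"] y by simp
  have b: "tens S (map y J) \<in> Ob C" by (rule S.tens_ob [OF ys(2)])
  have u: "in_hom C (unt T (tens S (map y J))) (tens T [tens S (map y J)]) (tens S (map y J))"
    using T.unt_hom [of "tens S (map y J)"] b by simp
  have i: "tensm T [Ide C (tens S (map y J))] = Ide C (tens T [tens S (map y J)])"
    using T_ide [of "[tens S (map y J)]" "\<lambda>a. a"] b by simp
  have "Ide C (tens S (map y J)) \<cdot>\<^bsub>C\<^esub> unt T (tens S (map y J)) =
      tensm S (map (unt T) (map y J)) \<cdot>\<^bsub>C\<^esub> \<xi> 1 (map (\<lambda>a. [a]) (map y J)) \<cdot>\<^bsub>C\<^esub>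
        tensm T [Ide C (tens S (map y J))]"
    using upsilon_monoidal ys(1)
    by (auto simp: monoidal_nat_trans_def compM_def circM_def strictM_def prod_cat_def)
  moreover have "\<xi> 1 (map (\<lambda>a. [a]) (map y J)) = grid [()] J (\<lambda>_. y)"
    by (simp add: grid_def comp_def)
  ultimately show ?thesis
    by (simp add: S.ide_left [OF u] i S.ide_right [OF g] comp_def)
qed

end

lemma slots_spread: "map (case_option (t []) f) (slots iss) = spread t (map (map f) iss)"
  unfolding spread_as_map [symmetric] by (rule spread_const_cong [symmetric]) simp

lemma slots_spread_id: "map (case_option (t []) (\<lambda>i. i)) (slots iss) = spread t iss"
  using slots_spread [of t "\<lambda>i. i" iss] by simp

subsection \<open>The action on comonoids and on monoids\<close>

context duoidal
begin

text \<open>For comonoids, the array with \<open>p\<close> equal columns and the array with the two columns given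
  by a list of pairs.\<close>

definition diag :: "nat \<Rightarrow> 'o list \<Rightarrow> 'm" where
  "diag p as = grid as (replicate p ()) (\<lambda>a _. a)"

definition two :: "('o \<times> 'o) list \<Rightarrow> 'm" where
  "two ps = grid ps [True, False] (\<lambda>p b. if b then fst p else snd p)"

lemma diag_grid: "grid I (replicate p ()) (\<lambda>i _. x i) = diag p (map x I)"
  by (simp add: diag_def grid_def comp_def)

lemma diag_hom: "set as \<subseteq> Ob C \<Longrightarrow>
    in_hom C (diag p as) (tens T (map (\<lambda>a. tens S (replicate p a)) as)) (tens S (replicate p
        (tens T as)))"
  using grid_hom [of as "replicate p ()" "\<lambda>a _. a"] by (auto simp: diag_def)

lemma ide_tens_cmp:
  assumes "in_hom C f a (tens S bs)" and "set bs \<subseteq> Ob C"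
  shows "tensm S (map (Ide C) bs) \<cdot>\<^bsub>C\<^esub> f = f"
proof -
  have "b \<in> Ob C" if "b \<in> set bs" for b using assms(2) that by blast
  from S.tensm_ide [of bs "\<lambda>b. b", OF this] show ?thesis
    using S.ide_left [OF assms(1)] by simp
qed

lemma cmp_ide_tens:
  assumes "in_hom C f (tens T bs) a" and "set bs \<subseteq> Ob C"
  shows "f \<cdot>\<^bsub>C\<^esub> tensm T (map (Ide C) bs) = f"
proof -
  have "b \<in> Ob C" if "b \<in> set bs" for b using assms(2) that by blast
  from T_ide [of bs "\<lambda>b. b", OF this] show ?thesis
    using S.ide_right [OF assms(1)] by simp
qed

lemma comonoid_interchange: "interchange C S T diag two"
proof unfold_locales
  fix as :: "'o list" and p
  assume as: "set as \<subseteq> Ob C"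
  show "in_hom C (diag p as) (tens T (map (\<lambda>a. tens S (replicate p a)) as)) (tens S (replicate p
      (tens T as)))"
    by (rule diag_hom [OF as])
next
  fix fs p
  assume "set fs \<subseteq> Arr C"
  then have "in_hom C f (Dom C f) (Cod C f)" if "f \<in> set fs" for f
    using that by (auto simp: in_hom_def)
  then show "diag p (map (Cod C) fs) \<cdot>\<^bsub>C\<^esub> tensm T (map (\<lambda>f. tensm S (replicate p f)) fs) =
      tensm S (replicate p (tensm T fs)) \<cdot>\<^bsub>C\<^esub> diag p (map (Dom C) fs)"
    using grid_natural [of fs "replicate p ()" "\<lambda>f _. f" "\<lambda>f _. Dom C f" "\<lambda>f _. Cod C f"]
    by (simp add: diag_grid)
next
  fix ass :: "'o list list" and p
  assume ass: "set (concat ass) \<subseteq> Ob C"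
  have ob: "a \<in> Ob C" if "a \<in> set (concat ass)" for a using ass that by blast
  have s: "grid (slots ass) (replicate p ()) (\<lambda>q _. case_option (tens T []) (\<lambda>a. a) q) =
      diag p (spread (tens T) ass)"
    by (simp only: diag_grid slots_spread_id)
  have e: "\<xi> 0 (map (\<lambda>_. []) (replicate p ())) = diag p []"
    by (simp add: diag_def grid_def)
  show "diag p (map (tens T) ass) \<cdot>\<^bsub>C\<^esub> tensm T (map (diag p) ass) \<cdot>\<^bsub>C\<^esub>
      lax T (map (map (\<lambda>a. tens S (replicate p a))) ass) =
    tensm S (replicate p (lax T ass)) \<cdot>\<^bsub>C\<^esub> diag p (spread (tens T) ass) \<cdot>\<^bsub>C\<^esub>
      tensm T (spread (\<lambda>_. diag p []) (map (map (\<lambda>a. Ide C (tens S (replicate p a)))) ass))"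
    using grid_lax_T_right [of ass "replicate p ()" "\<lambda>a _. a", OF ob] unfolding s e
    by (simp add: diag_grid)
  show "diag p (concat ass) \<cdot>\<^bsub>C\<^esub> opl T (map (map (\<lambda>a. tens S (replicate p a))) ass) =
    tensm S (replicate p (opl T ass)) \<cdot>\<^bsub>C\<^esub> diag p (spread (tens T) ass) \<cdot>\<^bsub>C\<^esub>
      tensm T (spread (\<lambda>_. diag p []) (map (map (\<lambda>a. Ide C (tens S (replicate p a)))) ass))"
    using grid_opl_T [of ass "replicate p ()" "\<lambda>a _. a", OF ob] unfolding s e
    by (simp add: diag_grid)
next
  fix a p
  assume "a \<in> Ob C"
  then show "unt T (tens S (replicate p a)) = tensm S (replicate p (unt T a)) \<cdot>\<^bsub>C\<^esub> diag p [a]"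
    using grid_unt_T [of "replicate p ()" "\<lambda>_. a"] by (simp add: diag_def grid_def)
next
  show "two (map (\<lambda>a. (a, a)) as) = diag 2 as" for as
    by (simp add: two_def diag_def grid_def comp_def numeral_2_eq_2)
next
  fix ps :: "('o \<times> 'o) list"
  assume "set ps \<subseteq> Ob C \<times> Ob C"
  then have "(if b then fst p else snd p) \<in> Ob C" if "p \<in> set ps" for p b
    using that by (cases p) auto
  then show "in_hom C (two ps) (tens T (map (\<lambda>(a, b). tens S [a, b]) ps))
      (tens S [tens T (map fst ps), tens T (map snd ps)])"
    using grid_hom [of ps "[True, False]" "\<lambda>p b. if b then fst p else snd p"]
    by (simp add: two_def case_prod_unfold)
next
  fix fgs :: "('m \<times> 'm) list"
  assume "set fgs \<subseteq> Arr C \<times> Arr C"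
  then have "(if b then fst p else snd p) \<in> Arr C" if "p \<in> set fgs" for p b
    using that by (cases p) auto
  then show "two (map (map_prod (Cod C) (Cod C)) fgs) \<cdot>\<^bsub>C\<^esub>
      tensm T (map (\<lambda>(f, g). tensm S [f, g]) fgs) =
      tensm S [tensm T (map fst fgs), tensm T (map snd fgs)] \<cdot>\<^bsub>C\<^esub>
          two (map (map_prod (Dom C) (Dom C)) fgs)"
    using grid_natural [of fgs "[True, False]" "\<lambda>p b. if b then fst p else snd p"
      "\<lambda>p b. Dom C (if b then fst p else snd p)" "\<lambda>p b. Cod C (if b then fst p else snd p)"]
    by (simp add: two_def grid_def case_prod_unfold in_hom_def comp_def)
next
  fix as :: "'o list"
  assume as: "set as \<subseteq> Ob C"
  have ob: "a \<in> Ob C" if "a \<in> set as" for a using as that by blast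
  have c: "tens T as \<in> Ob C" using T.tens_ob [of as] as by simp
  have d3: "in_hom C (diag 3 as) (tens T (map (\<lambda>a. tens S [a, a, a]) as))
      (tens S [tens T as, tens T as, tens T as])"
    using diag_hom [OF as, of 3] by (simp add: numeral_3_eq_3)
  have l: "in_hom C (lax S [[a, a], [a]]) (tens S [tens S [a, a], tens S [a]]) (tens S [a, a, a])"
    "in_hom C (lax S [[a], [a, a]]) (tens S [tens S [a], tens S [a, a]])
        (tens S [a, a, a])" if "a \<in> set as" for a
    using S.lax_hom [of "[[a, a], [a]]"] S.lax_hom [of "[[a], [a, a]]"] ob [OF that]
        by (auto simp: spread_Cons bracket_def)
  \<comment> \<open>For index lists without empty blocks the brackets contribute identities, here removed.\<close>
  note i = ide_tens_cmp [of _ _ "[tens T as, tens T as, tens T as]"]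
  have "in_hom C (diag 3 as \<cdot>\<^bsub>C\<^esub> tensm T (map (\<lambda>a. lax S [[a, a], [a]]) as))
      (tens T (map (\<lambda>a. tens S [tens S [a, a], tens S [a]]) as))
          (tens S [tens T as, tens T as, tens T as])"
    by (rule S.cmp_in_hom [OF T_hom d3]) (rule l(1))
  from i [OF this] c
  have i1: "tensm S [Ide C (tens T as), Ide C (tens T as), Ide C (tens T as)] \<cdot>\<^bsub>C\<^esub> diag 3 as \<cdot>\<^bsub>C\<^esub>
      tensm T (map (\<lambda>a. lax S [[a, a], [a]]) as) =
          diag 3 as \<cdot>\<^bsub>C\<^esub> tensm T (map (\<lambda>a. lax S [[a, a], [a]]) as)"
    by simp
  have "in_hom C (diag 3 as \<cdot>\<^bsub>C\<^esub> tensm T (map (\<lambda>a. lax S [[a], [a, a]]) as))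
      (tens T (map (\<lambda>a. tens S [tens S [a], tens S [a, a]]) as))
          (tens S [tens T as, tens T as, tens T as])"
    by (rule S.cmp_in_hom [OF T_hom d3]) (rule l(2))
  from i [OF this] c
  have i2: "tensm S [Ide C (tens T as), Ide C (tens T as), Ide C (tens T as)] \<cdot>\<^bsub>C\<^esub> diag 3 as \<cdot>\<^bsub>C\<^esub>
      tensm T (map (\<lambda>a. lax S [[a], [a, a]]) as) =
          diag 3 as \<cdot>\<^bsub>C\<^esub> tensm T (map (\<lambda>a. lax S [[a], [a, a]]) as)"
    by simp
  have grids:
    "grid as [Some (), Some (), Some ()] (\<lambda>a. case_option (tens S []) (\<lambda>_. a)) = diag 3 as"
    "grid as [None, Some ()] (\<lambda>a. case_option (tens S []) (\<lambda>_. a)) =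
        two (map (\<lambda>a. (tens S [], a)) as)"
    "grid as [Some (), None] (\<lambda>a. case_option (tens S []) (\<lambda>_. a)) =
        two (map (\<lambda>a. (a, tens S [])) as)"
    "grid as [[(), ()], [()]] (\<lambda>a js. tens S (map (\<lambda>_. a) js)) =
        two (map (\<lambda>a. (tens S [a, a], tens S [a])) as)"
    "grid as [[()], [(), ()]] (\<lambda>a js. tens S (map (\<lambda>_. a) js)) =
        two (map (\<lambda>a. (tens S [a], tens S [a, a])) as)"
    "grid as [(), ()] (\<lambda>a _. a) = diag 2 as" "grid as [()] (\<lambda>a _. a) =
        diag 1 as" "\<xi> (length as) [] = diag 0 as"
    by (simp_all add: grid_def diag_def two_def comp_def numeral_2_eq_2 numeral_3_eq_3)
  have slots: "slots [[(), ()], [()]] = [Some (), Some (), Some ()]" "slots [[()], [(), ()]] =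
      [Some (), Some (), Some ()]"
    "slots [[], [()]] = [None, Some ()]" "slots [[()], []] = [Some (), None]"
    by (simp_all add: slots_def spread_Cons bracket_def)
  show "diag 3 as \<cdot>\<^bsub>C\<^esub> tensm T (map (\<lambda>a. lax S [[a, a], [a]]) as) =
      lax S [[tens T as, tens T as], [tens T as]] \<cdot>\<^bsub>C\<^esub> tensm S [diag 2 as, diag 1 as] \<cdot>\<^bsub>C\<^esub>
        two (map (\<lambda>a. (tens S [a, a], tens S [a])) as)"
    using grid_lax_S [of as "[[(), ()], [()]]" "\<lambda>a _. a", OF ob] i1
    by (simp add: grids slots spread_Cons bracket_def)
  show "diag 3 as \<cdot>\<^bsub>C\<^esub> tensm T (map (\<lambda>a. lax S [[a], [a, a]]) as) =
      lax S [[tens T as], [tens T as, tens T as]] \<cdot>\<^bsub>C\<^esub> tensm S [diag 1 as, diag 2 as] \<cdot>\<^bsub>C\<^esub>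
        two (map (\<lambda>a. (tens S [a], tens S [a, a])) as)"
    using grid_lax_S [of as "[[()], [(), ()]]" "\<lambda>a _. a", OF ob] i2
    by (simp add: grids slots spread_Cons bracket_def)
  show "tensm S [diag 0 as, Ide C (tens T as)] \<cdot>\<^bsub>C\<^esub> two (map (\<lambda>a. (tens S [], a)) as) \<cdot>\<^bsub>C\<^esub>
        tensm T (map (\<lambda>a. opl S [[], [a]]) as) = opl S [[], [tens T as]] \<cdot>\<^bsub>C\<^esub> diag 1 as"
    using grid_opl_S [of as "[[], [()]]" "\<lambda>a _. a", OF ob]
    by (simp add: grids slots spread_Cons bracket_def)
  show "tensm S [Ide C (tens T as), diag 0 as] \<cdot>\<^bsub>C\<^esub> two (map (\<lambda>a. (a, tens S [])) as) \<cdot>\<^bsub>C\<^esub>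
        tensm T (map (\<lambda>a. opl S [[a], []]) as) = opl S [[tens T as], []] \<cdot>\<^bsub>C\<^esub> diag 1 as"
    using grid_opl_S [of as "[[()], []]" "\<lambda>a _. a", OF ob]
    by (simp add: grids slots spread_Cons bracket_def)
  show "diag 1 as \<cdot>\<^bsub>C\<^esub> tensm T (map (unt S) as) = unt S (tens T as)"
    using grid_unt_S [of as "\<lambda>a. a", OF ob] by (simp add: grids)
qed

text \<open>For monoids, the transposed arrays, with equal rows and with two rows.\<close>

definition diag' :: "nat \<Rightarrow> 'o list \<Rightarrow> 'm" where
  "diag' p as = grid (replicate p ()) as (\<lambda>_ a. a)"

definition two' :: "('o \<times> 'o) list \<Rightarrow> 'm" where
  "two' ps = grid [True, False] ps (\<lambda>b p. if b then fst p else snd p)"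

lemma diag'_grid: "grid (replicate p ()) J (\<lambda>_. y) = diag' p (map y J)"
  by (simp add: diag'_def grid_def comp_def)

lemma diag'_hom: "set as \<subseteq> Ob C \<Longrightarrow>
    in_hom C (diag' p as) (tens T (replicate p (tens S as))) (tens S (map (\<lambda>a. tens T
        (replicate p a)) as))"
  using grid_hom [of "replicate p ()" as "\<lambda>_ a. a"] by (auto simp: diag'_def)

lemma monoid_interchange: "interchange (op_cat C) T S diag' two'"
proof (intro interchange.intro interchange_axioms.intro, unfold op_cat_simps in_hom_op op_op_cat)
  show "lax_plus_oplax_zero (op_cat C) T" by (rule T.lax_plus_oplax_zero_axioms)
  show "lax_plus_oplax_zero C S" by (rule S.lax_plus_oplax_zero_axioms)
next
  fix as :: "'o list" and p
  assume as: "set as \<subseteq> Ob C"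
  show "in_hom C (diag' p as) (tens T (replicate p (tens S as))) (tens S (map (\<lambda>a. tens T
      (replicate p a)) as))"
    by (rule diag'_hom [OF as])
next
  fix fs p
  assume "set fs \<subseteq> Arr C"
  then have "in_hom C f (Dom C f) (Cod C f)" if "f \<in> set fs" for f
    using that by (auto simp: in_hom_def)
  then show "tensm S (map (\<lambda>f. tensm T (replicate p f)) fs) \<cdot>\<^bsub>C\<^esub> diag' p (map (Dom C) fs) =
      diag' p (map (Cod C) fs) \<cdot>\<^bsub>C\<^esub> tensm T (replicate p (tensm S fs))"
    using grid_natural [of "replicate p ()" fs "\<lambda>_ f. f" "\<lambda>_. Dom C" "\<lambda>_. Cod C"]
    by (simp add: diag'_grid)
next
  fix ass :: "'o list list" and p
  assume ass: "set (concat ass) \<subseteq> Ob C"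
  have ob: "a \<in> Ob C" if "a \<in> set (concat ass)" for a using ass that by blast
  have s: "grid (replicate p ()) (slots ass) (\<lambda>_. case_option (tens S []) (\<lambda>a. a)) =
      diag' p (spread (tens S) ass)"
    by (simp only: diag'_grid slots_spread_id)
  have e: "\<xi> (length (replicate p ())) [] = diag' p []"
    by (simp add: diag'_def grid_def)
  show "(lax S (map (map (\<lambda>a. tens T (replicate p a))) ass) \<cdot>\<^bsub>C\<^esub> tensm S (map (diag' p) ass)) \<cdot>\<^bsub>C\<^esub>
      diag' p (map (tens S) ass) =
    (tensm S (spread (\<lambda>_. diag' p []) (map (map (\<lambda>a. Ide C (tens T (replicate p a)))) ass)) \<cdot>\<^bsub>C\<^esub>
      diag' p (spread (tens S) ass)) \<cdot>\<^bsub>C\<^esub> tensm T (replicate p (lax S ass))"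
    using grid_S_left(1) [of "replicate p ()" ass "\<lambda>_ a. a", OF ob] unfolding s e
    by (simp add: diag'_grid)
  show "opl S (map (map (\<lambda>a. tens T (replicate p a))) ass) \<cdot>\<^bsub>C\<^esub> diag' p (concat ass) =
    (tensm S (spread (\<lambda>_. diag' p []) (map (map (\<lambda>a. Ide C (tens T (replicate p a)))) ass)) \<cdot>\<^bsub>C\<^esub>
      diag' p (spread (tens S) ass)) \<cdot>\<^bsub>C\<^esub> tensm T (replicate p (opl S ass))"
    using grid_S_left(2) [of "replicate p ()" ass "\<lambda>_ a. a", OF ob] unfolding s e
    by (simp add: diag'_grid)
next
  fix a p
  assume "a \<in> Ob C"
  then show "unt S (tens T (replicate p a)) = diag' p [a] \<cdot>\<^bsub>C\<^esub> tensm T (replicate p (unt S a))"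
    using grid_unt_S [of "replicate p ()" "\<lambda>_. a"] by (simp add: diag'_def grid_def)
next
  show "two' (map (\<lambda>a. (a, a)) as) = diag' 2 as" for as
    by (simp add: two'_def diag'_def grid_def comp_def numeral_2_eq_2)
next
  fix ps :: "('o \<times> 'o) list"
  assume "set ps \<subseteq> Ob C \<times> Ob C"
  then have "(if b then fst p else snd p) \<in> Ob C" if "p \<in> set ps" for p b
    using that by (cases p) auto
  then show "in_hom C (two' ps) (tens T [tens S (map fst ps), tens S (map snd ps)])
      (tens S (map (\<lambda>(a, b). tens T [a, b]) ps))"
    using grid_hom [of "[True, False]" ps "\<lambda>b p. if b then fst p else snd p"]
    by (simp add: two'_def case_prod_unfold)
next
  fix fgs :: "('m \<times> 'm) list"
  assume "set fgs \<subseteq> Arr C \<times> Arr C"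
  then have "(if b then fst p else snd p) \<in> Arr C" if "p \<in> set fgs" for p b
    using that by (cases p) auto
  then show "tensm S (map (\<lambda>(f, g). tensm T [f, g]) fgs) \<cdot>\<^bsub>C\<^esub>
      two' (map (map_prod (Dom C) (Dom C)) fgs) =
      two' (map (map_prod (Cod C) (Cod C)) fgs) \<cdot>\<^bsub>C\<^esub>
          tensm T [tensm S (map fst fgs), tensm S (map snd fgs)]"
    using grid_natural [of "[True, False]" fgs "\<lambda>b p. if b then fst p else snd p"
      "\<lambda>b p. Dom C (if b then fst p else snd p)" "\<lambda>b p. Cod C (if b then fst p else snd p)"]
    by (simp add: two'_def grid_def case_prod_unfold in_hom_def comp_def)
next
  fix as :: "'o list"
  assume as: "set as \<subseteq> Ob C"
  have ob: "a \<in> Ob C" if "a \<in> set as" for a using as that by blast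
  have b: "tens S as \<in> Ob C" by (rule S.tens_ob [OF as])
  have d3: "in_hom C (diag' 3 as) (tens T [tens S as, tens S as, tens S as]) (tens S (map
      (\<lambda>a. tens T [a, a, a]) as))"
    using diag'_hom [OF as, of 3] by (simp add: numeral_3_eq_3)
  have i3: "diag' 3 as \<cdot>\<^bsub>C\<^esub> tensm T [Ide C (tens S as), Ide C (tens S as), Ide C (tens S as)] =
      diag' 3 as"
    using cmp_ide_tens [OF d3] b by simp
  have grids:
    "grid [Some (), Some (), Some ()] as (\<lambda>q a. case_option (tens T []) (\<lambda>_. a) q) = diag' 3 as"
    "grid [None, Some ()] as (\<lambda>q a. case_option (tens T []) (\<lambda>_. a) q) =
        two' (map (\<lambda>a. (tens T [], a)) as)"
    "grid [Some (), None] as (\<lambda>q a. case_option (tens T []) (\<lambda>_. a) q) =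
        two' (map (\<lambda>a. (a, tens T [])) as)"
    "grid [[(), ()], [()]] as (\<lambda>is a. tens T (map (\<lambda>_. a) is)) =
        two' (map (\<lambda>a. (tens T [a, a], tens T [a])) as)"
    "grid [[()], [(), ()]] as (\<lambda>is a. tens T (map (\<lambda>_. a) is)) =
        two' (map (\<lambda>a. (tens T [a], tens T [a, a])) as)"
    "grid [(), ()] as (\<lambda>_ a. a) = diag' 2 as" "grid [()] as (\<lambda>_ a. a) = diag' 1 as"
    "\<xi> 0 (map (\<lambda>_. []) as) = diag' 0 as"
    by (simp_all add: grid_def diag'_def two'_def comp_def numeral_2_eq_2 numeral_3_eq_3)
  have slots: "slots [[(), ()], [()]] = [Some (), Some (), Some ()]" "slots [[()], [(), ()]] =
      [Some (), Some (), Some ()]"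
    "slots [[], [()]] = [None, Some ()]" "slots [[()], []] = [Some (), None]"
    by (simp_all add: slots_def spread_Cons bracket_def)
  show "tensm S (map (\<lambda>a. lax T [[a, a], [a]]) as) \<cdot>\<^bsub>C\<^esub> diag' 3 as =
      (two' (map (\<lambda>a. (tens T [a, a], tens T [a])) as) \<cdot>\<^bsub>C\<^esub> tensm T [diag' 2 as, diag' 1 as]) \<cdot>\<^bsub>C\<^esub>
        lax T [[tens S as, tens S as], [tens S as]]"
    using grid_lax_T [of "[[(), ()], [()]]" as "\<lambda>_ a. a", OF ob] i3
    by (simp add: grids slots spread_Cons bracket_def)
  show "tensm S (map (\<lambda>a. lax T [[a], [a, a]]) as) \<cdot>\<^bsub>C\<^esub> diag' 3 as =
      (two' (map (\<lambda>a. (tens T [a], tens T [a, a])) as) \<cdot>\<^bsub>C\<^esub> tensm T [diag' 1 as, diag' 2 as]) \<cdot>\<^bsub>C\<^esub>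
        lax T [[tens S as], [tens S as, tens S as]]"
    using grid_lax_T [of "[[()], [(), ()]]" as "\<lambda>_ a. a", OF ob] i3
    by (simp add: grids slots spread_Cons bracket_def)
  show "(tensm S (map (\<lambda>a. opl T [[], [a]]) as) \<cdot>\<^bsub>C\<^esub> two' (map (\<lambda>a. (tens T [], a)) as)) \<cdot>\<^bsub>C\<^esub>
        tensm T [diag' 0 as, Ide C (tens S as)] = diag' 1 as \<cdot>\<^bsub>C\<^esub> opl T [[], [tens S as]]"
    using grid_opl_T_left [of "[[], [()]]" as "\<lambda>_ a. a", OF ob]
    by (simp add: grids slots spread_Cons bracket_def)
  show "(tensm S (map (\<lambda>a. opl T [[a], []]) as) \<cdot>\<^bsub>C\<^esub> two' (map (\<lambda>a. (a, tens T [])) as)) \<cdot>\<^bsub>C\<^esub>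
        tensm T [Ide C (tens S as), diag' 0 as] = diag' 1 as \<cdot>\<^bsub>C\<^esub> opl T [[tens S as], []]"
    using grid_opl_T_left [of "[[()], []]" as "\<lambda>_ a. a", OF ob]
    by (simp add: grids slots spread_Cons bracket_def)
  show "tensm S (map (unt T) as) \<cdot>\<^bsub>C\<^esub> diag' 1 as = unt T (tens S as)"
    using grid_unt_T [of as "\<lambda>a. a", OF ob] by (simp add: grids)
qed

end

section \<open>The categories of comonoids and of monoids\<close>

lemma alg_cat_simps:
  "Ob (alg_cat C X hm) = X"
  "Dom (alg_cat C X hm) = fst"
  "Cod (alg_cat C X hm) = (\<lambda>F. snd (snd F))"
  "Ide (alg_cat C X hm) x = (x, Ide C (fst x), x)"
  "Cmp (alg_cat C X hm) G F = (fst F, fst (snd G) \<cdot>\<^bsub>C\<^esub> fst (snd F), snd (snd G))"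
  by (simp_all add: alg_cat_def case_prod_unfold fun_eq_iff)

lemma alg_cat_Arr:
  "F \<in> Arr (alg_cat C X hm) \<longleftrightarrow> fst F \<in> X \<and> snd (snd F) \<in> X \<and>
    in_hom C (fst (snd F)) (fst (fst F)) (fst (snd (snd F))) \<and>
        hm (fst F) (fst (snd F)) (snd (snd F))"
  by (cases F) (simp add: alg_cat_def)

lemma in_hom_alg_cat:
  "in_hom (alg_cat C X hm) F x y \<longleftrightarrow> x \<in> X \<and> y \<in> X \<and>
    fst F = x \<and> snd (snd F) = y \<and> in_hom C (fst (snd F)) (fst x) (fst y) \<and> hm x (fst (snd F)) y"
  unfolding in_hom_def [of "alg_cat C X hm"] alg_cat_Arr by (auto simp: alg_cat_simps)

lemma category_alg_cat:
  assumes "category C" and X: "\<And>x. x \<in> X \<Longrightarrow> fst x \<in> Ob C"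
    and ide: "\<And>x. x \<in> X \<Longrightarrow> hm x (Ide C (fst x)) x"
    and cmp: "\<And>x y z f g. x \<in> X \<Longrightarrow> y \<in> X \<Longrightarrow> z \<in> X \<Longrightarrow>
      in_hom C f (fst x) (fst y) \<Longrightarrow> hm x f y \<Longrightarrow> in_hom C g (fst y) (fst z) \<Longrightarrow> hm y g z \<Longrightarrow>
      hm x (g \<cdot>\<^bsub>C\<^esub> f) z"
  shows "category (alg_cat C X hm)"
proof -
  interpret category C by fact
  show ?thesis
  proof
    fix F x y assume "in_hom (alg_cat C X hm) F x y"
    then show "Ide (alg_cat C X hm) y \<cdot>\<^bsub>alg_cat C X hm\<^esub> F = F"
      "F \<cdot>\<^bsub>alg_cat C X hm\<^esub> Ide (alg_cat C X hm) x = F"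
      by (auto simp: in_hom_alg_cat alg_cat_simps ide_left ide_right intro!: prod_eqI)
  next
    fix F G H w x y z
    assume "in_hom (alg_cat C X hm) F w x" "in_hom (alg_cat C X hm) G x y"
        "in_hom (alg_cat C X hm) H y z"
    then show "H \<cdot>\<^bsub>alg_cat C X hm\<^esub> G \<cdot>\<^bsub>alg_cat C X hm\<^esub> F =
        (H \<cdot>\<^bsub>alg_cat C X hm\<^esub> G) \<cdot>\<^bsub>alg_cat C X hm\<^esub> F"
      by (auto simp: in_hom_alg_cat alg_cat_simps intro!: assoc)
  next
    fix F G x y z
    assume "in_hom (alg_cat C X hm) F x y" "in_hom (alg_cat C X hm) G y z"
    then show "in_hom (alg_cat C X hm) (G \<cdot>\<^bsub>alg_cat C X hm\<^esub> F) x z"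
      by (auto simp: in_hom_alg_cat alg_cat_simps intro: cmp cmp_in_hom)
  qed (auto simp: alg_cat_Arr alg_cat_simps in_hom_alg_cat X ide ide_in_hom)
qed

text \<open>A monoid is a comonoid in the opposite category, and a homomorphism of monoids is one of
  comonoids in the other direction.\<close>

lemma monoid_hom_op: "monoid_hom C T x f y \<longleftrightarrow> comonoid_hom (op_cat C) T y f x"
  by (auto simp: monoid_hom_def comonoid_hom_alt case_prod_unfold)

lemma monoids_op:
  assumes "lax_plus_oplax_zero (op_cat C) T" and "category C"
  shows "monoids C T = comonoids (op_cat C) T"
proof -
  interpret T: lax_plus_oplax_zero "op_cat C" T by fact
  interpret C: category C by fact
  have "\<mu> \<cdot>\<^bsub>C\<^esub> tensm T [\<mu>, unt T a] \<cdot>\<^bsub>C\<^esub> lax T [[a, a], [a]] =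
      (\<mu> \<cdot>\<^bsub>C\<^esub> tensm T [\<mu>, unt T a]) \<cdot>\<^bsub>C\<^esub> lax T [[a, a], [a]]"
    "\<mu> \<cdot>\<^bsub>C\<^esub> tensm T [unt T a, \<mu>] \<cdot>\<^bsub>C\<^esub> lax T [[a], [a, a]] =
      (\<mu> \<cdot>\<^bsub>C\<^esub> tensm T [unt T a, \<mu>]) \<cdot>\<^bsub>C\<^esub> lax T [[a], [a, a]]"
    if a: "a \<in> Ob C" and mu: "in_hom C \<mu> (tens T [a, a]) a" for a \<mu>
  proof -
    have u: "in_hom C (unt T a) (tens T [a]) a" using T.unt_hom [of a] a by simp
    have t: "in_hom C (tensm T [\<mu>, unt T a]) (tens T [tens T [a, a], tens T [a]]) (tens T [a, a])"
      "in_hom C (tensm T [unt T a, \<mu>]) (tens T [tens T [a], tens T [a, a]]) (tens T [a, a])"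
      using T.tensm_two_hom [of \<mu> a _ "unt T a" a] T.tensm_two_hom [of "unt T a" a _ \<mu> a] u mu
          by simp_all
    have l: "in_hom C (lax T [[a, a], [a]]) (tens T [a, a, a]) (tens T [tens T [a, a], tens T [a]])"
      "in_hom C (lax T [[a], [a, a]]) (tens T [a, a, a]) (tens T [tens T [a], tens T [a, a]])"
      using T.lax_hom [of "[[a, a], [a]]"] T.lax_hom [of "[[a], [a, a]]"] a
      by (simp_all add: spread_Cons bracket_def)
    show "\<mu> \<cdot>\<^bsub>C\<^esub> tensm T [\<mu>, unt T a] \<cdot>\<^bsub>C\<^esub> lax T [[a, a], [a]] =
        (\<mu> \<cdot>\<^bsub>C\<^esub> tensm T [\<mu>, unt T a]) \<cdot>\<^bsub>C\<^esub> lax T [[a, a], [a]]"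
      by (rule C.assoc [OF l(1) t(1) mu])
    show "\<mu> \<cdot>\<^bsub>C\<^esub> tensm T [unt T a, \<mu>] \<cdot>\<^bsub>C\<^esub> lax T [[a], [a, a]] =
        (\<mu> \<cdot>\<^bsub>C\<^esub> tensm T [unt T a, \<mu>]) \<cdot>\<^bsub>C\<^esub> lax T [[a], [a, a]]"
      by (rule C.assoc [OF l(2) t(2) mu])
  qed
  then show ?thesis
    unfolding monoids_def comonoids_def by auto
qed

lemma concat_map_map_subset:
  assumes "set (concat xss) \<subseteq> X" and "f ` X \<subseteq> Y"
  shows "set (concat (map (map f) xss)) \<subseteq> Y"
proof -
  have "set (concat (map (map f) xss)) = f ` set (concat xss)" by auto
  also have "\<dots> \<subseteq> Y" using assms by blast
  finally show ?thesis .
qed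

context duoidal
begin

interpretation com: interchange C S T diag two
  by (rule comonoid_interchange)

interpretation mon: interchange "op_cat C" T S diag' two'
  by (rule monoid_interchange)

lemma comonoid_tens_eq: "comonoid_tens C T \<xi> = com.ctens"
  by (rule ext)
    (simp add: comonoid_tens_def com.ctens_def com.costr_def diag_def grid_def Let_def comp_def
        numeral_2_eq_2)

lemma monoid_tens_eq: "monoid_tens C S \<xi> = mon.ctens"
  by (rule ext)
    (simp add: monoid_tens_def mon.ctens_def mon.costr_def diag'_def grid_def Let_def comp_def
        numeral_2_eq_2
      map_replicate_const)

lemma monoids_eq: "monoids C T = comonoids (op_cat C) T"
  by (rule monoids_op) unfold_locales

theorem comonoids_lax_zero_oplax_plus:
  "lax_zero_oplax_plus (comonoid_cat C S) (comonoid_str C T \<xi>)"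
proof -
  let ?A = "op_cat (comonoid_cat C S)" and ?R = "comonoid_str C T \<xi>"
  have cat: "category (comonoid_cat C S)"
    by (rule category_alg_cat)
      (auto intro: S.category_axioms comonoidD(1) S.comonoid_hom_ide S.comonoid_hom_cmp)
  have R: "tens ?R = com.ctens"
    "tensm ?R fs = (com.ctens (map fst fs), tensm T (map (\<lambda>f. fst (snd f)) fs), com.ctens (map
        (\<lambda>f. snd (snd f)) fs))"
    "lax ?R xss = (com.ctens (spread com.ctens xss), lax T (map (map fst) xss), com.ctens
        (map com.ctens xss))"
    "opl ?R xss = (com.ctens (spread com.ctens xss), opl T (map (map fst) xss), com.ctens
        (concat xss))"
    "unt ?R x = (com.ctens [x], unt T (fst x), x)" for fs xss x
    by (simp_all add: comonoid_str_def Let_def comonoid_tens_eq comp_def)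
  have hom_A: "in_hom ?A F y x \<longleftrightarrow> x \<in> comonoids C S \<and> y \<in> comonoids C S \<and> fst F = x \<and> snd (snd F) =
      y \<and>
      in_hom C (fst (snd F)) (fst x) (fst y) \<and> comonoid_hom C S x (fst (snd F)) y" for F x y
    by (simp add: in_hom_alg_cat)
  have sub: "fst ` comonoids C S \<subseteq> Ob C" using comonoidD(1) by fastforce
  have ob: "set (concat (map (map fst) xss)) \<subseteq> Ob C" if "set (concat xss) \<subseteq> comonoids C S" for xss
    by (rule concat_map_map_subset [OF that sub])
  have tc: "set (map com.ctens xss) \<subseteq> comonoids C S" if "set (concat xss) \<subseteq> comonoids C S" for xss
    using com.ctens_comonoid [OF set_concat_subset [OF that]] by auto
  have Arr_A: "fst F \<in> comonoids C S" "snd (snd F) \<in> comonoids C S"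
      "in_hom C (fst (snd F)) (fst (fst F)) (fst (snd (snd F)))"
      "comonoid_hom C S (fst F) (fst (snd F)) (snd (snd F))"
    if "set fs \<subseteq> Arr (comonoid_cat C S)" "F \<in> set fs" for F fs
    using subsetD [OF that] unfolding alg_cat_Arr by blast+
  have "strict_lift (op_cat C) T ?A ?R fst (\<lambda>F. fst (snd F))"
  proof (intro strict_lift.intro strict_lift_axioms.intro)
    show "lax_plus_oplax_zero (op_cat C) T" by (rule T.lax_plus_oplax_zero_axioms)
    show "category ?A" unfolding category_op_iff by (rule cat)
    fix x assume x: "x \<in> Ob ?A"
    then have x': "x \<in> comonoids C S" by (simp add: alg_cat_simps)
    then show "fst x \<in> Ob (op_cat C)" using comonoidD(1) by simp
    show "fst (snd (Ide ?A x)) = Ide (op_cat C) (fst x)" by (simp add: alg_cat_simps)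
    show "in_hom ?A (unt ?R x) x (tens ?R [x])"
      unfolding hom_A R using com.unt_comonoid_hom [OF x'] com.ctens_comonoid [of "[x]"] x'
        com.T_unt_hom [OF comonoidD(1) [OF x']] by (simp add: com.fst_ctens)
    show "fst (snd (unt ?R x)) = unt T (fst x)" by (simp add: R)
  next
    fix F x y assume "in_hom ?A F x y"
    then show "in_hom (op_cat C) (fst (snd F)) (fst x) (fst y)" unfolding hom_A by simp
    fix G z assume "in_hom ?A G y z"
    show "fst (snd (G \<cdot>\<^bsub>?A\<^esub> F)) = fst (snd G) \<cdot>\<^bsub>op_cat C\<^esub> fst (snd F)"
      by (simp add: alg_cat_simps)
  next
    fix F G x y assume "in_hom ?A F x y" "in_hom ?A G x y" "fst (snd F) = fst (snd G)"
    then show "F = G" unfolding hom_A by (auto intro!: prod_eqI)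
  next
    fix xs assume xs: "set xs \<subseteq> Ob ?A"
    show "tens ?R xs \<in> Ob ?A"
      using com.ctens_comonoid [of xs] xs by (simp add: R alg_cat_simps)
    show "fst (tens ?R xs) = tens T (map fst xs)" by (simp add: R com.fst_ctens)
  next
    fix fs assume "set fs \<subseteq> Arr ?A"
    then have fs: "set fs \<subseteq> Arr (comonoid_cat C S)" by simp
    note F = Arr_A [OF fs]
    have "com.ctens (map fst fs) \<in> comonoids C S"
        "com.ctens (map (\<lambda>F. snd (snd F)) fs) \<in> comonoids C S"
      by (rule com.ctens_comonoid; use F in fastforce)+
    moreover have "comonoid_hom C S (com.ctens (map fst fs)) (tensm T (map (\<lambda>F. fst (snd F)) fs))
        (com.ctens (map (\<lambda>F. snd (snd F)) fs))"
      by (rule com.tensm_comonoid_hom) (use F in blast)+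
    moreover have "in_hom C (tensm T (map (\<lambda>F. fst (snd F)) fs)) (tens T (map (\<lambda>F. fst (fst F)) fs))
        (tens T (map (\<lambda>F. fst (snd (snd F))) fs))"
      by (rule com.T_hom) (use F in blast)
    ultimately show "in_hom ?A (tensm ?R fs) (tens ?R (map (Dom ?A) fs)) (tens ?R (map
        (Cod ?A) fs))"
      unfolding hom_A R by (simp add: com.fst_ctens comp_def alg_cat_simps)
    show "fst (snd (tensm ?R fs)) = tensm T (map (\<lambda>F. fst (snd F)) fs)" by (simp add: R)
  next
    fix xss assume "set (concat xss) \<subseteq> Ob ?A"
    then have xss: "set (concat xss) \<subseteq> comonoids C S" by (simp only: op_cat_simps alg_cat_simps)
    note t = com.ctens_comonoid [OF com.spread_comonoids [OF xss]] com.ctens_comonoid [OF tc [OF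
        xss]]
      com.ctens_comonoid [OF xss]
    show "in_hom ?A (lax ?R xss) (tens ?R (map (tens ?R) xss)) (tens ?R (spread (tens ?R) xss))"
      unfolding hom_A R using t com.lax_comonoid_hom [OF xss] com.T_lax_hom [OF ob [OF xss]]
      by (simp add: com.fst_ctens com.ctens_spread comp_def)
    show "in_hom ?A (opl ?R xss) (tens ?R (concat xss)) (tens ?R (spread (tens ?R) xss))"
      unfolding hom_A R using t com.opl_comonoid_hom [OF xss] com.T_opl_hom [OF ob [OF xss]]
      by (simp add: com.fst_ctens com.ctens_spread comp_def map_concat)
    show "fst (snd (lax ?R xss)) = lax T (map (map fst) xss)" "fst (snd (opl ?R xss)) =
        opl T (map (map fst) xss)"
      by (simp_all add: R)
  qed
  then show ?thesis
    unfolding lax_zero_oplax_plus_def by (rule strict_lift.lax_plus_oplax_zero_lifts)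
qed

theorem monoids_lax_plus_oplax_zero:
  "lax_plus_oplax_zero (monoid_cat C T) (monoid_str C S \<xi>)"
proof -
  let ?A = "monoid_cat C T" and ?R = "monoid_str C S \<xi>"
  let ?M = "comonoids (op_cat C) T"
  have cat: "category ?A"
  proof (rule category_alg_cat, unfold monoids_eq monoid_hom_op)
    show "category C" by (rule S.category_axioms)
    show "fst x \<in> Ob C" if "x \<in> ?M" for x using comonoidD(1) [OF that] by simp
    show "comonoid_hom (op_cat C) T x (Ide C (fst x)) x" if "x \<in> ?M" for x
      using T.comonoid_hom_ide [OF that] by simp
    show "comonoid_hom (op_cat C) T z (g \<cdot>\<^bsub>C\<^esub> f) x"
      if "x \<in> ?M" "y \<in> ?M" "z \<in> ?M" "in_hom C f (fst x) (fst y)" "comonoid_hom (op_cat C) T y f x"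
        "in_hom C g (fst y) (fst z)" "comonoid_hom (op_cat C) T z g y" for x y z f g
      using T.comonoid_hom_cmp [of z y x g f] that by simp
  qed
  have R: "tens ?R = mon.ctens"
    "tensm ?R fs = (mon.ctens (map fst fs), tensm S (map (\<lambda>f. fst (snd f)) fs), mon.ctens (map
        (\<lambda>f. snd (snd f)) fs))"
    "lax ?R xss = (mon.ctens (map mon.ctens xss), lax S (map (map fst) xss), mon.ctens
        (spread mon.ctens xss))"
    "opl ?R xss = (mon.ctens (concat xss), opl S (map (map fst) xss), mon.ctens
        (spread mon.ctens xss))"
    "unt ?R x = (x, unt S (fst x), mon.ctens [x])" for fs xss x
    by (simp_all add: monoid_str_def Let_def monoid_tens_eq comp_def)
  have hom_A: "in_hom ?A F x y \<longleftrightarrow> x \<in> ?M \<and> y \<in> ?M \<and> fst F = x \<and> snd (snd F) = y \<and>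
      in_hom C (fst (snd F)) (fst x) (fst y) \<and>
          comonoid_hom (op_cat C) T y (fst (snd F)) x" for F x y
    by (simp add: in_hom_alg_cat monoids_eq monoid_hom_op)
  have sub: "fst ` ?M \<subseteq> Ob C" using comonoidD(1) by fastforce
  have ob: "set (concat (map (map fst) xss)) \<subseteq> Ob C" if "set (concat xss) \<subseteq> ?M" for xss
    by (rule concat_map_map_subset [OF that sub])
  have tc: "set (map mon.ctens xss) \<subseteq> ?M" if "set (concat xss) \<subseteq> ?M" for xss
    using mon.ctens_comonoid [OF set_concat_subset [OF that]] by auto
  have Arr_A: "fst F \<in> ?M" "snd (snd F) \<in> ?M"
      "in_hom C (fst (snd F)) (fst (fst F)) (fst (snd (snd F)))"
      "comonoid_hom (op_cat C) T (snd (snd F)) (fst (snd F)) (fst F)"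
    if "set fs \<subseteq> Arr ?A" "F \<in> set fs" for F fs
    using subsetD [OF that] unfolding alg_cat_Arr monoids_eq monoid_hom_op by blast+
  have "strict_lift C S ?A ?R fst (\<lambda>F. fst (snd F))"
  proof (intro strict_lift.intro strict_lift_axioms.intro)
    show "lax_plus_oplax_zero C S" by (rule S.lax_plus_oplax_zero_axioms)
    show "category ?A" by (rule cat)
    fix x assume x: "x \<in> Ob ?A"
    then have x': "x \<in> ?M" by (simp add: alg_cat_simps monoids_eq)
    then show xo: "fst x \<in> Ob C" using comonoidD(1) by fastforce
    show "fst (snd (Ide ?A x)) = Ide C (fst x)" by (simp add: alg_cat_simps)
    show "in_hom ?A (unt ?R x) x (tens ?R [x])"
      unfolding hom_A R using mon.unt_comonoid_hom [OF x'] mon.ctens_comonoid [of "[x]"] x'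
        S.unt_hom [OF xo] by (simp add: mon.fst_ctens)
    show "fst (snd (unt ?R x)) = unt S (fst x)" by (simp add: R)
  next
    fix F x y assume "in_hom ?A F x y"
    then show "in_hom C (fst (snd F)) (fst x) (fst y)" unfolding hom_A by simp
    fix G z assume "in_hom ?A G y z"
    show "fst (snd (G \<cdot>\<^bsub>?A\<^esub> F)) = fst (snd G) \<cdot>\<^bsub>C\<^esub> fst (snd F)"
      by (simp add: alg_cat_simps)
  next
    fix F G x y assume "in_hom ?A F x y" "in_hom ?A G x y" "fst (snd F) = fst (snd G)"
    then show "F = G" unfolding hom_A by (auto intro!: prod_eqI)
  next
    fix xs assume xs: "set xs \<subseteq> Ob ?A"
    show "tens ?R xs \<in> Ob ?A"
      using mon.ctens_comonoid [of xs] xs by (simp add: R alg_cat_simps monoids_eq)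
    show "fst (tens ?R xs) = tens S (map fst xs)" by (simp add: R mon.fst_ctens)
  next
    fix fs assume fs: "set fs \<subseteq> Arr ?A"
    note F = Arr_A [OF fs]
    have "mon.ctens (map fst fs) \<in> ?M" "mon.ctens (map (\<lambda>F. snd (snd F)) fs) \<in> ?M"
      by (rule mon.ctens_comonoid; use F in fastforce)+
    moreover have "comonoid_hom (op_cat C) T (mon.ctens (map (\<lambda>F. snd (snd F)) fs)) (tensm S (map
        (\<lambda>F. fst (snd F)) fs)) (mon.ctens (map fst fs))"
      by (rule mon.tensm_comonoid_hom) (use F in \<open>unfold in_hom_op, blast\<close>)+
    moreover have "in_hom C (tensm S (map (\<lambda>F. fst (snd F)) fs)) (tens S (map (\<lambda>F. fst (fst F)) fs))
        (tens S (map (\<lambda>F. fst (snd (snd F))) fs))"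
      by (rule S.tensm_hom) (use F in blast)
    ultimately show "in_hom ?A (tensm ?R fs) (tens ?R (map (Dom ?A) fs)) (tens ?R (map
        (Cod ?A) fs))"
      unfolding hom_A R by (simp add: mon.fst_ctens comp_def alg_cat_simps)
    show "fst (snd (tensm ?R fs)) = tensm S (map (\<lambda>F. fst (snd F)) fs)" by (simp add: R)
  next
    fix xss assume "set (concat xss) \<subseteq> Ob ?A"
    then have xss: "set (concat xss) \<subseteq> ?M" by (simp only: monoids_eq alg_cat_simps)
    note t = mon.ctens_comonoid [OF mon.spread_comonoids [OF xss]] mon.ctens_comonoid [OF tc [OF
        xss]]
      mon.ctens_comonoid [OF xss]
    show "in_hom ?A (lax ?R xss) (tens ?R (map (tens ?R) xss)) (tens ?R (spread (tens ?R) xss))"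
      unfolding hom_A R using t mon.lax_comonoid_hom [OF xss] S.lax_hom [OF ob [OF xss]]
      by (simp add: mon.fst_ctens mon.ctens_spread comp_def)
    show "in_hom ?A (opl ?R xss) (tens ?R (concat xss)) (tens ?R (spread (tens ?R) xss))"
      unfolding hom_A R using t mon.opl_comonoid_hom [OF xss] S.opl_hom [OF ob [OF xss]]
      by (simp add: mon.fst_ctens mon.ctens_spread comp_def map_concat)
    show "fst (snd (lax ?R xss)) = lax S (map (map fst) xss)" "fst (snd (opl ?R xss)) =
        opl S (map (map fst) xss)"
      by (simp_all add: R)
  qed
  then show ?thesis
    by (rule strict_lift.lax_plus_oplax_zero_lifts)
qed

end

theorem theorem7p4:
  fixes C :: "('o, 'm) cat"
    and S T :: "('o, 'm) str"
    and \<xi> :: "nat \<Rightarrow> 'o list list \<Rightarrow> 'm"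
  assumes "duoidal C S T \<xi>"
  shows "lax_zero_oplax_plus (comonoid_cat C S) (comonoid_str C T \<xi>) \<and>
         lax_plus_oplax_zero (monoid_cat C T) (monoid_str C S \<xi>)"
  using duoidal.comonoids_lax_zero_oplax_plus [OF assms] duoidal.monoids_lax_plus_oplax_zero [OF
      assms]
  by blast

end
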